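(* Suppose that, for any rational space $(X,\Lambda)$ with a rational inner product $Q$, any rational subspace $L$ of $X$, any unimodular cone $C$ in $X/L$ and any non-negative integer $n$ with $n\ge\dim(C)$, there is given a homogeneous differential operator $\mathcal{D}_n^X(C)$ on $X$ of order $n-\dim(C)$ with symbol $\nu_n^X(C)$ such that: (1) If $C\subset X/L$, then $\nu_n^X(C)=p_L^*\,\nu_n^{X/L}(C)$, where $p_L:X^*\to(X/L)^*$ is the orthogonal projection. (2) If $C\subset X$ with $\dim(C)<\dim(X)$, then $\nu_n^X(C)=({}^t\iota_C)^*\,\nu_n^{L(C)}(C)$, where ${}^t\iota_C:X^*\to L(C)^*$ is the transpose of the inclusion $\iota_C:L(C)\hookrightarrow X$. (3) When $\dim(X)=0$, $\mathcal{D}_0^X(\{0\})=1$ and $\mathcal{D}_n^X(\{0\})=0$ for $n\ge1$. When $\dim(X)=1$ and $C=\mathbb{R}_+u$ with a generator $u$ of $\Lambda$, $\mathcal{D}_n^X(C)=-\frac{b_n}{n!}\nabla_u^{n-1}$ for $n\ge1$. (4) For any unimodular cone $C\subset X$ and any Schwartz function $\varphi\in\mathcal{S}(X)$, $$R_N(C;\varphi)\sim\sum_{n\ge0}N^{-n}\sum_{F\in\mathcal{F}(C),\ \dim(F)\ge\dim(C)-n}\int_F\mathcal{D}_n^X(\pi_F(C))\varphi\qquad(N\to\infty).$$ Then $\nu_n^X(C)=\mu_X^{n-\dim(C)}(C)$ for any such $X$, $C$ and $n$ with $n-\dim(C)\ge0$.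
   Context: Rational spaces. A rational space $(X,\Lambda)$ is a finite-dimensional real vector space $X$ with a lattice $\Lambda$; a point $x$ is rational if $qx\in\Lambda$ for some nonzero integer $q$. An inner product $Q$ is rational if $Q(x,y)\in\mathbb{Q}$ for all rational $x,y$; $Q$ also denotes the induced inner product on $X^*$. A subspace $L$ is rational if $L\cap\Lambda$ is a lattice in $L$; $L$ is then a rational space (with restricted inner product), and $X/L$ is a rational space with lattice $\pi_L(\Lambda)$, $\pi_L:X\to X/L$ the projection, and with the rational inner product obtained by identifying $X/L$ with the orthogonal complement $L^{\perp_Q}$. $(X/L)^*$ is identified with the annihilator $L^\perp\subset X^*$, and $p_L:X^*\to(X/L)^*$ is the orthogonal projection. A rational subspace $L$ carries the Lebesgue measure for which a fundamental domain of $L\cap\Lambda$ has measure $1$, its affine translates carry the translated measure, and every integral over a set is with respect to this measure on its affine hull (evaluation, for a point). For $S\subset X$, $\langle S\rangle$ is the affine hull and $L(S)$ the linear span of $\{y-x:x,y\in S\}$. $\mathcal{F}(P)$ is the set of non-empty faces of a polyhedron $P$ (including $P$); for a face $f$, $\pi_f=\pi_{L(f)}$, $p_f=p_{L(f)}$. A rational cone is a cone generated by finitely many elements of the lattice; it is pointed if $C\cap(-C)=\{0\}$, and unimodular if it is generated by a subset of an integral basis ($\mathbb{Z}$-basis) of the lattice. A rational affine cone is a set $s+C$ with $s$ rational and $C$ a rational cone. $\nabla_u$ is the derivative in direction $u$. Operators have constant coefficients; the symbol of $D$ is $\sigma(D)(\xi)=e^{-\langle\xi,x\rangle}D\,e^{\langle\xi,x\rangle}$.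 The numbers $b_n$ are defined by $\frac{z}{e^z-1}=\sum_{n\ge0}\frac{b_n}{n!}z^n$. The polynomials $\mu_X^k$. For a rational polyhedron $P$ let $S(P)(\xi)=\sum_{\gamma\in P\cap\Lambda}e^{\langle\xi,\gamma\rangle}$ and $I(P)(\xi)=\int_Pe^{\langle\xi,x\rangle}$, understood as meromorphic functions on $X^*$ (by continuation from where they converge absolutely; both are $0$ if $P$ contains a straight line); similarly on rational quotients. For a face $f$ of $P$, $C_P(f)$ is the cone generated by the vectors $y-x$, $y\in P$, $x\in f$, and $\mathfrak{t}(P,f)=\pi_f(\langle f\rangle+C_P(f))\subset X/L(f)$. By a theorem of Berline and Vergne there is a unique family of maps $\mu_W$, indexed by the rational quotient spaces $W$ of $X$, assigning to each rational affine cone $\mathfrak{a}$ in $W$ a function $\mu_W(\mathfrak{a})$ analytic near $0\in W^*$ with rational Taylor coefficients, such that: $\mu_{\{0\}}(\{0\})=1$; $\mu_W(\mathfrak{a})=0$ if $\mathfrak{a}$ contains a straight line; and $S(\mathfrak{a})(\xi)=\sum_{F\in\mathcal{F}(\mathfrak{a})}\mu_{W/L(F)}(\mathfrak{t}(\mathfrak{a},F))(\xi)\,I(F)(\xi)$, where functions on $(W/L(F))^*$ are pulled back to $W^*$ by orthogonal projection. For a pointed rational affine cone $\mathfrak{a}$ in $X/L$, $\mu^k_{X/L}(\mathfrak{a})$ is the degree-$k$ homogeneous part of the Taylor expansion of $\mu_{X/L}(\mathfrak{a})$ at $0$, and $\mu^k_X(\mathfrak{a})=p_L^*\mu^k_{X/L}(\mathfrak{a})$.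 Riemann sums. $R_N(C;\varphi)=N^{-\dim(C)}\sum_{\gamma\in C\cap\Lambda}\varphi(\gamma/N)$ for positive integers $N$. $R_N\sim\sum_{n\ge0}a_nN^{-n}$ means $R_N-\sum_{n<M}a_nN^{-n}=O(N^{-M})$ as $N\to\infty$ for every $M\ge1$. *)

theory Defs
  imports
    "HOL-Analysis.Analysis"
    "HOL-Library.Landau_Symbols"
    "HOL-Computational_Algebra.Formal_Power_Series"
begin

section \<open>Rational spaces\<close>

text \<open>
  A rational space is a finite-dimensional linear subspace of an arbitrary ambient real vector
  space \<^typ>\<open>'a\<close>, together with a lattice and an inner product.  Every rational space arises in
  this way (as a subspace of itself), and the rational spaces inside a fixed ambient space are closed
  under passing to rational subspaces and, with the identification made below, to quotients.
  The ambient space carries no topology or inner product.  Only the values of \<open>ip\<close> on \<open>vs\<close> are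
  constrained.
\<close>

record 'a ratspace =
  vs :: "'a set"
  lat :: "'a set"
  ip :: "'a \<Rightarrow> 'a \<Rightarrow> real"

definition int_span :: "'a::real_vector set \<Rightarrow> 'a set" where
  "int_span B = {\<Sum>b\<in>B. of_int (k b) *\<^sub>R b | k :: 'a \<Rightarrow> int. True}"

definition is_zbasis :: "'a::real_vector set \<Rightarrow> 'a set \<Rightarrow> bool" where
  "is_zbasis B \<Lambda> \<longleftrightarrow> finite B \<and> independent B \<and> \<Lambda> = int_span B"

definition is_lattice :: "'a::real_vector set \<Rightarrow> 'a set \<Rightarrow> bool" where
  "is_lattice \<Lambda> V \<longleftrightarrow> (\<exists>B. is_zbasis B \<Lambda> \<and> span B = V)"

definition rational_point :: "('a::real_vector) ratspace \<Rightarrow> 'a \<Rightarrow> bool" where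
  "rational_point X x \<longleftrightarrow> x \<in> vs X \<and> (\<exists>q::int. q \<noteq> 0 \<and> of_int q *\<^sub>R x \<in> lat X)"

definition inner_product_on :: "'a::real_vector set \<Rightarrow> ('a \<Rightarrow> 'a \<Rightarrow> real) \<Rightarrow> bool" where
  "inner_product_on V Q \<longleftrightarrow>
     (\<forall>x\<in>V. \<forall>y\<in>V. Q x y = Q y x) \<and>
     (\<forall>x\<in>V. \<forall>y\<in>V. \<forall>z\<in>V. Q (x + y) z = Q x z + Q y z) \<and>
     (\<forall>x\<in>V. \<forall>y\<in>V. \<forall>r. Q (r *\<^sub>R x) y = r * Q x y) \<and>
     (\<forall>x\<in>V. x \<noteq> 0 \<longrightarrow> Q x x > 0)"

definition rational_space :: "('a::real_vector) ratspace \<Rightarrow> bool" where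
  "rational_space X \<longleftrightarrow> is_lattice (lat X) (vs X) \<and> inner_product_on (vs X) (ip X) \<and>
     (\<forall>x y. rational_point X x \<longrightarrow> rational_point X y \<longrightarrow> ip X x y \<in> \<rat>)"

definition rational_subspace :: "('a::real_vector) ratspace \<Rightarrow> 'a set \<Rightarrow> bool" where
  "rational_subspace X L \<longleftrightarrow> subspace L \<and> L \<subseteq> vs X \<and> is_lattice (L \<inter> lat X) L"

definition subsp :: "'a ratspace \<Rightarrow> 'a set \<Rightarrow> 'a ratspace" where
  "subsp X L = X\<lparr>vs := L, lat := L \<inter> lat X\<rparr>"

definition perp :: "'a ratspace \<Rightarrow> 'a set \<Rightarrow> 'a set" where
  "perp X L = {x \<in> vs X. \<forall>l\<in>L. ip X x l = 0}"

text \<open>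
  The quotient \<open>X/L\<close> is identified with the orthogonal complement of \<open>L\<close>; under this identification
  the projection \<open>X \<rightarrow> X/L\<close> is the orthogonal projection.
\<close>

definition qproj :: "('a::real_vector) ratspace \<Rightarrow> 'a set \<Rightarrow> 'a \<Rightarrow> 'a" where
  "qproj X L x = (THE y. y \<in> perp X L \<and> x - y \<in> L)"

definition quot :: "('a::real_vector) ratspace \<Rightarrow> 'a set \<Rightarrow> 'a ratspace" where
  "quot X L = X\<lparr>vs := perp X L, lat := qproj X L ` lat X\<rparr>"


section \<open>The dual space\<close>

text \<open>
  Complexified dual: the real-linear functionals \<open>X \<rightarrow> \<complex>\<close>.  They are functions on the ambient
  space of which only the values on \<open>vs X\<close> matter, so an element of \<open>dual X\<close> is at the same time (by
  restriction) an element of \<open>dual (subsp X L)\<close>; this restriction is the transpose of the inclusion.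
\<close>

definition dual :: "('a::real_vector) ratspace \<Rightarrow> ('a \<Rightarrow> complex) set" where
  "dual X = {\<xi>. (\<forall>x\<in>vs X. \<forall>y\<in>vs X. \<xi> (x + y) = \<xi> x + \<xi> y) \<and>
               (\<forall>x\<in>vs X. \<forall>r. \<xi> (r *\<^sub>R x) = r *\<^sub>R \<xi> x)}"

text \<open>
  The orthogonal projection of the dual onto the annihilator of \<open>L\<close>, which is identified with the
  dual of \<open>X/L\<close>.  For \<open>\<xi> = Q(v,\<cdot>)\<close> the projection is \<open>Q(\<pi>v,\<cdot>)\<close>, where \<open>\<pi>\<close> is the orthogonal
  projection along \<open>L\<close>, and this is \<open>\<xi> \<circ> \<pi>\<close>; see \<open>ip_qproj_left\<close> below.
\<close>

definition dproj :: "('a::real_vector) ratspace \<Rightarrow> 'a set \<Rightarrow> ('a \<Rightarrow> complex) \<Rightarrow> ('a \<Rightarrow> complex)" where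
  "dproj X L \<xi> = \<xi> \<circ> qproj X L"


section \<open>Cones, faces and dimension\<close>

definition lin :: "'a::real_vector set \<Rightarrow> 'a set" where
  "lin S = span {y - x | x y. x \<in> S \<and> y \<in> S}"

definition cdim :: "'a::real_vector set \<Rightarrow> nat" where
  "cdim S = dim (lin S)"

definition rational_cone :: "('a::real_vector) ratspace \<Rightarrow> 'a set \<Rightarrow> bool" where
  "rational_cone X C \<longleftrightarrow> (\<exists>V. finite V \<and> V \<subseteq> lat X \<and> C = convex_cone hull V)"

definition unimodular_cone :: "('a::real_vector) ratspace \<Rightarrow> 'a set \<Rightarrow> bool" where
  "unimodular_cone X C \<longleftrightarrow> (\<exists>B V. is_zbasis B (lat X) \<and> V \<subseteq> B \<and> C = convex_cone hull V)"

definition rational_affine_cone :: "('a::real_vector) ratspace \<Rightarrow> 'a set \<Rightarrow> bool" where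
  "rational_affine_cone X A \<longleftrightarrow>
     (\<exists>s C. rational_point X s \<and> rational_cone X C \<and> A = (\<lambda>x. s + x) ` C)"

definition contains_line :: "'a::real_vector set \<Rightarrow> bool" where
  "contains_line S \<longleftrightarrow> (\<exists>x v. v \<noteq> 0 \<and> (\<forall>t::real. x + t *\<^sub>R v \<in> S))"

definition faces :: "'a::real_vector set \<Rightarrow> 'a set set" where
  "faces P = {F. F face_of P \<and> F \<noteq> {}}"

definition tangent_cone :: "'a::real_vector set \<Rightarrow> 'a set \<Rightarrow> 'a set" where
  "tangent_cone P F = convex_cone hull {y - x | x y. y \<in> P \<and> x \<in> F}"

definition transverse_cone :: "('a::real_vector) ratspace \<Rightarrow> 'a set \<Rightarrow> 'a set \<Rightarrow> 'a set" where
  "transverse_cone X P F =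
     qproj X (lin F) ` {a + c | a c. a \<in> affine hull F \<and> c \<in> tangent_cone P F}"


section \<open>Lattice-normalised Lebesgue measure\<close>

definition zbasis :: "'a::real_vector set \<Rightarrow> 'a set" where
  "zbasis \<Lambda> = (SOME B. is_zbasis B \<Lambda>)"

text \<open>
  The measure on the affine hull of \<open>S\<close>: the image of Lebesgue measure on \<open>\<real>\<^sup>B\<close> under the affine
  parametrisation given by a \<open>\<int>\<close>-basis \<open>B\<close> of the lattice of \<open>lin S\<close> and a point of \<open>S\<close>.  If
  \<open>S\<close> is a point, then \<open>B\<close> is empty and this is the Dirac measure.
\<close>

definition aff_measure :: "('a::real_vector) ratspace \<Rightarrow> 'a set \<Rightarrow> 'a measure" where
  "aff_measure X S =
     (let B = zbasis (lin S \<inter> lat X); s = (SOME s. s \<in> S)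
      in embed_measure (\<Pi>\<^sub>M b\<in>B. lborel) (\<lambda>t. s + (\<Sum>b\<in>B. t b *\<^sub>R b)))"

definition poly_integral :: "('a::real_vector) ratspace \<Rightarrow> 'a set \<Rightarrow> ('a \<Rightarrow> complex) \<Rightarrow> complex" where
  "poly_integral X S f = set_lebesgue_integral (aff_measure X S) S f"


section \<open>Analytic and meromorphic functions on the dual\<close>

definition multi_idx :: "('a::real_vector) ratspace \<Rightarrow> ('a \<Rightarrow> nat) set" where
  "multi_idx X = (\<Pi>\<^sub>E b\<in>zbasis (lat X). UNIV)"

definition dmonom :: "('a::real_vector) ratspace \<Rightarrow> ('a \<Rightarrow> nat) \<Rightarrow> ('a \<Rightarrow> complex) \<Rightarrow> complex" where
  "dmonom X \<alpha> \<xi> = (\<Prod>b\<in>zbasis (lat X). \<xi> b ^ \<alpha> b)"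

definition near0 :: "('a::real_vector) ratspace \<Rightarrow> (('a \<Rightarrow> complex) \<Rightarrow> bool) \<Rightarrow> bool" where
  "near0 X P \<longleftrightarrow> (\<exists>r>0. \<forall>\<xi>\<in>dual X. (\<forall>b\<in>zbasis (lat X). norm (\<xi> b) < r) \<longrightarrow> P \<xi>)"

definition is_taylor ::
  "('a::real_vector) ratspace \<Rightarrow> (('a \<Rightarrow> complex) \<Rightarrow> complex) \<Rightarrow> (('a \<Rightarrow> nat) \<Rightarrow> complex) \<Rightarrow> bool" where
  "is_taylor X f c \<longleftrightarrow> near0 X (\<lambda>\<xi>. ((\<lambda>\<alpha>. c \<alpha> * dmonom X \<alpha> \<xi>) has_sum f \<xi>) (multi_idx X))"

definition analytic_at0_rat :: "('a::real_vector) ratspace \<Rightarrow> (('a \<Rightarrow> complex) \<Rightarrow> complex) \<Rightarrow> bool" where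
  "analytic_at0_rat X f \<longleftrightarrow> (\<exists>c. is_taylor X f c \<and> (\<forall>\<alpha>\<in>multi_idx X. c \<alpha> \<in> \<rat>))"

definition hom_part ::
  "('a::real_vector) ratspace \<Rightarrow> nat \<Rightarrow> (('a \<Rightarrow> complex) \<Rightarrow> complex) \<Rightarrow> ('a \<Rightarrow> complex) \<Rightarrow> complex" where
  "hom_part X k f \<xi> =
     (\<Sum>\<alpha> | \<alpha> \<in> multi_idx X \<and> (\<Sum>b\<in>zbasis (lat X). \<alpha> b) = k.
        (SOME c. is_taylor X f c) \<alpha> * dmonom X \<alpha> \<xi>)"

definition entire_on_dual :: "('a::real_vector) ratspace \<Rightarrow> (('a \<Rightarrow> complex) \<Rightarrow> complex) \<Rightarrow> bool" where
  "entire_on_dual X g \<longleftrightarrow>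
     (\<exists>c. \<forall>\<xi>\<in>dual X. ((\<lambda>\<alpha>. c \<alpha> * dmonom X \<alpha> \<xi>) has_sum g \<xi>) (multi_idx X))"

text \<open>
  A meromorphic function on the complexified dual is a quotient \<open>g/h\<close> of entire functions, with
  \<open>h\<close> not identically zero (on \<open>\<complex>\<^sup>d\<close> this is no restriction).  \<open>mero_rep X A f\<close> collects
  the representations of a meromorphic continuation of the function \<open>f\<close> given on the set \<open>A\<close>,
  \<open>mero_dom X A f\<close> the points where some representation has a non-zero denominator, and
  \<open>mero_val X A f\<close> is the value there.
\<close>

definition mero_rep ::
  "('a::real_vector) ratspace \<Rightarrow> ('a \<Rightarrow> complex) set \<Rightarrow> (('a \<Rightarrow> complex) \<Rightarrow> complex)
     \<Rightarrow> ((('a \<Rightarrow> complex) \<Rightarrow> complex) \<times> (('a \<Rightarrow> complex) \<Rightarrow> complex)) set" where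
  "mero_rep X A f = {(g, h). entire_on_dual X g \<and> entire_on_dual X h \<and> (\<exists>\<xi>\<in>dual X. h \<xi> \<noteq> 0) \<and>
                             (\<forall>\<xi>\<in>A. h \<xi> * f \<xi> = g \<xi>)}"

definition mero_dom ::
  "('a::real_vector) ratspace \<Rightarrow> ('a \<Rightarrow> complex) set \<Rightarrow> (('a \<Rightarrow> complex) \<Rightarrow> complex)
     \<Rightarrow> ('a \<Rightarrow> complex) set" where
  "mero_dom X A f = {\<xi>\<in>dual X. \<exists>(g, h)\<in>mero_rep X A f. h \<xi> \<noteq> 0}"

definition mero_val ::
  "('a::real_vector) ratspace \<Rightarrow> ('a \<Rightarrow> complex) set \<Rightarrow> (('a \<Rightarrow> complex) \<Rightarrow> complex)
     \<Rightarrow> ('a \<Rightarrow> complex) \<Rightarrow> complex" where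
  "mero_val X A f \<xi> = (THE v. \<exists>(g, h)\<in>mero_rep X A f. h \<xi> \<noteq> 0 \<and> v = g \<xi> / h \<xi>)"


section \<open>Exponential sums and integrals\<close>

definition S_conv :: "('a::real_vector) ratspace \<Rightarrow> 'a set \<Rightarrow> ('a \<Rightarrow> complex) set" where
  "S_conv X P = (if contains_line P then dual X
     else {\<xi>\<in>dual X. (\<lambda>\<gamma>. norm (exp (\<xi> \<gamma>))) summable_on (P \<inter> lat X)})"

definition S_sum :: "('a::real_vector) ratspace \<Rightarrow> 'a set \<Rightarrow> ('a \<Rightarrow> complex) \<Rightarrow> complex" where
  "S_sum X P \<xi> = (if contains_line P then 0 else (\<Sum>\<^sub>\<infinity>\<gamma>\<in>P \<inter> lat X. exp (\<xi> \<gamma>)))"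

definition I_conv :: "('a::real_vector) ratspace \<Rightarrow> 'a set \<Rightarrow> ('a \<Rightarrow> complex) set" where
  "I_conv X P = (if contains_line P then dual X
     else {\<xi>\<in>dual X. set_integrable (aff_measure X P) P (\<lambda>x. exp (\<xi> x))})"

definition I_int :: "('a::real_vector) ratspace \<Rightarrow> 'a set \<Rightarrow> ('a \<Rightarrow> complex) \<Rightarrow> complex" where
  "I_int X P \<xi> = (if contains_line P then 0 else poly_integral X P (\<lambda>x. exp (\<xi> x)))"

abbreviation S_dom :: "('a::real_vector) ratspace \<Rightarrow> 'a set \<Rightarrow> ('a \<Rightarrow> complex) set" where
  "S_dom X P \<equiv> mero_dom X (S_conv X P) (S_sum X P)"

abbreviation S_mero :: "('a::real_vector) ratspace \<Rightarrow> 'a set \<Rightarrow> ('a \<Rightarrow> complex) \<Rightarrow> complex" where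
  "S_mero X P \<equiv> mero_val X (S_conv X P) (S_sum X P)"

abbreviation I_dom :: "('a::real_vector) ratspace \<Rightarrow> 'a set \<Rightarrow> ('a \<Rightarrow> complex) set" where
  "I_dom X P \<equiv> mero_dom X (I_conv X P) (I_int X P)"

abbreviation I_mero :: "('a::real_vector) ratspace \<Rightarrow> 'a set \<Rightarrow> ('a \<Rightarrow> complex) \<Rightarrow> complex" where
  "I_mero X P \<equiv> mero_val X (I_conv X P) (I_int X P)"


section \<open>The Berline--Vergne family\<close>

text \<open>
  \<open>\<mu> W \<aa>\<close> is only meaningful as a germ at \<open>0\<close>.  The last condition is an identity of meromorphic
  germs, tested at all points near \<open>0\<close> at which the meromorphic functions involved are regular.
\<close>

definition BV_family ::
  "('a::real_vector) ratspace \<Rightarrow> ('a ratspace \<Rightarrow> 'a set \<Rightarrow> ('a \<Rightarrow> complex) \<Rightarrow> complex) \<Rightarrow> bool" where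
  "BV_family X \<mu> \<longleftrightarrow>
     (\<forall>M W A. rational_subspace X M \<and> W = quot X M \<and> rational_affine_cone W A \<longrightarrow>
        analytic_at0_rat W (\<mu> W A) \<and>
        (vs W = {0} \<longrightarrow> A = {0} \<longrightarrow> near0 W (\<lambda>\<xi>. \<mu> W A \<xi> = 1)) \<and>
        (contains_line A \<longrightarrow> near0 W (\<lambda>\<xi>. \<mu> W A \<xi> = 0)) \<and>
        near0 W (\<lambda>\<xi>. \<xi> \<in> S_dom W A \<longrightarrow> (\<forall>F\<in>faces A. \<xi> \<in> I_dom W F) \<longrightarrow>
           S_mero W A \<xi> =
             (\<Sum>F\<in>faces A. \<mu> (quot W (lin F)) (transverse_cone W A F) (dproj W (lin F) \<xi>)
                            * I_mero W F \<xi>)))"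

text \<open>The polynomial \<open>\<mu>\<^sup>k\<^sub>X(A)\<close> on the dual of \<open>X\<close>, for a cone \<open>A\<close> in \<open>X/L\<close>.\<close>

definition mu_part ::
  "('a ratspace \<Rightarrow> 'a set \<Rightarrow> ('a \<Rightarrow> complex) \<Rightarrow> complex) \<Rightarrow> ('a::real_vector) ratspace \<Rightarrow> 'a set
     \<Rightarrow> nat \<Rightarrow> 'a set \<Rightarrow> ('a \<Rightarrow> complex) \<Rightarrow> complex" where
  "mu_part \<mu> X L k A \<xi> = hom_part (quot X L) k (\<mu> (quot X L) A) (dproj X L \<xi>)"


section \<open>Differential operators and Schwartz functions\<close>

definition nabla :: "'a::real_vector \<Rightarrow> ('a \<Rightarrow> complex) \<Rightarrow> 'a \<Rightarrow> complex" where
  "nabla v f x = vector_derivative (\<lambda>t. f (x + t *\<^sub>R v)) (at 0)"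

definition nablas :: "'a::real_vector list \<Rightarrow> ('a \<Rightarrow> complex) \<Rightarrow> 'a \<Rightarrow> complex" where
  "nablas us f = foldr nabla us f"

definition continuous_in_coords :: "('a::real_vector) ratspace \<Rightarrow> ('a \<Rightarrow> complex) \<Rightarrow> bool" where
  "continuous_in_coords X f \<longleftrightarrow>
     continuous_on UNIV (\<lambda>t :: 'a \<Rightarrow> real. f (\<Sum>b\<in>zbasis (lat X). t b *\<^sub>R b))"

definition smooth_on_space :: "('a::real_vector) ratspace \<Rightarrow> ('a \<Rightarrow> complex) \<Rightarrow> bool" where
  "smooth_on_space X f \<longleftrightarrow>
     (\<forall>us. set us \<subseteq> vs X \<longrightarrow>
        continuous_in_coords X (nablas us f) \<and>
        (\<forall>x\<in>vs X. \<forall>v\<in>vs X. (\<lambda>t::real. nablas us f (x + t *\<^sub>R v)) differentiable (at 0)))"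

definition schwartz :: "('a::real_vector) ratspace \<Rightarrow> ('a \<Rightarrow> complex) \<Rightarrow> bool" where
  "schwartz X f \<longleftrightarrow> smooth_on_space X f \<and>
     (\<forall>us m. set us \<subseteq> vs X \<longrightarrow>
        (\<exists>K. \<forall>x\<in>vs X. (1 + ip X x x) ^ m * norm (nablas us f x) \<le> K))"

text \<open>
  Homogeneous operators of order \<open>m\<close> with constant coefficients on \<open>X\<close> (including the zero operator);
  an operator is applied only to smooth functions on \<open>X\<close>.
\<close>

definition hom_diff_op ::
  "('a::real_vector) ratspace \<Rightarrow> nat \<Rightarrow> (('a \<Rightarrow> complex) \<Rightarrow> 'a \<Rightarrow> complex) \<Rightarrow> bool" where
  "hom_diff_op X m D \<longleftrightarrow>
     (\<exists>T. finite T \<and> (\<forall>us\<in>T. length us = m \<and> set us \<subseteq> vs X) \<and>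
       (\<exists>c :: 'a list \<Rightarrow> complex. \<forall>f. smooth_on_space X f \<longrightarrow>
          (\<forall>x\<in>vs X. D f x = (\<Sum>us\<in>T. c us * nablas us f x))))"

text \<open>The right-hand side defining the symbol does not depend on the point \<open>x\<close>.\<close>

definition symbol ::
  "('a::real_vector) ratspace \<Rightarrow> (('a \<Rightarrow> complex) \<Rightarrow> 'a \<Rightarrow> complex) \<Rightarrow> ('a \<Rightarrow> complex) \<Rightarrow> complex" where
  "symbol X D \<xi> = (THE s. \<forall>x\<in>vs X. s = exp (- \<xi> x) * D (\<lambda>y. exp (\<xi> y)) x)"

definition bern :: "nat \<Rightarrow> real" where
  "bern n = fact n * fps_nth (fps_X / (fps_exp 1 - 1)) n"


section \<open>Riemann sums\<close>

definition riemann_sum :: "('a::real_vector) ratspace \<Rightarrow> 'a set \<Rightarrow> ('a \<Rightarrow> complex) \<Rightarrow> nat \<Rightarrow> complex" where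
  "riemann_sum X C \<phi> N =
     (\<Sum>\<^sub>\<infinity>\<gamma>\<in>C \<inter> lat X. \<phi> (inverse (real N) *\<^sub>R \<gamma>)) / of_nat N ^ cdim C"

definition asymptotic_series :: "(nat \<Rightarrow> complex) \<Rightarrow> (nat \<Rightarrow> complex) \<Rightarrow> bool" where
  "asymptotic_series R a \<longleftrightarrow>
     (\<forall>M\<ge>1. (\<lambda>N. R N - (\<Sum>n<M. a n / of_nat N ^ n)) \<in> O(\<lambda>N. 1 / of_nat N ^ M))"


section \<open>The orthogonal projection is well defined\<close>

lemma inner_product_onD:
  assumes "inner_product_on V Q" "x \<in> V" "y \<in> V"
  shows "Q x y = Q y x" "z \<in> V \<Longrightarrow> Q (x + y) z = Q x z + Q y z"
    "Q (r *\<^sub>R x) y = r * Q x y" "x \<noteq> 0 \<Longrightarrow> Q x x > 0"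
  using assms by (simp_all add: inner_product_on_def)

lemma inner_product_on_diff:
  assumes "inner_product_on V Q" "subspace V" "x \<in> V" "y \<in> V" "z \<in> V"
  shows "Q (x - y) z = Q x z - Q y z"
proof -
  have "(-1) *\<^sub>R y \<in> V" using assms(2,4) by (rule subspace_scale)
  hence "Q (x + (-1) *\<^sub>R y) z = Q x z + Q ((-1) *\<^sub>R y) z"
    by (rule inner_product_onD(2)[OF assms(1,3) _ assms(5)])
  also have "Q ((-1) *\<^sub>R y) z = (-1) * Q y z"
    by (rule inner_product_onD(3)[OF assms(1,4,5)])
  finally show ?thesis by simp
qed

lemma orthogonal_decomposition:
  assumes "inner_product_on V Q" "subspace V" "finite B" "B \<subseteq> V" "x \<in> V"
  shows "\<exists>l\<in>span B. \<forall>m\<in>span B. Q (x - l) m = 0"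
  using assms(3,4,5)
proof (induction B arbitrary: x rule: finite_induct)
  case empty
  have "Q 0 0 = 0" using inner_product_onD(3)[OF assms(1), of 0 0 0] subspace_0[OF assms(2)] by simp
  moreover have "Q x 0 = 0" using inner_product_onD(3)[OF assms(1), of 0 x 0]
      inner_product_onD(1)[OF assms(1), of 0 x] subspace_0[OF assms(2)] empty by simp
  ultimately show ?case by simp
next
  case (insert b B)
  have BV: "span B \<subseteq> V" using insert.prems assms(2) by (simp add: span_minimal)
  have iBV: "span (insert b B) \<subseteq> V" using insert.prems assms(2) by (simp add: span_minimal)
  have bV: "b \<in> V" using insert.prems by simp
  obtain p where p: "p \<in> span B" "\<forall>m\<in>span B. Q (b - p) m = 0"
    using insert.IH[of b] insert.prems by auto
  obtain q where q: "q \<in> span B" "\<forall>m\<in>span B. Q (x - q) m = 0"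
    using insert.IH[of x] insert.prems by auto
  define e where "e = b - p"
  define r where "r = (if e = 0 then 0 else Q (x - q) e / Q e e)"
  have eV: "e \<in> V" using p(1) BV bV assms(2) unfolding e_def by (auto intro: subspace_diff)
  have qV: "q \<in> V" using q(1) BV by auto
  have xqV: "x - q \<in> V" using qV insert.prems assms(2) by (auto intro: subspace_diff)
  have reV: "r *\<^sub>R e \<in> V" using eV assms(2) by (simp add: subspace_scale)
  have e_in: "e \<in> span (insert b B)"
    unfolding e_def using p(1) by (meson span_base span_diff span_mono insertI1 subset_insertI subsetD)
  have main: "Q (x - (q + r *\<^sub>R e)) m = 0" if m: "m \<in> span (insert b B)" for m
  proof -
    obtain k where k: "m - k *\<^sub>R b \<in> span B" using m by (auto simp: span_insert)
    define n where "n = m - k *\<^sub>R e"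
    have "n = (m - k *\<^sub>R b) + k *\<^sub>R p" unfolding n_def e_def by (simp add: algebra_simps)
    hence n: "n \<in> span B" using k p(1) by (simp add: span_add span_scale)
    have nV: "n \<in> V" using n BV by auto
    have keV: "k *\<^sub>R e \<in> V" using eV assms(2) by (simp add: subspace_scale)
    have y: "x - (q + r *\<^sub>R e) = (x - q) - r *\<^sub>R e" by simp
    have yV: "(x - q) - r *\<^sub>R e \<in> V" using xqV reV assms(2) by (auto intro: subspace_diff)
    have en: "Q e n = 0" using p(2) n e_def by simp
    have 1: "Q ((x - q) - r *\<^sub>R e) n = 0"
      using inner_product_on_diff[OF assms(1,2) xqV reV nV] inner_product_onD(3)[OF assms(1) eV nV]
        q(2) n en by simp
    have 2: "Q ((x - q) - r *\<^sub>R e) e = 0"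
    proof -
      have "Q ((x - q) - r *\<^sub>R e) e = Q (x - q) e - r * Q e e"
        using inner_product_on_diff[OF assms(1,2) xqV reV eV] inner_product_onD(3)[OF assms(1) eV eV]
        by simp
      moreover have "Q (x - q) e = 0" if "e = 0"
        using that inner_product_onD(1)[OF assms(1) xqV eV] inner_product_onD(3)[OF assms(1) eV xqV, of 0]
        by simp
      moreover have "Q e e \<noteq> 0" if "e \<noteq> 0" using inner_product_onD(4)[OF assms(1) eV eV that] by simp
      ultimately show ?thesis unfolding r_def by auto
    qed
    have m_eq: "m = n + k *\<^sub>R e" unfolding n_def by simp
    have "Q ((x - q) - r *\<^sub>R e) (n + k *\<^sub>R e) = Q (n + k *\<^sub>R e) ((x - q) - r *\<^sub>R e)"
      using inner_product_onD(1)[OF assms(1) yV] nV keV assms(2) by (auto intro: subspace_add)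
    also have "\<dots> = Q n ((x - q) - r *\<^sub>R e) + k * Q e ((x - q) - r *\<^sub>R e)"
      using inner_product_onD(2)[OF assms(1) nV keV yV] inner_product_onD(3)[OF assms(1) eV yV] by simp
    also have "\<dots> = 0"
      using 1 2 inner_product_onD(1)[OF assms(1) yV nV] inner_product_onD(1)[OF assms(1) yV eV] by simp
    finally show ?thesis unfolding m_eq y .
  qed
  have "q + r *\<^sub>R e \<in> span (insert b B)"
    using q(1) e_in by (meson span_add span_scale span_mono subset_insertI subsetD)
  thus ?case using main by (intro bexI[of _ "q + r *\<^sub>R e"] ballI)
qed

lemma rational_spaceD:
  assumes "rational_space X"
  shows "subspace (vs X)" "inner_product_on (vs X) (ip X)"
proof -
  obtain B where "span B = vs X" using assms unfolding rational_space_def is_lattice_def by blast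
  thus "subspace (vs X)" by (metis subspace_span)
  show "inner_product_on (vs X) (ip X)" using assms unfolding rational_space_def by blast
qed

lemma qproj:
  assumes "rational_space X" "rational_subspace X L" "x \<in> vs X"
  shows "qproj X L x \<in> perp X L" "x - qproj X L x \<in> L"
    and "\<And>y. y \<in> perp X L \<Longrightarrow> x - y \<in> L \<Longrightarrow> qproj X L x = y"
proof -
  note V = rational_spaceD[OF assms(1)]
  have L: "subspace L" "L \<subseteq> vs X" using assms(2) by (auto simp: rational_subspace_def)
  obtain B where B: "finite B" "span B = L"
    using assms(2) by (auto simp: rational_subspace_def is_lattice_def is_zbasis_def)
  have BV: "B \<subseteq> vs X" using B(2) L(2) span_superset by blast
  obtain l where l: "l \<in> L" "\<forall>m\<in>L. ip X (x - l) m = 0"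
    using orthogonal_decomposition[OF V(2,1) B(1) BV assms(3)] B(2) by auto
  have ex: "x - l \<in> perp X L \<and> x - (x - l) \<in> L"
    using l L(2) assms(3) V(1) by (auto simp: perp_def intro: subspace_diff)
  have uniq: "y = z" if "y \<in> perp X L" "x - y \<in> L" "z \<in> perp X L" "x - z \<in> L" for y z
  proof (rule ccontr)
    assume "y \<noteq> z"
    have yz: "y \<in> vs X" "z \<in> vs X" using that by (auto simp: perp_def)
    have "(x - z) - (x - y) \<in> L" using that L(1) by (blast intro: subspace_diff)
    hence d: "y - z \<in> L" by simp
    have dV: "y - z \<in> vs X" using d L(2) by auto
    have "ip X (y - z) (y - z) = ip X y (y - z) - ip X z (y - z)"
      using inner_product_on_diff[OF V(2,1) yz dV] .
    also have "\<dots> = 0" using that d by (simp add: perp_def)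
    finally show False using inner_product_onD(4)[OF V(2) dV dV] \<open>y \<noteq> z\<close> by simp
  qed
  have *: "qproj X L x = y" if "y \<in> perp X L" "x - y \<in> L" for y
    unfolding qproj_def using that uniq by blast
  have "qproj X L x = x - l" using * ex by blast
  thus "qproj X L x \<in> perp X L" "x - qproj X L x \<in> L" using ex by auto
  show "\<And>y. y \<in> perp X L \<Longrightarrow> x - y \<in> L \<Longrightarrow> qproj X L x = y" by (rule *)
qed

lemma ip_qproj_left:
  assumes "rational_space X" "rational_subspace X L" "v \<in> vs X" "x \<in> vs X"
  shows "ip X v (qproj X L x) = ip X (qproj X L v) x"
proof -
  note V = rational_spaceD[OF assms(1)]
  let ?p = "qproj X L"
  have L: "L \<subseteq> vs X" using assms(2) by (auto simp: rational_subspace_def)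
  have pv: "?p v \<in> perp X L" "v - ?p v \<in> L" and px: "?p x \<in> perp X L" "x - ?p x \<in> L"
    using qproj(1,2)[OF assms(1,2)] assms(3,4) by auto
  have mem: "?p v \<in> vs X" "?p x \<in> vs X" using pv px by (auto simp: perp_def)
  have "ip X v (?p x) - ip X (?p v) (?p x) = ip X (v - ?p v) (?p x)"
    using inner_product_on_diff[OF V(2,1)] assms(3) mem by simp
  also have "\<dots> = ip X (?p x) (v - ?p v)"
    using inner_product_onD(1)[OF V(2)] L pv(2) mem(2) by blast
  also have "\<dots> = 0" using px pv by (simp add: perp_def)
  finally have 1: "ip X v (?p x) = ip X (?p v) (?p x)" by simp
  have "ip X x (?p v) - ip X (?p x) (?p v) = ip X (x - ?p x) (?p v)"
    using inner_product_on_diff[OF V(2,1)] assms(4) mem by simp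
  also have "\<dots> = ip X (?p v) (x - ?p x)"
    using inner_product_onD(1)[OF V(2)] L px(2) mem(1) by blast
  also have "\<dots> = 0" using px pv by (simp add: perp_def)
  finally have "ip X x (?p v) = ip X (?p x) (?p v)" by simp
  thus ?thesis using 1 inner_product_onD(1)[OF V(2)] mem assms(4) by metis
qed

lemma lat_memberships:
  assumes "rational_space X"
  shows "0 \<in> lat X" "lat X \<subseteq> vs X"
proof -
  obtain B where B: "lat X = int_span B" "span B = vs X"
    using assms unfolding rational_space_def is_lattice_def is_zbasis_def by blast
  show "0 \<in> lat X" unfolding B(1) int_span_def by (auto intro!: exI[of _ "\<lambda>_. 0"])
  show "lat X \<subseteq> vs X"
    unfolding B(1) int_span_def B(2)[symmetric] by (auto intro!: span_sum span_scale intro: span_base)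
qed

lemma rational_subspace_0:
  assumes "rational_space X"
  shows "rational_subspace X {0}"
proof -
  have "is_zbasis {} ({0} \<inter> lat X)"
    using lat_memberships(1)[OF assms] by (auto simp: is_zbasis_def int_span_def independent_empty)
  hence "is_lattice ({0} \<inter> lat X) {0}" unfolding is_lattice_def by (intro exI[of _ "{}"]) simp
  thus ?thesis using subspace_0[OF rational_spaceD(1)[OF assms]] by (simp add: rational_subspace_def)
qed

text \<open>The quotient by \<open>{0}\<close> is the space itself, so cones in \<open>X\<close> are the case \<open>L = {0}\<close>.\<close>

lemma quot_0:
  assumes "rational_space X"
  shows "quot X {0} = X"
proof -
  note V = rational_spaceD[OF assms]
  have "ip X x 0 = 0" if "x \<in> vs X" for x
    using inner_product_onD(3)[OF V(2), of 0 x 0] inner_product_onD(1)[OF V(2), of 0 x]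
      subspace_0[OF V(1)] that by simp
  hence vs: "perp X {0} = vs X" by (auto simp: perp_def)
  have "qproj X {0} x = x" if "x \<in> vs X" for x
    using qproj(3)[OF assms rational_subspace_0[OF assms] that, of x] that vs by simp
  moreover note lat_memberships(2)[OF assms]
  ultimately have "qproj X {0} ` lat X = lat X" by force
  thus ?thesis using vs by (simp add: quot_def)
qed

end

theory Submission
  imports Defs "HOL-Complex_Analysis.Complex_Analysis"
begin

text \<open>
  For a functional \<open>\<xi>\<close> whose real part is negative on the generators of a unimodular cone \<open>C\<close>, there is a
  Schwartz function that agrees with \<open>exp \<xi>\<close> near \<open>C\<close>.  Its Riemann sum is \<open>N\<^sup>-\<^sup>d S(C)(\<xi>/N)\<close> with
  \<open>d = dim C\<close>.  The hypothesis on Riemann sums expands it with coefficients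
  \<open>\<Sum>\<^sub>F \<nu>\<^sub>n(\<pi>\<^sub>F C)(\<xi>) I(F)(\<xi>)\<close>.  Since \<open>I(F)(\<xi>/N) = N\<^bsup>dim F\<^esup> I(F)(\<xi>)\<close>, the Berline--Vergne identity at
  \<open>\<xi>/N\<close> expands it with the coefficients obtained by replacing \<open>\<nu>\<^sub>n(\<pi>\<^sub>F C)\<close> by the homogeneous part
  of degree \<open>n - d + dim F\<close> of \<open>\<mu>(\<pi>\<^sub>F C)\<close>.  Asymptotic coefficients are unique, and by induction on the
  dimension the terms with \<open>F \<noteq> {0}\<close> agree, so the terms with \<open>F = {0}\<close> agree as well.  Both sides are
  polynomials in \<open>\<xi>\<close>, so the restriction on \<open>\<xi>\<close> can be dropped.
\<close>

text \<open>In positive dimension an exponential is never a Schwartz function on all of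
  \<open>vs X\<close>, and agreement of a test function with it on \<open>C\<close> alone would not
  suffice, because the operators also differentiate in directions that leave the cone. Hence the
  test function copies the exponential on a box around \<open>C\<close> in the coordinates of a
  lattice basis. The ambient space has no topology, so openness is always expressed along lines.

  The continuations in \<open>BV_family\<close> are given by representations that must be valid on
  the whole convergence set. The sets where the sum over a cone and the integral over a face
  converge therefore have to be determined exactly, as equivalences.

  The integrals over the faces occur with the same values in both expansions. What matters about
  them is their degree of homogeneity and that the integral over \<open>{0}\<close> can be
  cancelled. The bulk of the work lies in leaving \<open>X\<close>: dividing by the span of a face
  must again give a rational space, a unimodular cone with fewer generators, and a Berline--Vergne
  family.\<close>

section \<open>Coordinates with respect to a basis\<close>

text \<open>
  \<open>construct\<close> extends by zero, so the coordinate functionals are linear on the whole ambient space and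
  not only on the span of the basis.
\<close>

definition coord :: "'a::real_vector set \<Rightarrow> 'a \<Rightarrow> 'a \<Rightarrow> real" where
  "coord B b = construct B (\<lambda>b'. if b' = b then 1 else 0)"

lemma linear_coord: "independent B \<Longrightarrow> linear (coord B b)"
  unfolding coord_def by (rule linear_construct)

lemma coord_basis: "independent B \<Longrightarrow> b' \<in> B \<Longrightarrow> coord B b b' = (if b' = b then 1 else 0)"
  unfolding coord_def by (simp add: construct_basis)

lemma coord_add: "independent B \<Longrightarrow> coord B b (x + y) = coord B b x + coord B b y"
  by (rule linear_add[OF linear_coord])

lemma coord_diff: "independent B \<Longrightarrow> coord B b (x - y) = coord B b x - coord B b y"
  by (rule linear_diff[OF linear_coord])

lemma coord_scaleR: "independent B \<Longrightarrow> coord B b (r *\<^sub>R x) = r * coord B b x"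
  using linear_scale[OF linear_coord] by fastforce

lemma coord_sum:
  assumes "finite S" "independent B" "S \<subseteq> B"
  shows "coord B b (\<Sum>c\<in>S. t c *\<^sub>R c) = (if b \<in> S then t b else 0)"
proof -
  have "coord B b (\<Sum>c\<in>S. t c *\<^sub>R c) = (\<Sum>c\<in>S. t c * coord B b c)"
    by (simp add: linear_sum[OF linear_coord[OF assms(2)]] coord_scaleR[OF assms(2)])
  also have "\<dots> = (\<Sum>c\<in>S. if c = b then t c else 0)"
    using assms coord_basis[OF assms(2)] by (intro sum.cong) auto
  finally show ?thesis using assms(1) by (simp add: sum.delta)
qed

lemma span_finite_sum:
  assumes "finite B" "x \<in> span B"
  obtains t where "x = (\<Sum>b\<in>B. t b *\<^sub>R b)"
  using assms by (auto simp: span_finite)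

lemma sum_coord:
  assumes "finite B" "independent B" "x \<in> span B"
  shows "(\<Sum>b\<in>B. coord B b x *\<^sub>R b) = x"
proof -
  obtain t where t: "x = (\<Sum>b\<in>B. t b *\<^sub>R b)" using span_finite_sum[OF assms(1,3)] .
  show ?thesis unfolding t by (intro sum.cong) (auto simp: coord_sum[OF assms(1,2)])
qed

lemma sum_scaleR_eqD:
  assumes "finite B" "independent B" "(\<Sum>b\<in>B. t b *\<^sub>R b) = (\<Sum>b\<in>B. u b *\<^sub>R b)" "b \<in> B"
  shows "t b = u b"
  using coord_sum[OF assms(1,2), of b t] coord_sum[OF assms(1,2), of b u] assms(3,4) by simp

lemma int_span_iff:
  assumes "finite B" "independent B"
  shows "x \<in> int_span B \<longleftrightarrow> x \<in> span B \<and> (\<forall>b\<in>B. coord B b x \<in> \<int>)"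
proof
  assume "x \<in> int_span B"
  then obtain k :: "'a \<Rightarrow> int" where k: "x = (\<Sum>b\<in>B. of_int (k b) *\<^sub>R b)" by (auto simp: int_span_def)
  show "x \<in> span B \<and> (\<forall>b\<in>B. coord B b x \<in> \<int>)"
  proof (intro conjI ballI)
    show "x \<in> span B" unfolding k by (intro span_sum span_scale span_base)
    show "coord B b x \<in> \<int>" if "b \<in> B" for b
      unfolding k using that by (simp add: coord_sum[OF assms(1,2)])
  qed
next
  assume *: "x \<in> span B \<and> (\<forall>b\<in>B. coord B b x \<in> \<int>)"
  hence "\<forall>b\<in>B. \<exists>k. coord B b x = of_int k" by (auto elim: Ints_cases)
  then obtain k where k: "\<And>b. b \<in> B \<Longrightarrow> coord B b x = of_int (k b)" by metis
  have "x = (\<Sum>b\<in>B. coord B b x *\<^sub>R b)" using sum_coord[OF assms] * by simp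
  also have "\<dots> = (\<Sum>b\<in>B. of_int (k b) *\<^sub>R b)" using k by (intro sum.cong) auto
  finally show "x \<in> int_span B" unfolding int_span_def by blast
qed

text \<open>A vector of \<open>span V\<close> has zero \<open>B\<close>-coordinates off
  \<open>V\<close> and its \<open>V\<close>-coordinates on \<open>V\<close>, so the two integrality
  conditions agree. For a face of a unimodular cone this identifies the lattice of its linear span:
  the generators of the face form a \<int>-basis.\<close>

lemma span_Int_int_span:
  assumes "finite B" "independent B" "V \<subseteq> B"
  shows "span V \<inter> int_span B = int_span V"
proof -
  have fV: "finite V" "independent V" using assms finite_subset independent_mono by blast+
  have c: "x = (\<Sum>b\<in>V. coord V b x *\<^sub>R b)" if "x \<in> span V" for x
    using sum_coord[OF fV that] by simp
  have eq: "coord B b x = (if b \<in> V then coord V b x else 0)" if "x \<in> span V" for b x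
    using coord_sum[OF fV(1) assms(2,3), of b "\<lambda>b. coord V b x"] c[OF that] by simp
  show ?thesis
  proof (intro set_eqI)
    fix x
    have "(\<forall>b\<in>B. coord B b x \<in> \<int>) \<longleftrightarrow> (\<forall>b\<in>V. coord V b x \<in> \<int>)" if "x \<in> span V"
      unfolding eq[OF that] using assms(3) by auto
    thus "x \<in> span V \<inter> int_span B \<longleftrightarrow> x \<in> int_span V"
      using span_mono[OF assms(3)] unfolding Int_iff int_span_iff[OF assms(1,2)] int_span_iff[OF fV] by blast
  qed
qed

lemma span_int_span: "finite B \<Longrightarrow> independent B \<Longrightarrow> span (int_span B) = span B"
proof
  assume B: "finite B" "independent B"
  show "span (int_span B) \<subseteq> span B"
    by (rule span_minimal) (auto simp: int_span_iff[OF B])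
  have "b \<in> int_span B" if "b \<in> B" for b
    unfolding int_span_iff[OF B] using that by (auto simp: coord_basis B span_base)
  thus "span B \<subseteq> span (int_span B)" by (intro span_mono) auto
qed

lemma zbasis_subset:
  assumes "is_zbasis B \<Lambda>" "V \<subseteq> B"
  shows "finite V" "independent V"
  using assms finite_subset independent_mono unfolding is_zbasis_def by blast+

section \<open>Schwartz functions on the line\<close>

text \<open>Smoothness is \<open>times_differentiable n\<close> for every \<open>n\<close>. The
  derivative is quantified at each level, so closure under products, inverses and affine
  substitution follows by induction on \<open>n\<close> over all functions, without formulas for
  higher derivatives.\<close>

primrec times_differentiable :: "nat \<Rightarrow> (real \<Rightarrow> complex) \<Rightarrow> bool" where
  "times_differentiable 0 f \<longleftrightarrow> True"
| "times_differentiable (Suc n) f \<longleftrightarrow>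
     (\<exists>f'. (\<forall>t. (f has_vector_derivative f' t) (at t)) \<and> times_differentiable n f')"

lemma times_differentiable_less: "times_differentiable (Suc n) f \<Longrightarrow> times_differentiable n f"
  by (induction n arbitrary: f) auto

lemma times_differentiable_const: "times_differentiable n (\<lambda>_. c)"
proof (induction n arbitrary: c)
  case (Suc n)
  have "((\<lambda>_. c) has_vector_derivative 0) (at t)" for t :: real
    by (auto intro: derivative_eq_intros)
  thus ?case using Suc[of 0] by (auto intro!: exI[of _ "\<lambda>_. 0"])
qed simp

lemma times_differentiable_add:
  "times_differentiable n f \<Longrightarrow> times_differentiable n g \<Longrightarrow> times_differentiable n (\<lambda>t. f t + g t)"
proof (induction n arbitrary: f g)
  case (Suc n)
  from Suc.prems obtain f' g' where
    "\<And>t. (f has_vector_derivative f' t) (at t)" "times_differentiable n f'"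
    "\<And>t. (g has_vector_derivative g' t) (at t)" "times_differentiable n g'" by auto
  thus ?case using Suc.IH[of f' g']
    by (auto intro!: exI[of _ "\<lambda>t. f' t + g' t"] has_vector_derivative_add)
qed simp

lemma times_differentiable_mult:
  "times_differentiable n f \<Longrightarrow> times_differentiable n g \<Longrightarrow> times_differentiable n (\<lambda>t. f t * g t)"
proof (induction n arbitrary: f g)
  case (Suc n)
  from Suc.prems obtain f' g' where *:
    "\<And>t. (f has_vector_derivative f' t) (at t)" "times_differentiable n f'"
    "\<And>t. (g has_vector_derivative g' t) (at t)" "times_differentiable n g'" by auto
  show ?case unfolding times_differentiable.simps
  proof (intro exI conjI allI)
    show "((\<lambda>t. f t * g t) has_vector_derivative f t * g' t + f' t * g t) (at t)" for t
      by (rule has_vector_derivative_mult) (rule *)+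
    show "times_differentiable n (\<lambda>t. f t * g' t + f' t * g t)"
      using Suc.IH[of f g'] Suc.IH[of f' g] * Suc.prems
      by (intro times_differentiable_add) (auto dest: times_differentiable_less simp del: times_differentiable.simps)
  qed
qed simp

lemma times_differentiable_affine:
  "times_differentiable n f \<Longrightarrow> times_differentiable n (\<lambda>t. f (a * t + b))"
proof (induction n arbitrary: f)
  case (Suc n)
  from Suc.prems obtain f' where *:
    "\<And>t. (f has_vector_derivative f' t) (at t)" "times_differentiable n f'" by auto
  show ?case unfolding times_differentiable.simps
  proof (intro exI conjI allI)
    show "((\<lambda>t. f (a * t + b)) has_vector_derivative (of_real a * f' (a * t + b))) (at t)" for t
    proof -
      have "((\<lambda>t. a * t + b) has_vector_derivative a) (at t)"
        by (auto intro!: derivative_eq_intros)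
      from vector_diff_chain_at[OF this *(1)] show ?thesis
        by (simp add: o_def scaleR_conv_of_real)
    qed
    show "times_differentiable n (\<lambda>t. of_real a * f' (a * t + b))"
      by (intro times_differentiable_mult times_differentiable_const Suc.IH *)
  qed
qed simp

text \<open>The derivative is a product of \<open>f'\<close> and inverses of the same
  \<open>f\<close>, so the induction hypothesis for \<open>f\<close> itself, one level lower, is
  enough.\<close>

lemma times_differentiable_inverse:
  "times_differentiable n f \<Longrightarrow> (\<And>t. f t \<noteq> 0) \<Longrightarrow> times_differentiable n (\<lambda>t. inverse (f t))"
proof (induction n arbitrary: f)
  case (Suc n)
  from Suc.prems obtain f' where *:
    "\<And>t. (f has_vector_derivative f' t) (at t)" "times_differentiable n f'" by auto
  show ?case unfolding times_differentiable.simps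
  proof (intro exI conjI allI)
    show "((\<lambda>t. inverse (f t)) has_vector_derivative (-1) * (f' t * (inverse (f t) * inverse (f t)))) (at t)" for t
    proof -
      have "(inverse has_field_derivative - (inverse (f t) * inverse (f t))) (at (f t))"
        using DERIV_inverse[OF Suc.prems(2)[of t]] by (simp add: power2_eq_square)
      from field_vector_diff_chain_at[OF *(1) this] show ?thesis
        by (simp add: o_def)
    qed
    have "times_differentiable n (\<lambda>t. inverse (f t))"
      by (intro Suc.IH Suc.prems times_differentiable_less)
    thus "times_differentiable n (\<lambda>t. (-1) * (f' t * (inverse (f t) * inverse (f t))))"
      by (intro times_differentiable_mult times_differentiable_const *)
  qed
qed simp

lemma times_differentiable_exp: "times_differentiable n (\<lambda>t. exp (c * of_real t))"
proof (induction n)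
  case (Suc n)
  show ?case unfolding times_differentiable.simps
  proof (intro exI conjI allI)
    show "((\<lambda>t. exp (c * of_real t)) has_vector_derivative c * exp (c * of_real t)) (at t)" for t
    proof -
      have "((\<lambda>t. c * of_real t) has_vector_derivative c) (at t)"
        by (auto intro!: derivative_eq_intros has_vector_derivative_of_real)
      from field_vector_diff_chain_at[OF this DERIV_exp] show ?thesis by (simp add: o_def)
    qed
    show "times_differentiable n (\<lambda>t. c * exp (c * of_real t))"
      by (intro times_differentiable_mult times_differentiable_const Suc)
  qed
qed simp

section \<open>A flat function at 0 and a smooth cutoff\<close>

lemma power_le_fact_exp: "0 \<le> (x::real) \<Longrightarrow> x ^ n \<le> fact n * exp x"
proof -
  assume x: "0 \<le> x"
  have "(\<Sum>i\<in>{n}. inverse (fact i) * x ^ i) \<le> (\<Sum>i. inverse (fact i) * x ^ i)"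
    using x by (intro sum_le_suminf summable_exp) auto
  thus ?thesis by (simp add: exp_def scaleR_conv_of_real field_simps)
qed

text \<open>The classical \<open>exp (-1/t)\<close>, continued by 0. The extra power of
  \<open>inverse t\<close> makes the family closed under differentiation: the derivative of a member
  is a combination of the next two.\<close>

definition flat :: "nat \<Rightarrow> real \<Rightarrow> complex" where
  "flat m t = (if t > 0 then of_real (exp (- inverse t) * inverse t ^ m) else 0)"

text \<open>The term of degree \<open>m + 2\<close> of the exponential series leaves a factor
  \<open>t ^ 2\<close> after \<open>inverse t ^ m\<close> is absorbed; a quadratic bound is what
  makes the derivative at 0 vanish.\<close>

lemma norm_flat_le: "norm (flat m t) \<le> fact (m + 2) * t ^ 2"
proof (cases "t > 0")
  case True
  have "inverse t ^ (m + 2) \<le> fact (m + 2) * exp (inverse t)"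
    using True by (intro power_le_fact_exp) simp
  hence "inverse t ^ (m + 2) * exp (- inverse t) \<le> fact (m + 2) * exp (inverse t) * exp (- inverse t)"
    by (rule mult_right_mono) simp
  also have "\<dots> = fact (m + 2)" by (simp add: exp_minus del: fact_Suc)
  finally have "inverse t ^ m * exp (- inverse t) * inverse t ^ 2 \<le> fact (m + 2)"
    by (simp only: power_add mult_ac)
  from mult_right_mono[OF this, of "t ^ 2"]
  have "inverse t ^ m * exp (- inverse t) * (inverse t ^ 2 * t ^ 2) \<le> fact (m + 2) * t ^ 2"
    by (simp only: mult.assoc zero_le_power2)
  moreover have one: "inverse t ^ 2 * t ^ 2 = 1" using True by (simp add: field_simps)
  ultimately have "inverse t ^ m * exp (- inverse t) \<le> fact (m + 2) * t ^ 2"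
    unfolding one by (simp only: mult_1_right)
  moreover have "norm (flat m t) = inverse t ^ m * exp (- inverse t)"
    using True by (simp add: flat_def norm_mult norm_power norm_inverse)
  ultimately show ?thesis by simp
qed (simp add: flat_def)

lemma has_vector_derivative_flat:
  "(flat m has_vector_derivative (- of_nat m * flat (m + 1) t + flat (m + 2) t)) (at t)"
proof -
  consider "t > 0" | "t < 0" | "t = 0" by linarith
  thus ?thesis
  proof cases
    case 1
    have "((\<lambda>t. exp (- inverse t) * inverse t ^ m) has_field_derivative
        (- of_nat m * (exp (- inverse t) * inverse t ^ (m + 1)) + exp (- inverse t) * inverse t ^ (m + 2))) (at t)"
      using 1 by (auto intro!: derivative_eq_intros simp: power_Suc power2_eq_square field_simps
          simp flip: power_Suc)
        (cases m; simp add: field_simps power_Suc)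
    hence "((\<lambda>t. complex_of_real (exp (- inverse t) * inverse t ^ m)) has_vector_derivative
        of_real (- of_nat m * (exp (- inverse t) * inverse t ^ (m + 1)) + exp (- inverse t) * inverse t ^ (m + 2))) (at t)"
      by (intro has_vector_derivative_of_real)
    thus ?thesis using 1
      by (rule_tac has_vector_derivative_transform_within_open[of _ _ _ "{0<..}"]) (auto simp: flat_def)
  next
    case 2
    have "((\<lambda>_. 0) has_vector_derivative (0::complex)) (at t)" by simp
    thus ?thesis using 2
      by (rule_tac has_vector_derivative_transform_within_open[of "\<lambda>_. 0" _ _ "{..<0}"]) (auto simp: flat_def)
  next
    case 3
    \<comment> \<open>By the quadratic bound the difference quotient at 0 is at most a multiple of
      \<open>\<bar>h\<bar>\<close>. The derivative there is thus 0, which is also the value of the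
      claimed formula.\<close>
    have "((\<lambda>h. flat m h /\<^sub>R \<bar>h\<bar>) \<longlongrightarrow> 0) (at 0)"
    proof (rule Lim_null_comparison)
      show "\<forall>\<^sub>F h in at 0. norm (flat m h /\<^sub>R \<bar>h\<bar>) \<le> fact (m + 2) * \<bar>h\<bar>"
      proof (intro always_eventually allI)
        fix h :: real
        have "norm (flat m h /\<^sub>R \<bar>h\<bar>) \<le> inverse \<bar>h\<bar> * (fact (m + 2) * h ^ 2)"
          using norm_flat_le[of m h] by (simp add: mult_left_mono del: fact_Suc)
        also have "\<dots> = fact (m + 2) * \<bar>h\<bar>"
          by (cases "h = 0") (auto simp: power2_eq_square abs_if field_simps simp del: fact_Suc)
        finally show "norm (flat m h /\<^sub>R \<bar>h\<bar>) \<le> fact (m + 2) * \<bar>h\<bar>" .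
      qed
      show "((\<lambda>h::real. fact (m + 2) * \<bar>h\<bar>) \<longlongrightarrow> 0) (at 0)"
        by (auto intro!: tendsto_eq_intros)
    qed
    from tendsto_norm_zero[OF this]
    have "((\<lambda>h. norm (flat m h) / \<bar>h\<bar>) \<longlongrightarrow> 0) (at 0)" by (simp add: divide_inverse mult.commute)
    moreover have "flat k 0 = 0" for k by (simp add: flat_def)
    ultimately show ?thesis unfolding 3 has_vector_derivative_def has_derivative_at
      by (simp add: bounded_linear_zero)
  qed
qed

lemma times_differentiable_flat: "times_differentiable n (flat m)"
proof (induction n arbitrary: m)
  case (Suc n)
  show ?case unfolding times_differentiable.simps
    by (intro exI conjI allI) (rule has_vector_derivative_flat,
      intro times_differentiable_add times_differentiable_mult times_differentiable_const Suc)
qed simp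

text \<open>The usual quotient \<open>p / (p + q)\<close>, where \<open>p\<close> is positive
  exactly for \<open>t > -2\<close> and \<open>q\<close> exactly for \<open>t < -1\<close>. The
  coefficients \<open>1\<close> and \<open>-1\<close> are written out so that both arguments have
  the shape \<open>a * t + b\<close> of \<open>times_differentiable_affine\<close>.\<close>

definition cutoff :: "real \<Rightarrow> complex" where
  "cutoff t = flat 0 (1 * t + 2) * inverse (flat 0 (1 * t + 2) + flat 0 ((-1) * t + (-1)))"

lemma cutoff:
  "times_differentiable n cutoff" "t \<ge> -1 \<Longrightarrow> cutoff t = 1" "t \<le> -2 \<Longrightarrow> cutoff t = 0"
proof -
  \<comment> \<open>The two arguments add up to 1, so at least one is positive; both values of
    \<open>flat 0\<close> are non-negative reals.\<close>
  have "flat 0 (1 * t + 2) + flat 0 ((-1) * t + (-1)) \<noteq> 0" for t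
  proof -
    have "exp (- inverse (t + 2)) + exp (- inverse (- 1 - t)) > (0::real)" by (simp add: add_pos_pos)
    thus ?thesis unfolding flat_def
      by (auto simp flip: of_real_add simp add: algebra_simps)
  qed
  thus "times_differentiable n cutoff" unfolding cutoff_def
    by (intro times_differentiable_mult times_differentiable_inverse times_differentiable_add
        times_differentiable_affine times_differentiable_flat)
  show "t \<ge> -1 \<Longrightarrow> cutoff t = 1" "t \<le> -2 \<Longrightarrow> cutoff t = 0" by (simp_all add: cutoff_def flat_def)
qed

text \<open>The whole sequence of derivatives is the witness, so passing to the derivative is a
  shift of the sequence.\<close>

definition schwartz_line :: "(real \<Rightarrow> complex) \<Rightarrow> bool" where
  "schwartz_line g \<longleftrightarrow> (\<exists>G. G 0 = g \<and> (\<forall>k t. (G k has_vector_derivative G (Suc k) t) (at t)) \<and>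
     (\<forall>k m. \<exists>K. \<forall>t::real. (1 + t\<^sup>2) ^ m * norm (G k t :: complex) \<le> K))"

text \<open>Outside \<open>[-R, R]\<close> the function is 0 or a multiple of an exponential, and
  both shapes survive differentiation. Decay then follows by compactness in the middle and by
  exponential against polynomial on the right. The alternative \<open>a = 0\<close> covers compact
  support, with \<open>c\<close> arbitrary.\<close>

lemma schwartz_lineI:
  assumes smooth: "\<And>n. times_differentiable n g"
    and left: "\<And>t. t < -R \<Longrightarrow> g t = 0" and right: "\<And>t. t > R \<Longrightarrow> g t = a * exp (c * of_real t)"
    and c: "a = 0 \<or> Re c < 0"
  shows "schwartz_line g"
proof -
  define G where "G = (\<lambda>k. ((\<lambda>f t. vector_derivative f (at t)) ^^ k) g)"
  have "(\<forall>n. times_differentiable n (G k)) \<and> (\<forall>t. (G k has_vector_derivative G (Suc k) t) (at t)) \<and>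
      (\<forall>t< -R. G k t = 0) \<and> (\<forall>t>R. G k t = a * c ^ k * exp (c * of_real t))" for k
  proof (induction k)
    case 0
    have "(g has_vector_derivative vector_derivative g (at t)) (at t)" for t
      using smooth[of 1] by simp (metis vector_derivative_at)
    thus ?case using left right smooth by (simp add: G_def)
  next
    case (Suc k)
    have d: "(G k has_vector_derivative G (Suc k) t) (at t)" for t using Suc by blast
    have sm: "times_differentiable n (G (Suc k))" for n
    proof -
      obtain f' where f': "\<And>t. (G k has_vector_derivative f' t) (at t)" "times_differentiable n f'"
        using Suc times_differentiable.simps(2)[of n "G k"] by blast
      have "f' = G (Suc k)" using vector_derivative_unique_at[OF f'(1) d] by auto
      thus ?thesis using f' by simp
    qed
    have d': "(G (Suc k) has_vector_derivative G (Suc (Suc k)) t) (at t)" for t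
      using sm[of 1] by (simp add: G_def) (metis vector_derivative_at)
    have l: "G (Suc k) t = 0" if "t < -R" for t
    proof -
      have "(G k has_vector_derivative 0) (at t)"
        by (rule has_vector_derivative_transform_within_open[of "\<lambda>_. 0" _ _ "{..< -R}"]) (use that Suc in auto)
      thus ?thesis using vector_derivative_unique_at[OF d] by blast
    qed
    have r: "G (Suc k) t = a * c ^ Suc k * exp (c * of_real t)" if "t > R" for t
    proof -
      have "((\<lambda>t. c * of_real t) has_vector_derivative c) (at t)"
        by (auto intro!: derivative_eq_intros has_vector_derivative_of_real)
      from field_vector_diff_chain_at[OF this DERIV_exp]
      have "((\<lambda>t. exp (c * of_real t)) has_vector_derivative c * exp (c * of_real t)) (at t)"
        by (simp add: o_def)
      from has_vector_derivative_mult_right[OF this, of "a * c ^ k"]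
      have e: "((\<lambda>t. a * c ^ k * exp (c * of_real t)) has_vector_derivative a * c ^ k * (c * exp (c * of_real t))) (at t)" .
      have "(G k has_vector_derivative a * c ^ k * (c * exp (c * of_real t))) (at t)"
        by (rule has_vector_derivative_transform_within_open[OF e, of "{R<..}"]) (use that Suc in auto)
      thus ?thesis using vector_derivative_unique_at[OF d] by (auto simp: algebra_simps)
    qed
    show ?case using sm d' l r by blast
  qed
  hence G: "\<And>k t. (G k has_vector_derivative G (Suc k) t) (at t)"
    "\<And>k t. t < -R \<Longrightarrow> G k t = 0" "\<And>k t. t > R \<Longrightarrow> G k t = a * c ^ k * exp (c * of_real t)" by auto
  have "\<exists>K. \<forall>t. (1 + t\<^sup>2) ^ m * norm (G k t) \<le> K" for k m
  proof -
    \<comment> \<open>\<open>S\<close> exceeds \<open>\<bar>R\<bar>\<close>, so the explicit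
      formulas hold in both tails, and it is at least 1, so that
      \<open>1 + t^2 \<le> 2 * t^2\<close> beyond it.\<close>
    define S where "S = max 1 (\<bar>R\<bar> + 1)"
    have "continuous_on {-S..S} (G k)"
      using G(1) by (meson continuous_at_imp_continuous_on has_vector_derivative_continuous)
    hence "compact ((\<lambda>t. (1 + t\<^sup>2) ^ m * norm (G k t)) ` {-S..S})"
      by (intro compact_continuous_image continuous_intros) auto
    then obtain K0 where K0: "\<And>t. t \<in> {-S..S} \<Longrightarrow> (1 + t\<^sup>2) ^ m * norm (G k t) \<le> K0"
      using compact_imp_bounded bounded_real by (metis (no_types, lifting) abs_le_D1 image_eqI)
    \<comment> \<open>The constant combines \<open>(1 + t^2)^m \<le> 2^m * t^(2*m)\<close> with the
      bound of \<open>power_le_fact_exp\<close> at \<open>- Re c * t\<close>; the exponential of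
      that bound cancels the decay of \<open>G k\<close>.\<close>
    define K1 where "K1 = norm (a * c ^ k) * (2 ^ m * (fact (2 * m) / (- Re c) ^ (2 * m)))"
    have K1: "(1 + t\<^sup>2) ^ m * norm (G k t) \<le> K1" if t: "t > S" for t
    proof (cases "a = 0")
      case False
      hence rc: "Re c < 0" using c by simp
      have "t > 1" "t > R" using t by (auto simp: S_def)
      hence "1 \<le> t\<^sup>2" by (metis less_eq_real_def one_le_power)
      hence "(1 + t\<^sup>2) ^ m \<le> (2 * t\<^sup>2) ^ m" by (intro power_mono) auto
      also have "\<dots> = 2 ^ m * t ^ (2 * m)" by (simp add: power_mult_distrib power_mult)
      also have "t ^ (2 * m) = (- Re c * t) ^ (2 * m) / (- Re c) ^ (2 * m)"
        using rc by (simp add: power_mult_distrib)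
      also have "\<dots> \<le> fact (2 * m) * exp (- Re c * t) / (- Re c) ^ (2 * m)"
        using rc \<open>t > 1\<close> by (intro divide_right_mono power_le_fact_exp) (auto simp: mult_nonpos_nonneg)
      finally have "(1 + t\<^sup>2) ^ m \<le> 2 ^ m * (fact (2 * m) * exp (- Re c * t) / (- Re c) ^ (2 * m))" by simp
      hence "(1 + t\<^sup>2) ^ m * norm (G k t) \<le> 2 ^ m * (fact (2 * m) * exp (- Re c * t) / (- Re c) ^ (2 * m)) * norm (G k t)"
        by (rule mult_right_mono) simp
      also have Gk: "norm (G k t) = norm (a * c ^ k) * exp (Re c * t)"
        using G(3)[OF \<open>t > R\<close>] by (simp add: norm_mult)
      also have "2 ^ m * (fact (2 * m) * exp (- Re c * t) / (- Re c) ^ (2 * m)) * (norm (a * c ^ k) * exp (Re c * t)) = K1 * (exp (- Re c * t) * exp (Re c * t))"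
        by (simp add: K1_def)
      also have "exp (- Re c * t) * exp (Re c * t) = 1" by (simp flip: exp_add)
      finally show ?thesis unfolding Gk by simp
    qed (use G(3)[of t k] t in \<open>simp add: S_def K1_def\<close>)
    have "(1 + t\<^sup>2) ^ m * norm (G k t) \<le> max (max K0 K1) 0" for t
    proof -
      consider "t \<in> {-S..S}" | "t > S" | "t < -S" by fastforce
      thus ?thesis
      proof cases
        case 3
        hence "t < -R" by (auto simp: S_def)
        thus ?thesis using G(2) by simp
      qed (use K0 K1 in \<open>force+\<close>)
    qed
    thus ?thesis by blast
  qed
  thus ?thesis unfolding schwartz_line_def using G(1) by (intro exI[of _ G]) (auto simp: G_def)
qed

text \<open>The factor along a generator of the cone: it has to be the exponential on a whole
  half-line, whence the condition on \<open>Re c\<close>. The half-line starts at -1 to leave room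
  around every point of the cone.\<close>

lemma schwartz_line_exp_right:
  assumes "Re c < 0"
  obtains g where "schwartz_line g" "\<And>t. t > -1 \<Longrightarrow> g t = exp (c * of_real t)"
proof
  show "schwartz_line (\<lambda>t. cutoff t * exp (c * of_real t))"
    by (rule schwartz_lineI[of _ 2 1 c])
      (use assms in \<open>auto simp: cutoff intro!: times_differentiable_mult times_differentiable_exp cutoff\<close>)
qed (simp add: cutoff)

text \<open>The factor in a lattice direction off the cone, where only a neighbourhood of 0 matters.
  Two opposite cutoffs give compact support, so \<open>c\<close> may be arbitrary.\<close>

lemma schwartz_line_exp_local:
  obtains g where "schwartz_line g" "\<And>t. \<bar>t\<bar> < 1 \<Longrightarrow> g t = exp (c * of_real t)"
proof
  show "schwartz_line (\<lambda>t. cutoff t * cutoff ((-1) * t + 0) * exp (c * of_real t))"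
    by (rule schwartz_lineI[of _ 2 0 c])
      (intro times_differentiable_mult times_differentiable_exp times_differentiable_affine cutoff,
        auto simp: cutoff)
qed (auto simp: cutoff)

lemma schwartz_line_bound:
  assumes "schwartz_line g"
  obtains K where "\<And>t. (1 + t\<^sup>2) ^ m * norm (g t) \<le> K"
  using assms unfolding schwartz_line_def by metis

lemma schwartz_line_derivative:
  assumes "schwartz_line g"
  obtains g' where "schwartz_line g'" "\<And>t. (g has_vector_derivative g' t) (at t)"
proof -
  obtain G where G: "G 0 = g" "\<And>k t. (G k has_vector_derivative G (Suc k) t) (at t)"
     "\<And>k m. \<exists>K. \<forall>t::real. (1 + t\<^sup>2) ^ m * norm (G k t :: complex) \<le> K"
    using assms unfolding schwartz_line_def by blast
  have "schwartz_line (G 1)" unfolding schwartz_line_def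
    by (intro exI[of _ "\<lambda>k. G (Suc k)"]) (use G in auto)
  thus ?thesis using that[of "G 1"] G(2)[of 0] G(1) by simp
qed

section \<open>Test functions and symbols\<close>

lemma vs_eq_span:
  assumes "rational_space X" "is_zbasis B (lat X)"
  shows "vs X = span B"
proof -
  obtain B0 where "is_zbasis B0 (lat X)" "span B0 = vs X"
    using assms(1) by (auto simp: rational_space_def is_lattice_def)
  thus ?thesis using assms(2) span_int_span unfolding is_zbasis_def by metis
qed

text \<open>The test functions are combinations of products of one-variable Schwartz functions in
  the coordinates of \<open>B\<close>. Products alone are not closed under directional derivatives,
  since the Leibniz rule yields a sum. In this class all estimates become one-dimensional.\<close>

inductive_set tensors :: "'a::real_vector set \<Rightarrow> ('a \<Rightarrow> complex) set" for B where
  prod: "(\<And>b. b \<in> B \<Longrightarrow> schwartz_line (g b)) \<Longrightarrow> (\<lambda>x. \<Prod>b\<in>B. g b (coord B b x)) \<in> tensors B"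
| zero: "(\<lambda>_. 0) \<in> tensors B"
| add: "f \<in> tensors B \<Longrightarrow> g \<in> tensors B \<Longrightarrow> (\<lambda>x. f x + g x) \<in> tensors B"
| scale: "f \<in> tensors B \<Longrightarrow> (\<lambda>x. c * f x) \<in> tensors B"

lemma tensors_sum: "finite I \<Longrightarrow> (\<And>i. i \<in> I \<Longrightarrow> f i \<in> tensors B) \<Longrightarrow> (\<lambda>x. \<Sum>i\<in>I. f i x) \<in> tensors B"
  by (induction I rule: finite_induct) (auto intro: tensors.intros)

lemma tensors_derivative:
  assumes "finite B" "independent B" "f \<in> tensors B"
  shows "\<exists>f'\<in>tensors B. \<forall>x. ((\<lambda>t::real. f (x + t *\<^sub>R v)) has_vector_derivative f' x) (at 0)"
  using assms(3)
proof induction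
  case (prod g)
  have "\<forall>b\<in>B. \<exists>g'. schwartz_line g' \<and> (\<forall>t. (g b has_vector_derivative g' t) (at t))"
    using prod schwartz_line_derivative by metis
  then obtain g' where g': "\<And>b. b \<in> B \<Longrightarrow> schwartz_line (g' b)"
    "\<And>b t. b \<in> B \<Longrightarrow> (g b has_vector_derivative g' b t) (at t)" by metis
  \<comment> \<open>\<open>F b\<close> is the product with only the factor at \<open>b\<close>
    differentiated; \<open>coord B b v\<close> comes from the chain rule.\<close>
  define F where "F = (\<lambda>b x. \<Prod>c\<in>B. (if c = b then g' c else g c) (coord B c x))"
  define f' where "f' = (\<lambda>x. \<Sum>b\<in>B. of_real (coord B b v) * F b x)"
  have "f' \<in> tensors B" unfolding f'_def F_def
    using prod g' by (intro tensors_sum assms(1) tensors.scale tensors.prod) auto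
  moreover have "((\<lambda>t::real. \<Prod>b\<in>B. g b (coord B b (x + t *\<^sub>R v))) has_vector_derivative f' x) (at 0)" for x
  proof -
    have d: "((\<lambda>t::real. g b (coord B b (x + t *\<^sub>R v))) has_derivative
        (\<lambda>t. t *\<^sub>R (of_real (coord B b v) * g' b (coord B b x)))) (at 0)" if "b \<in> B" for b
    proof -
      have "((\<lambda>t. coord B b x + t * coord B b v) has_vector_derivative coord B b v) (at 0)"
        by (auto intro!: derivative_eq_intros)
      from vector_diff_chain_at[OF this, of "g b" "g' b (coord B b x)"] g'(2)[OF that]
      show ?thesis
        by (simp add: o_def coord_add coord_scaleR assms(2) has_vector_derivative_def scaleR_conv_of_real)
    qed
    have "((\<lambda>t::real. \<Prod>b\<in>B. g b (coord B b (x + t *\<^sub>R v))) has_derivative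
      (\<lambda>t. \<Sum>b\<in>B. t *\<^sub>R (of_real (coord B b v) * g' b (coord B b x)) *
          (\<Prod>c\<in>B - {b}. g c (coord B c (x + 0 *\<^sub>R v))))) (at 0)"
      by (rule has_derivative_prod) (rule d)
    moreover have "t *\<^sub>R (of_real (coord B b v) * g' b (coord B b x)) *
          (\<Prod>c\<in>B - {b}. g c (coord B c (x + 0 *\<^sub>R v))) = t *\<^sub>R (of_real (coord B b v) * F b x)"
      if "b \<in> B" for t :: real and b
    proof -
      have "F b x = g' b (coord B b x) * (\<Prod>c\<in>B - {b}. g c (coord B c x))"
        unfolding F_def using that assms(1) by (subst prod.remove[of B b]) (auto intro!: prod.cong)
      thus ?thesis by simp
    qed
    hence "(\<lambda>t::real. \<Sum>b\<in>B. t *\<^sub>R (of_real (coord B b v) * g' b (coord B b x)) *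
          (\<Prod>c\<in>B - {b}. g c (coord B c (x + 0 *\<^sub>R v)))) = (\<lambda>t. t *\<^sub>R f' x)"
      unfolding f'_def scaleR_sum_right by (intro ext sum.cong refl) blast
    ultimately show ?thesis unfolding has_vector_derivative_def by simp
  qed
  ultimately show ?case by blast
next
  case zero
  show ?case by (intro bexI[of _ "\<lambda>_. 0"] tensors.zero) auto
next
  case (add f g)
  then obtain f' g' where *: "f' \<in> tensors B" "g' \<in> tensors B"
    "\<And>x. ((\<lambda>t::real. f (x + t *\<^sub>R v)) has_vector_derivative f' x) (at 0)"
    "\<And>x. ((\<lambda>t::real. g (x + t *\<^sub>R v)) has_vector_derivative g' x) (at 0)" by blast
  thus ?case
    by (intro bexI[of _ "\<lambda>x. f' x + g' x"] tensors.add) (auto intro: has_vector_derivative_add)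
next
  case (scale f c)
  then obtain f' where *: "f' \<in> tensors B"
    "\<And>x. ((\<lambda>t::real. f (x + t *\<^sub>R v)) has_vector_derivative f' x) (at 0)" by blast
  thus ?case
    by (intro bexI[of _ "\<lambda>x. c * f' x"] tensors.scale) (auto intro: has_vector_derivative_mult_right)
qed

lemma nablas_Cons: "nablas (u # us) f = nabla u (nablas us f)"
  by (simp add: nablas_def)

lemma nablas_Nil: "nablas [] f = f"
  by (simp add: nablas_def)

lemma tensors_nablas:
  assumes "finite B" "independent B" "f \<in> tensors B"
  shows "nablas us f \<in> tensors B"
proof (induction us)
  case (Cons u us)
  from tensors_derivative[OF assms(1,2) Cons, of u] obtain f' where f': "f' \<in> tensors B"
    "\<And>x. ((\<lambda>t::real. nablas us f (x + t *\<^sub>R u)) has_vector_derivative f' x) (at 0)" by blast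
  have "nabla u (nablas us f) = f'"
    unfolding nabla_def fun_eq_iff using f'(2) by (auto intro: vector_derivative_at)
  thus ?case using f'(1) by (simp add: nablas_Cons)
qed (simp add: nablas_Nil assms(3))

text \<open>\<open>continuous_in_coords\<close> parametrises by the chosen basis
  \<open>zbasis (lat X)\<close>, which may differ from \<open>B\<close>. Hence the arbitrary
  \<open>Z\<close>: every coordinate relative to \<open>B\<close> is a linear function of the
  parameters.\<close>

lemma tensors_continuous:
  assumes "independent B" "f \<in> tensors B"
  shows "continuous_on UNIV (\<lambda>t :: 'a \<Rightarrow> real. f (\<Sum>z\<in>Z. t z *\<^sub>R (z :: 'a :: real_vector)))"
  using assms(2)
proof induction
  case (prod g)
  have *: "coord B b (\<Sum>z\<in>Z. t z *\<^sub>R z) = (\<Sum>z\<in>Z. t z * coord B b z)" for t b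
    by (simp add: linear_sum[OF linear_coord[OF assms(1)]] coord_scaleR[OF assms(1)])
  have g: "continuous_on UNIV (g b)" if b: "b \<in> B" for b
  proof -
    obtain g' where "\<And>t. (g b has_vector_derivative g' t) (at t)"
      using schwartz_line_derivative[OF prod[OF b]] by metis
    thus ?thesis by (meson continuous_at_imp_continuous_on has_vector_derivative_continuous)
  qed
  have lin: "continuous_on UNIV (\<lambda>t :: 'a \<Rightarrow> real. \<Sum>z\<in>Z. t z * coord B b z)" for b
    by (intro continuous_on_sum continuous_on_mult continuous_on_const continuous_on_product_coordinates)
  show ?case unfolding *
    by (rule continuous_on_prod) (rule continuous_on_compose2[OF g lin], auto)
qed (auto intro!: continuous_intros)

text \<open>The weight is itself a product over \<open>B\<close>, so for a product function the
  bound splits into one-dimensional ones.\<close>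

lemma tensors_bound:
  assumes "finite B" "f \<in> tensors B"
  shows "\<exists>K. \<forall>x. (\<Prod>b\<in>B. 1 + (coord B b x)\<^sup>2) ^ m * norm (f x) \<le> K"
  using assms(2)
proof induction
  case (prod g)
  have "\<forall>b\<in>B. \<exists>K. \<forall>t. (1 + t\<^sup>2) ^ m * norm (g b t) \<le> K"
    using schwartz_line_bound[OF prod] by metis
  then obtain K where K: "\<And>b t. b \<in> B \<Longrightarrow> (1 + t\<^sup>2) ^ m * norm (g b t) \<le> K b" by metis
  have "(\<Prod>b\<in>B. 1 + (coord B b x)\<^sup>2) ^ m * norm (\<Prod>b\<in>B. g b (coord B b x))
      = (\<Prod>b\<in>B. (1 + (coord B b x)\<^sup>2) ^ m * norm (g b (coord B b x)))" for x
    by (simp add: prod_norm prod.distrib prod_power_distrib)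
  also have "\<dots> x \<le> (\<Prod>b\<in>B. K b)" for x
    using K by (intro prod_mono) auto
  finally show ?case by blast
next
  case zero
  show ?case by (intro exI[of _ 0]) simp
next
  case (add f g)
  then obtain K1 K2 where K: "\<And>x. (\<Prod>b\<in>B. 1 + (coord B b x)\<^sup>2) ^ m * norm (f x) \<le> K1"
    "\<And>x. (\<Prod>b\<in>B. 1 + (coord B b x)\<^sup>2) ^ m * norm (g x) \<le> K2" by blast
  have "(\<Prod>b\<in>B. 1 + (coord B b x)\<^sup>2) ^ m * norm (f x + g x) \<le> K1 + K2" for x
  proof -
    have "(\<Prod>b\<in>B. 1 + (coord B b x)\<^sup>2) ^ m * norm (f x + g x)
      \<le> (\<Prod>b\<in>B. 1 + (coord B b x)\<^sup>2) ^ m * (norm (f x) + norm (g x))"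
      by (intro mult_left_mono norm_triangle_ineq zero_le_power prod_nonneg) (auto intro: add_nonneg_nonneg)
    thus ?thesis using K[of x] by (simp add: algebra_simps)
  qed
  thus ?case by blast
next
  case (scale f c)
  then obtain K where K: "\<And>x. (\<Prod>b\<in>B. 1 + (coord B b x)\<^sup>2) ^ m * norm (f x) \<le> K" by blast
  have "(\<Prod>b\<in>B. 1 + (coord B b x)\<^sup>2) ^ m * norm (c * f x) \<le> norm c * K" for x
    using mult_left_mono[OF K[of x], of "norm c"] by (simp add: norm_mult mult_ac)
  thus ?case by blast
qed

lemma ip_sum_sum:
  assumes "inner_product_on V Q" "subspace V" "finite B" "B \<subseteq> V"
  shows "Q (\<Sum>b\<in>B. s b *\<^sub>R b) (\<Sum>b\<in>B. t b *\<^sub>R b) = (\<Sum>b\<in>B. \<Sum>c\<in>B. s b * t c * Q b c)"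
proof -
  have mem: "(\<Sum>b\<in>S. s b *\<^sub>R b) \<in> V" if "S \<subseteq> B" for S s
    using assms that by (intro subspace_sum subspace_scale) auto
  have left: "Q (\<Sum>b\<in>B. s b *\<^sub>R b) y = (\<Sum>b\<in>B. s b * Q b y)" if y: "y \<in> V" for y s
    using assms(3,4)
  proof (induction B rule: finite_induct)
    case empty
    show ?case using inner_product_onD(3)[OF assms(1) y y, of 0]
      inner_product_onD(3)[OF assms(1) subspace_0[OF assms(2)] y, of 0] by simp
  next
    case (insert b B)
    have m: "(\<Sum>b\<in>B. s b *\<^sub>R b) \<in> V" "b \<in> V" "s b *\<^sub>R b \<in> V"
      using insert.prems by (auto intro!: subspace_scale[OF assms(2)] subspace_sum[OF assms(2)])
    have "Q (s b *\<^sub>R b + (\<Sum>b\<in>B. s b *\<^sub>R b)) y = s b * Q b y + (\<Sum>b\<in>B. s b * Q b y)"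
      using inner_product_onD(2)[OF assms(1) m(3,1) y] inner_product_onD(3)[OF assms(1) m(2) y] insert.IH insert.prems
      by auto
    thus ?case using insert.hyps by simp
  qed
  have "Q b (\<Sum>c\<in>B. t c *\<^sub>R c) = (\<Sum>c\<in>B. t c * Q b c)" if "b \<in> B" for b
  proof -
    have bV: "b \<in> V" using that assms(4) by auto
    have "Q b (\<Sum>c\<in>B. t c *\<^sub>R c) = Q (\<Sum>c\<in>B. t c *\<^sub>R c) b"
      by (rule inner_product_onD(1)[OF assms(1) bV mem]) simp
    also have "\<dots> = (\<Sum>c\<in>B. t c * Q c b)" by (rule left[OF bV])
    also have "\<dots> = (\<Sum>c\<in>B. t c * Q b c)"
      using assms(4) bV by (intro sum.cong refl) (metis inner_product_onD(1)[OF assms(1)] subsetD)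
    finally show ?thesis .
  qed
  thus ?thesis using left[OF mem[OF order.refl], of s t] by (simp add: sum_distrib_left mult.assoc)
qed

lemma schwartz_tensors:
  assumes X: "rational_space X" and B: "is_zbasis B (lat X)" and f: "f \<in> tensors B"
  shows "smooth_on_space X f" "schwartz X f"
proof -
  have fin: "finite B" "independent B" using B by (auto simp: is_zbasis_def)
  have vs: "vs X = span B" by (rule vs_eq_span[OF X B])
  note nab = tensors_nablas[OF fin f]
  show smooth: "smooth_on_space X f"
    unfolding smooth_on_space_def continuous_in_coords_def
  proof (intro allI impI conjI ballI)
    fix us show "continuous_on UNIV (\<lambda>t. nablas us f (\<Sum>b\<in>zbasis (lat X). t b *\<^sub>R b))"
      by (rule tensors_continuous[OF fin(2) nab])
    fix x v
    from tensors_derivative[OF fin nab[of us], of v]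
    show "(\<lambda>t::real. nablas us f (x + t *\<^sub>R v)) differentiable at 0"
      by (meson differentiableI_vector)
  qed
  \<comment> \<open>With \<open>w\<close> the product of all \<open>1 + (coord B b x)^2\<close>,
    each coordinate is at most \<open>w\<close> in modulus, so \<open>ip X x x\<close> is at most
    \<open>w^2\<close> times the double sum. The summand 1 absorbs the 1 of
    \<open>1 + ip X x x\<close>. This trades the weight of \<open>schwartz\<close> for the product
    weight with doubled exponent.\<close>
  define K where "K = 1 + (\<Sum>b\<in>B. \<Sum>c\<in>B. \<bar>ip X b c\<bar>)"
  have K: "1 + ip X x x \<le> K * (\<Prod>b\<in>B. 1 + (coord B b x)\<^sup>2)\<^sup>2" and ip0: "0 \<le> 1 + ip X x x" if x: "x \<in> vs X" for x
  proof -
    define w where "w = (\<Prod>b\<in>B. 1 + (coord B b x)\<^sup>2)"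
    have w1: "1 \<le> w" unfolding w_def by (intro prod_ge_1) auto
    have le: "\<bar>coord B b x\<bar> \<le> w" if "b \<in> B" for b
    proof -
      have "\<bar>coord B b x\<bar> \<le> 1 + (coord B b x)\<^sup>2"
        using zero_le_power2[of "\<bar>coord B b x\<bar> - 1"] by (simp add: power2_eq_square algebra_simps)
      also have "\<dots> = (\<Prod>c\<in>{b}. 1 + (coord B c x)\<^sup>2)" by simp
      also have "\<dots> \<le> w" unfolding w_def
        using that fin(1) by (intro prod_mono2) auto
      finally show ?thesis .
    qed
    have "ip X x x = ip X (\<Sum>b\<in>B. coord B b x *\<^sub>R b) (\<Sum>b\<in>B. coord B b x *\<^sub>R b)"
      using sum_coord[OF fin] x vs by simp
    also have "\<dots> = (\<Sum>b\<in>B. \<Sum>c\<in>B. coord B b x * coord B c x * ip X b c)"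
      using rational_spaceD[OF X] vs by (intro ip_sum_sum[of "vs X"] fin) (auto intro: span_base)
    also have "\<dots> \<le> (\<Sum>b\<in>B. \<Sum>c\<in>B. w * w * \<bar>ip X b c\<bar>)"
    proof (intro sum_mono)
      fix b c assume bc: "b \<in> B" "c \<in> B"
      have "coord B b x * coord B c x * ip X b c \<le> \<bar>coord B b x\<bar> * \<bar>coord B c x\<bar> * \<bar>ip X b c\<bar>"
        by (metis abs_ge_self abs_mult)
      also have "\<dots> \<le> w * w * \<bar>ip X b c\<bar>" using le bc w1 by (intro mult_mono) auto
      finally show "coord B b x * coord B c x * ip X b c \<le> w * w * \<bar>ip X b c\<bar>" .
    qed
    also have "\<dots> = w\<^sup>2 * (K - 1)" by (simp add: K_def sum_distrib_left power2_eq_square)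
    finally have "1 + ip X x x \<le> 1 + w\<^sup>2 * (K - 1)" by simp
    moreover have "1 \<le> w\<^sup>2" using w1 by simp
    ultimately show "1 + ip X x x \<le> K * (\<Prod>b\<in>B. 1 + (coord B b x)\<^sup>2)\<^sup>2"
      unfolding w_def[symmetric] by (simp add: algebra_simps)
    show "0 \<le> 1 + ip X x x"
      using inner_product_onD(3)[OF rational_spaceD(2)[OF X] x x, of 0]
        inner_product_onD(4)[OF rational_spaceD(2)[OF X] x x] by (cases "x = 0") auto
  qed
  have K0: "0 \<le> K" unfolding K_def by (intro add_nonneg_nonneg sum_nonneg) auto
  show "schwartz X f" unfolding schwartz_def
  proof (intro conjI smooth allI impI)
    fix us :: "'a list" and m
    obtain M where M: "\<And>x. (\<Prod>b\<in>B. 1 + (coord B b x)\<^sup>2) ^ (2 * m) * norm (nablas us f x) \<le> M"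
      using tensors_bound[OF fin(1) nab] by blast
    have "(1 + ip X x x) ^ m * norm (nablas us f x) \<le> K ^ m * M" if x: "x \<in> vs X" for x
    proof -
      have "(1 + ip X x x) ^ m * norm (nablas us f x) \<le> (K * (\<Prod>b\<in>B. 1 + (coord B b x)\<^sup>2)\<^sup>2) ^ m * norm (nablas us f x)"
        using K[OF x] ip0[OF x] by (intro mult_right_mono power_mono) auto
      also have "\<dots> = K ^ m * ((\<Prod>b\<in>B. 1 + (coord B b x)\<^sup>2) ^ (2 * m) * norm (nablas us f x))"
        by (simp add: power_mult_distrib power_mult)
      also have "\<dots> \<le> K ^ m * M" using M K0 by (intro mult_left_mono) auto
      finally show ?thesis .
    qed
    thus "\<exists>K. \<forall>x\<in>vs X. (1 + ip X x x) ^ m * norm (nablas us f x) \<le> K" by blast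
  qed
qed

text \<open>One half-line factor for each generator and one local factor for each other basis
  vector. The box on which the product is the exponential surrounds the cone, so derivatives at
  points of the cone are those of the exponential.\<close>

lemma tensors_exp_near_cone:
  assumes "finite B" "V \<subseteq> B" "\<And>b. b \<in> V \<Longrightarrow> Re (\<xi> b) < 0"
  obtains f where "f \<in> tensors B"
    "\<And>x. (\<And>b. b \<in> V \<Longrightarrow> coord B b x > -1) \<Longrightarrow> (\<And>b. b \<in> B - V \<Longrightarrow> \<bar>coord B b x\<bar> < 1) \<Longrightarrow>
       f x = exp (\<Sum>b\<in>B. coord B b x *\<^sub>R \<xi> b)"
proof -
  have "\<exists>g. schwartz_line g \<and> (\<forall>t. (if b \<in> V then t > -1 else \<bar>t\<bar> < 1) \<longrightarrow> g t = exp (\<xi> b * of_real t))" for b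
    using schwartz_line_exp_right[OF assms(3)[of b]] schwartz_line_exp_local[of "\<xi> b"] by metis
  then obtain g where g: "\<And>b. schwartz_line (g b)"
    "\<And>b t. (if b \<in> V then t > -1 else \<bar>t\<bar> < 1) \<Longrightarrow> g b t = exp (\<xi> b * of_real t)" by metis
  show ?thesis
  proof (rule that)
    show "(\<lambda>x. \<Prod>b\<in>B. g b (coord B b x)) \<in> tensors B" by (intro tensors.prod g)
    fix x assume "\<And>b. b \<in> V \<Longrightarrow> coord B b x > -1" "\<And>b. b \<in> B - V \<Longrightarrow> \<bar>coord B b x\<bar> < 1"
    hence "(\<Prod>b\<in>B. g b (coord B b x)) = (\<Prod>b\<in>B. exp (coord B b x *\<^sub>R \<xi> b))"
      by (intro prod.cong refl) (subst g(2), auto simp: scaleR_conv_of_real mult.commute)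
    thus "(\<Prod>b\<in>B. g b (coord B b x)) = exp (\<Sum>b\<in>B. coord B b x *\<^sub>R \<xi> b)"
      using assms(1) by (simp add: exp_sum)
  qed
qed

section \<open>Constant-coefficient operators on exponentials, and their symbols\<close>

lemma dualD:
  assumes "\<xi> \<in> dual X"
  shows "x \<in> vs X \<Longrightarrow> y \<in> vs X \<Longrightarrow> \<xi> (x + y) = \<xi> x + \<xi> y" "x \<in> vs X \<Longrightarrow> \<xi> (r *\<^sub>R x) = r *\<^sub>R \<xi> x"
  using assms by (auto simp: dual_def)

lemma dual_sum:
  assumes "\<xi> \<in> dual X" "subspace (vs X)" "finite S" "S \<subseteq> vs X"
  shows "\<xi> (\<Sum>b\<in>S. t b *\<^sub>R b) = (\<Sum>b\<in>S. t b *\<^sub>R \<xi> b)"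
  using assms(3,4)
proof (induction S rule: finite_induct)
  case empty
  show ?case using dualD(2)[OF assms(1) subspace_0[OF assms(2)], of 0] by simp
next
  case (insert b S)
  hence "(\<Sum>b\<in>S. t b *\<^sub>R b) \<in> vs X" "t b *\<^sub>R b \<in> vs X"
    using assms(2) by (auto intro!: subspace_sum subspace_scale)
  thus ?case using insert dualD[OF assms(1)] by simp
qed

text \<open>Openness of \<open>U\<close> is replaced by its trace on lines: from a point of
  \<open>U\<close>, a short move in any direction of \<open>vs X\<close> stays in \<open>U\<close>.
  This suffices because \<open>nabla\<close> sees a function on one line only, and the induction
  keeps the formula valid at all points of \<open>U\<close>.\<close>

lemma nablas_exp_local:
  assumes \<xi>: "\<xi> \<in> dual X" and X: "subspace (vs X)"
    and U: "U \<subseteq> vs X" "\<And>x v. x \<in> U \<Longrightarrow> v \<in> vs X \<Longrightarrow> \<forall>\<^sub>F t in nhds (0::real). x + t *\<^sub>R v \<in> U"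
    and f: "\<And>x. x \<in> U \<Longrightarrow> f x = exp (\<xi> x)"
    and "set us \<subseteq> vs X" "x \<in> U"
  shows "nablas us f x = prod_list (map \<xi> us) * exp (\<xi> x)"
  using assms(6,7)
proof (induction us arbitrary: x)
  case Nil
  thus ?case using f by (simp add: nablas_Nil)
next
  case (Cons u us)
  have xu: "x \<in> vs X" "u \<in> vs X" using Cons.prems U by auto
  have "((\<lambda>t. \<xi> x + of_real t * \<xi> u) has_vector_derivative \<xi> u) (at 0)"
    by (auto intro!: derivative_eq_intros has_vector_derivative_of_real)
  from field_vector_diff_chain_at[OF this DERIV_exp]
  have "((\<lambda>t. exp (\<xi> x + of_real t * \<xi> u)) has_vector_derivative \<xi> u * exp (\<xi> x)) (at 0)"
    by (simp add: o_def)
  from has_vector_derivative_mult_right[OF this, of "prod_list (map \<xi> us)"]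
  have d: "((\<lambda>t. prod_list (map \<xi> us) * exp (\<xi> x + of_real t * \<xi> u)) has_vector_derivative
      prod_list (map \<xi> us) * (\<xi> u * exp (\<xi> x))) (at 0)" .
  have ev: "\<forall>\<^sub>F t in nhds (0::real). nablas us f (x + t *\<^sub>R u) = prod_list (map \<xi> us) * exp (\<xi> x + of_real t * \<xi> u)"
    using U(2)[OF Cons.prems(2) xu(2)]
  proof eventually_elim
    case (elim t)
    have "\<xi> (x + t *\<^sub>R u) = \<xi> x + of_real t * \<xi> u"
      using dualD[OF \<xi>] xu subspace_scale[OF X] by (simp add: scaleR_conv_of_real)
    thus ?case using Cons.IH[OF _ elim] Cons.prems by simp
  qed
  obtain T where "open T" "0 \<in> T"
    "\<And>t. t \<in> T \<Longrightarrow> nablas us f (x + t *\<^sub>R u) = prod_list (map \<xi> us) * exp (\<xi> x + of_real t * \<xi> u)"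
    using ev by (auto simp: eventually_nhds)
  hence "((\<lambda>t. nablas us f (x + t *\<^sub>R u)) has_vector_derivative
      prod_list (map \<xi> us) * (\<xi> u * exp (\<xi> x))) (at 0)"
    by (intro has_vector_derivative_transform_within_open[OF d]) auto
  hence "nabla u (nablas us f) x = prod_list (map \<xi> us) * (\<xi> u * exp (\<xi> x))"
    unfolding nabla_def by (rule vector_derivative_at)
  thus ?case by (simp add: nablas_Cons mult_ac)
qed


lemma is_zbasis_zbasis: "is_lattice \<Lambda> V \<Longrightarrow> is_zbasis (zbasis \<Lambda>) \<Lambda>"
  unfolding is_lattice_def zbasis_def by (elim exE conjE) (rule someI)

lemma zbasis_rational_space:
  assumes "rational_space X"
  shows "is_zbasis (zbasis (lat X)) (lat X)" "finite (zbasis (lat X))" "independent (zbasis (lat X))"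
    "span (zbasis (lat X)) = vs X" "zbasis (lat X) \<subseteq> vs X"
proof -
  show *: "is_zbasis (zbasis (lat X)) (lat X)"
    using assms is_zbasis_zbasis by (auto simp: rational_space_def)
  thus "finite (zbasis (lat X))" "independent (zbasis (lat X))" by (auto simp: is_zbasis_def)
  show "span (zbasis (lat X)) = vs X" using vs_eq_span[OF assms *] by simp
  thus "zbasis (lat X) \<subseteq> vs X" using span_superset by metis
qed

lemma nablas_exp:
  assumes "\<xi> \<in> dual X" "subspace (vs X)" "set us \<subseteq> vs X" "x \<in> vs X"
  shows "nablas us (\<lambda>y. exp (\<xi> y)) x = prod_list (map \<xi> us) * exp (\<xi> x)"
  using assms by (intro nablas_exp_local[OF assms(1,2), of "vs X"])
    (auto intro!: always_eventually subspace_add subspace_scale)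

text \<open>\<open>hom_diff_op\<close> describes an operator on smooth functions only, and
  \<open>symbol\<close> applies it to an exponential.\<close>

lemma smooth_on_space_exp:
  assumes X: "rational_space X" and \<xi>: "\<xi> \<in> dual X"
  shows "smooth_on_space X (\<lambda>y. exp (\<xi> y))"
  unfolding smooth_on_space_def continuous_in_coords_def
proof (intro allI impI conjI ballI)
  note Z = zbasis_rational_space[OF X]
  have sub: "subspace (vs X)" using rational_spaceD[OF X] by simp
  fix us assume us: "set us \<subseteq> vs X"
  have "nablas us (\<lambda>y. exp (\<xi> y)) (\<Sum>z\<in>zbasis (lat X). t z *\<^sub>R z) =
      prod_list (map \<xi> us) * exp (\<Sum>z\<in>zbasis (lat X). t z *\<^sub>R \<xi> z)" for t
  proof -
    have "(\<Sum>z\<in>zbasis (lat X). t z *\<^sub>R z) \<in> vs X"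
      using Z(5) by (intro subspace_sum subspace_scale sub) auto
    thus ?thesis using nablas_exp[OF \<xi> sub us] dual_sum[OF \<xi> sub Z(2,5)] by simp
  qed
  moreover have "continuous_on UNIV (\<lambda>t :: 'a \<Rightarrow> real.
      prod_list (map \<xi> us) * exp (\<Sum>z\<in>zbasis (lat X). t z *\<^sub>R \<xi> z))"
    by (intro continuous_on_mult continuous_on_const continuous_on_exp continuous_on_sum
        continuous_on_scaleR continuous_on_product_coordinates)
  ultimately show "continuous_on UNIV (\<lambda>t. nablas us (\<lambda>y. exp (\<xi> y)) (\<Sum>b\<in>zbasis (lat X). t b *\<^sub>R b))"
    by simp
  fix x v assume xv: "x \<in> vs X" "v \<in> vs X"
  have "nablas us (\<lambda>y. exp (\<xi> y)) (x + t *\<^sub>R v) = prod_list (map \<xi> us) * exp (\<xi> x + t *\<^sub>R \<xi> v)" for t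
    using nablas_exp[OF \<xi> sub us, of "x + t *\<^sub>R v"] xv dualD[OF \<xi>] sub
    by (simp add: subspace_add subspace_scale)
  moreover have "(\<lambda>t::real. prod_list (map \<xi> us) * exp (\<xi> x + t *\<^sub>R \<xi> v)) differentiable at 0"
  proof -
    have "((\<lambda>t. \<xi> x + t *\<^sub>R \<xi> v) has_vector_derivative \<xi> v) (at 0)"
      by (auto intro!: derivative_eq_intros)
    from has_vector_derivative_mult_right[OF field_vector_diff_chain_at[OF this DERIV_exp], of "prod_list (map \<xi> us)"]
    show ?thesis unfolding o_def by (rule differentiableI_vector)
  qed
  ultimately show "(\<lambda>t::real. nablas us (\<lambda>y. exp (\<xi> y)) (x + t *\<^sub>R v)) differentiable at 0"
    by simp
qed

text \<open>A single presentation by \<open>T\<close> and \<open>c\<close> serves two purposes: the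
  symbol is a polynomial in \<xi>, which permits analytic continuation, and the operator multiplies
  by the symbol wherever a smooth function is locally an exponential.\<close>

lemma hom_diff_op_symbol:
  assumes X: "rational_space X" and D: "hom_diff_op X m D"
  obtains T c where "finite T" "\<And>us. us \<in> T \<Longrightarrow> length us = m \<and> set us \<subseteq> vs X"
    "\<And>\<xi>. \<xi> \<in> dual X \<Longrightarrow> symbol X D \<xi> = (\<Sum>us\<in>T. c us * prod_list (map \<xi> us))"
    "\<And>\<xi> f U x. \<xi> \<in> dual X \<Longrightarrow> smooth_on_space X f \<Longrightarrow> U \<subseteq> vs X \<Longrightarrow>
      (\<And>x v. x \<in> U \<Longrightarrow> v \<in> vs X \<Longrightarrow> \<forall>\<^sub>F t in nhds (0::real). x + t *\<^sub>R v \<in> U) \<Longrightarrow>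
      (\<And>x. x \<in> U \<Longrightarrow> f x = exp (\<xi> x)) \<Longrightarrow> x \<in> U \<Longrightarrow> D f x = symbol X D \<xi> * exp (\<xi> x)"
proof -
  obtain T c where T': "finite T" "\<forall>us\<in>T. length us = m \<and> set us \<subseteq> vs X"
    "\<forall>f. smooth_on_space X f \<longrightarrow> (\<forall>x\<in>vs X. D f x = (\<Sum>us\<in>T. c us * nablas us f x))"
    using D unfolding hom_diff_op_def by (elim exE conjE) (rule that)
  have T: "finite T" "\<And>us. us \<in> T \<Longrightarrow> length us = m \<and> set us \<subseteq> vs X"
    "\<And>f x. smooth_on_space X f \<Longrightarrow> x \<in> vs X \<Longrightarrow> D f x = (\<Sum>us\<in>T. c us * nablas us f x)"
    using T' by simp_all
  have sub: "subspace (vs X)" using rational_spaceD[OF X] by simp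
  have loc: "D f x = (\<Sum>us\<in>T. c us * prod_list (map \<xi> us)) * exp (\<xi> x)"
    if "\<xi> \<in> dual X" "smooth_on_space X f" "U \<subseteq> vs X"
      "\<And>x v. x \<in> U \<Longrightarrow> v \<in> vs X \<Longrightarrow> \<forall>\<^sub>F t in nhds (0::real). x + t *\<^sub>R v \<in> U"
      "\<And>x. x \<in> U \<Longrightarrow> f x = exp (\<xi> x)" "x \<in> U" for \<xi> f U x
  proof -
    have "x \<in> vs X" using that by auto
    have "nablas us f x = prod_list (map \<xi> us) * exp (\<xi> x)" if "us \<in> T" for us
      using nablas_exp_local[OF \<open>\<xi> \<in> dual X\<close> sub \<open>U \<subseteq> vs X\<close>] T(2)[OF that] \<open>x \<in> U\<close>
        \<open>\<And>x v. x \<in> U \<Longrightarrow> v \<in> vs X \<Longrightarrow> \<forall>\<^sub>F t in nhds (0::real). x + t *\<^sub>R v \<in> U\<close>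
        \<open>\<And>x. x \<in> U \<Longrightarrow> f x = exp (\<xi> x)\<close> by blast
    thus ?thesis using T(3)[OF \<open>smooth_on_space X f\<close> \<open>x \<in> vs X\<close>]
      by (simp add: sum_distrib_right mult.assoc)
  qed
  have sym: "symbol X D \<xi> = (\<Sum>us\<in>T. c us * prod_list (map \<xi> us))" if \<xi>: "\<xi> \<in> dual X" for \<xi>
  proof -
    have "exp (- \<xi> x) * D (\<lambda>y. exp (\<xi> y)) x = (\<Sum>us\<in>T. c us * prod_list (map \<xi> us))"
      if "x \<in> vs X" for x
      by (subst loc[OF \<xi> smooth_on_space_exp[OF X \<xi>], of "vs X"])
        (use that sub in \<open>auto intro!: always_eventually subspace_add subspace_scale simp: exp_minus\<close>)
    thus ?thesis unfolding symbol_def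
      using subspace_0[OF sub] by (intro the_equality) auto
  qed
  show ?thesis
  proof (rule that[OF T(1,2) sym])
    fix \<xi> f U x
    assume *: "\<xi> \<in> dual X" "smooth_on_space X f" "U \<subseteq> vs X"
      "\<And>x v. x \<in> U \<Longrightarrow> v \<in> vs X \<Longrightarrow> \<forall>\<^sub>F t in nhds (0::real). x + t *\<^sub>R v \<in> U"
      "\<And>x. x \<in> U \<Longrightarrow> f x = exp (\<xi> x)" "x \<in> U"
    show "D f x = symbol X D \<xi> * exp (\<xi> x)" unfolding sym[OF *(1)] by (rule loc[OF *])
  qed
qed

section \<open>Change of basis for Lebesgue measure\<close>

interpretation lborel_product: product_sigma_finite "\<lambda>_. lborel :: real measure"
  by (rule product_sigma_finite.intro) (rule lborel.sigma_finite_measure_axioms)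

text \<open>Translation invariance, one coordinate at a time by Tonelli. The shifted argument is
  restricted to \<open>B\<close> because points of the product space are extensional.\<close>

lemma nn_integral_PiM_lborel_shift:
  assumes "finite B" "G \<in> borel_measurable (\<Pi>\<^sub>M b\<in>B. (lborel :: real measure))"
  shows "(\<integral>\<^sup>+t. G (\<lambda>b\<in>B. t b + d b) \<partial>(\<Pi>\<^sub>M b\<in>B. lborel)) = (\<integral>\<^sup>+t. G t \<partial>(\<Pi>\<^sub>M b\<in>B. lborel))"
  using assms
proof (induction B arbitrary: G rule: finite_induct)
  case empty
  show ?case by (intro nn_integral_cong) (auto simp: space_PiM)
next
  case (insert b B)
  note [measurable] = insert.prems
  have [measurable]: "(\<lambda>t. \<lambda>i\<in>insert b B. t i + d i) \<in>
      measurable (\<Pi>\<^sub>M i\<in>insert b B. lborel) (\<Pi>\<^sub>M i\<in>insert b B. (lborel :: real measure))"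
    by measurable
  have upd: "(\<lambda>i\<in>insert b B. (x(b := y)) i + d i) = (\<lambda>i\<in>B. x i + d i)(b := y + d b)" for x :: "'a \<Rightarrow> real" and y
    using insert.hyps by (auto simp: fun_eq_iff restrict_def)
  have m2: "(\<lambda>y. G (x(b := y))) \<in> borel_measurable lborel" if "x \<in> space (\<Pi>\<^sub>M i\<in>B. (lborel :: real measure))" for x
    using that insert.hyps by measurable
  have "(\<integral>\<^sup>+t. G (\<lambda>i\<in>insert b B. t i + d i) \<partial>(\<Pi>\<^sub>M i\<in>insert b B. lborel))
      = (\<integral>\<^sup>+x. \<integral>\<^sup>+y. G ((\<lambda>i\<in>B. x i + d i)(b := y + d b)) \<partial>lborel \<partial>(\<Pi>\<^sub>M i\<in>B. lborel))"
    using insert.hyps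
    by (subst lborel_product.product_nn_integral_insert) (measurable, simp_all only: upd)
  also have "\<dots> = (\<integral>\<^sup>+x. \<integral>\<^sup>+y. G ((\<lambda>i\<in>B. x i + d i)(b := y)) \<partial>lborel \<partial>(\<Pi>\<^sub>M i\<in>B. lborel))"
  proof (rule nn_integral_cong)
    fix x :: "'a \<Rightarrow> real" assume "x \<in> space (\<Pi>\<^sub>M i\<in>B. lborel)"
    have "(\<lambda>i\<in>B. x i + d i) \<in> space (\<Pi>\<^sub>M i\<in>B. (lborel :: real measure))" by (auto simp: space_PiM)
    from m2[OF this] show "(\<integral>\<^sup>+y. G ((\<lambda>i\<in>B. x i + d i)(b := y + d b)) \<partial>lborel) = (\<integral>\<^sup>+y. G ((\<lambda>i\<in>B. x i + d i)(b := y)) \<partial>lborel)"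
      using nn_integral_real_affine[of "\<lambda>y. G ((\<lambda>i\<in>B. x i + d i)(b := y))" 1 "d b"]
      by (simp add: add.commute)
  qed
  also have "\<dots> = (\<integral>\<^sup>+x. \<integral>\<^sup>+y. G (x(b := y)) \<partial>lborel \<partial>(\<Pi>\<^sub>M i\<in>B. lborel))"
    using insert.hyps by (intro insert.IH) measurable
  also have "\<dots> = (\<integral>\<^sup>+t. G t \<partial>(\<Pi>\<^sub>M i\<in>insert b B. lborel))"
    using insert.hyps by (subst lborel_product.product_nn_integral_insert) auto
  finally show ?case .
qed

definition param :: "'a::real_vector set \<Rightarrow> ('a \<Rightarrow> real) \<Rightarrow> 'a" where
  "param B t = (\<Sum>b\<in>B. t b *\<^sub>R b)"

text \<open>The two parametrisations differ by a linear map of determinant \<open>a b\<close>: a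
  shear of the other coordinates by multiples of the coordinate of \<open>v\<close>, and a scaling
  of that coordinate. Tonelli reduces the claim to translation invariance and one-variable
  scaling.\<close>

lemma param_exchange:
  fixes B :: "'a::real_vector set"
  assumes "finite B" "independent B" "b \<in> B" "v = (\<Sum>c\<in>B. a c *\<^sub>R c)" "a b \<noteq> 0"
    and f: "(\<lambda>t. f (param B t)) \<in> borel_measurable (\<Pi>\<^sub>M c\<in>B. (lborel :: real measure))"
  defines "B' \<equiv> insert v (B - {b})"
  shows "(\<lambda>t. f (param B' t)) \<in> borel_measurable (\<Pi>\<^sub>M c\<in>B'. (lborel :: real measure))" (is ?A)
    and "(\<integral>\<^sup>+t. f (param B t) \<partial>(\<Pi>\<^sub>M c\<in>B. lborel))
       = ennreal \<bar>a b\<bar> * (\<integral>\<^sup>+t. f (param B' t) \<partial>(\<Pi>\<^sub>M c\<in>B'. lborel))" (is ?B)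
proof -
  let ?C = "B - {b}"
  have B: "B = insert b ?C" "b \<notin> ?C" "finite ?C" using assms by auto
  have v: "v \<notin> ?C"
  proof
    assume "v \<in> ?C"
    hence "coord B b v = 0" using coord_basis[OF assms(2), of v b] by auto
    moreover have "coord B b v = a b" using coord_sum[OF assms(1,2), of b a] assms(3,4) by simp
    ultimately show False using assms(5) by simp
  qed
  have par': "param B' t = param B (\<lambda>c\<in>B. if c = b then t v * a b else t c + t v * a c)" for t
  proof -
    have "param B (\<lambda>c\<in>B. if c = b then t v * a b else t c + t v * a c)
        = (t v * a b) *\<^sub>R b + (\<Sum>c\<in>?C. (t c + t v * a c) *\<^sub>R c)"
      unfolding param_def using assms(1,3) by (subst sum.remove[of B b]) (auto intro!: sum.cong)
    also have "\<dots> = (\<Sum>c\<in>?C. t c *\<^sub>R c) + t v *\<^sub>R (a b *\<^sub>R b + (\<Sum>c\<in>?C. a c *\<^sub>R c))"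
      by (simp add: scaleR_add_left sum.distrib scaleR_add_right scaleR_sum_right)
    also have "a b *\<^sub>R b + (\<Sum>c\<in>?C. a c *\<^sub>R c) = v"
      unfolding assms(4) using assms(1,3) by (subst sum.remove[of B b]) auto
    finally show ?thesis unfolding param_def B'_def using v assms(1) by (simp add: add.commute)
  qed
  have mC[measurable]: "(\<lambda>t. t c) \<in> borel_measurable (\<Pi>\<^sub>M c\<in>D. (lborel :: real measure))" if "c \<in> D" for c and D :: "'a set"
    using measurable_component_singleton[OF that, of "\<lambda>_. lborel"] by simp
  have "(\<lambda>t. \<lambda>c\<in>B. if c = b then t v * a b else t c + t v * a c) \<in>
      measurable (\<Pi>\<^sub>M c\<in>B'. lborel) (\<Pi>\<^sub>M c\<in>B. (lborel :: real measure))"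
  proof (rule measurable_restrict)
    fix c assume "c \<in> B"
    have [measurable]: "(\<lambda>t. t v) \<in> borel_measurable (\<Pi>\<^sub>M c\<in>B'. (lborel :: real measure))"
      by (rule mC) (simp add: B'_def)
    show "(\<lambda>t. if c = b then t v * a b else t c + t v * a c) \<in> (\<Pi>\<^sub>M c\<in>B'. lborel) \<rightarrow>\<^sub>M lborel"
    proof (cases "c = b")
      case False
      hence [measurable]: "(\<lambda>t. t c) \<in> borel_measurable (\<Pi>\<^sub>M c\<in>B'. (lborel :: real measure))"
        using \<open>c \<in> B\<close> by (intro mC) (simp add: B'_def)
      show ?thesis using False by simp
    qed simp
  qed
  from measurable_compose[OF this f] show A: ?A by (simp add: par')
  have parB: "param B (x(b := y)) = param ?C x + y *\<^sub>R b" for x y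
    unfolding param_def using assms(1,3) by (subst sum.remove[of B b]) (auto intro!: sum.cong)
  have parB': "param B' (x(v := y)) = param ?C x + y *\<^sub>R v" for x y
  proof -
    have "(\<Sum>c\<in>?C. (x(v := y)) c *\<^sub>R c) = (\<Sum>c\<in>?C. x c *\<^sub>R c)"
      using v by (intro sum.cong) auto
    thus ?thesis unfolding param_def B'_def using v B(3) by simp
  qed
  have fB: "(\<lambda>t. f (param B t)) \<in> borel_measurable (\<Pi>\<^sub>M c\<in>insert b ?C. (lborel :: real measure))"
    using f B(1) by simp
  have fub: "(\<lambda>x. f (param ?C (fst x) + snd x *\<^sub>R b)) \<in> borel_measurable ((\<Pi>\<^sub>M c\<in>?C. (lborel :: real measure)) \<Otimes>\<^sub>M lborel)"
    using measurable_compose[OF measurable_add_dim fB] by (simp add: case_prod_unfold parB)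
  have secx: "(\<lambda>x. f (param ?C x + y *\<^sub>R b)) \<in> borel_measurable (\<Pi>\<^sub>M c\<in>?C. (lborel :: real measure))" for y
    using measurable_compose[OF measurable_Pair1'[of y lborel "\<Pi>\<^sub>M c\<in>?C. (lborel :: real measure)"] measurable_compose[OF measurable_pair_swap' fub]] by simp
  interpret S: pair_sigma_finite "\<Pi>\<^sub>M c\<in>?C. (lborel :: real measure)" lborel
    by (intro pair_sigma_finite.intro lborel_product.sigma_finite lborel.sigma_finite_measure_axioms) (use assms in auto)
  have G: "(\<lambda>y. \<integral>\<^sup>+x. f (param ?C x + y *\<^sub>R b) \<partial>(\<Pi>\<^sub>M c\<in>?C. lborel)) \<in> borel_measurable (lborel :: real measure)"
    using sigma_finite_measure.borel_measurable_nn_integral_fst[OF lborel_product.sigma_finite[OF B(3)] measurable_compose[OF measurable_pair_swap' fub]]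
    by simp
  \<comment> \<open>For fixed \<open>y\<close> the remaining coordinates are merely translated by
    \<open>y * a c\<close>, so the inner integral loses the shear before \<open>y\<close> is
    rescaled.\<close>
  have eqC: "param ?C x + y *\<^sub>R v = param ?C (\<lambda>c\<in>?C. x c + y * a c) + (y * a b) *\<^sub>R b" for x y
  proof -
    have "v = (\<Sum>c\<in>?C. a c *\<^sub>R c) + a b *\<^sub>R b"
      unfolding assms(4) using assms(1,3) by (subst sum.remove[of B b]) auto
    thus ?thesis unfolding param_def
      by (simp add: scaleR_add_left sum.distrib scaleR_add_right scaleR_sum_right algebra_simps)
  qed
  have "(\<integral>\<^sup>+t. f (param B' t) \<partial>(\<Pi>\<^sub>M c\<in>B'. lborel))
      = (\<integral>\<^sup>+y. \<integral>\<^sup>+x. f (param ?C x + y *\<^sub>R v) \<partial>(\<Pi>\<^sub>M c\<in>?C. lborel) \<partial>lborel)"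
    using A v B(3) unfolding B'_def
    by (subst lborel_product.product_nn_integral_insert_rev) (simp_all flip: parB' add: B'_def)
  also have "\<dots> = (\<integral>\<^sup>+y. \<integral>\<^sup>+x. f (param ?C x + (0 + a b * y) *\<^sub>R b) \<partial>(\<Pi>\<^sub>M c\<in>?C. lborel) \<partial>lborel)"
    unfolding eqC using nn_integral_PiM_lborel_shift[OF B(3) secx] by (simp add: mult.commute)
  finally have 1: "ennreal \<bar>a b\<bar> * (\<integral>\<^sup>+t. f (param B' t) \<partial>(\<Pi>\<^sub>M c\<in>B'. lborel)) =
      ennreal \<bar>a b\<bar> * (\<integral>\<^sup>+y. \<integral>\<^sup>+x. f (param ?C x + (0 + a b * y) *\<^sub>R b) \<partial>(\<Pi>\<^sub>M c\<in>?C. lborel) \<partial>lborel)" by simp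
  also have "\<dots> = (\<integral>\<^sup>+y. \<integral>\<^sup>+x. f (param ?C x + y *\<^sub>R b) \<partial>(\<Pi>\<^sub>M c\<in>?C. lborel) \<partial>lborel)"
    using nn_integral_real_affine[OF _ assms(5), of "\<lambda>y. \<integral>\<^sup>+x. f (param ?C x + y *\<^sub>R b) \<partial>(\<Pi>\<^sub>M c\<in>?C. lborel)" 0] G
    by simp
  also have "\<dots> = (\<integral>\<^sup>+t. f (param B t) \<partial>(\<Pi>\<^sub>M c\<in>insert b ?C. lborel))"
    using fB B by (subst lborel_product.product_nn_integral_insert_rev) (simp_all flip: parB)
  also have "insert b ?C = B" using B by simp
  finally show ?B by simp
qed


text \<open>
  Steinitz exchange replaces one basis vector at a time, and each step scales the measure by a constant.
  The homogeneity of the exponential integrals does not depend on the value of the constant.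
\<close>

lemma nn_integral_param_change_basis:
  fixes B V :: "'a::real_vector set"
  assumes "finite B" "independent B" "finite V" "independent V" "span B = span V"
  obtains k :: real where "k > 0"
    "\<And>f. (\<lambda>t. f (param B t)) \<in> borel_measurable (\<Pi>\<^sub>M c\<in>B. lborel) \<Longrightarrow>
      (\<integral>\<^sup>+t. f (param B t) \<partial>(\<Pi>\<^sub>M c\<in>B. lborel)) = ennreal k * (\<integral>\<^sup>+t. f (param V t) \<partial>(\<Pi>\<^sub>M c\<in>V. lborel))"
proof -
  have "\<exists>k::real. k > 0 \<and> (\<forall>f. (\<lambda>t. f (param B t)) \<in> borel_measurable (\<Pi>\<^sub>M c\<in>B. lborel) \<longrightarrow>
      (\<integral>\<^sup>+t. f (param B t) \<partial>(\<Pi>\<^sub>M c\<in>B. lborel)) = ennreal k * (\<integral>\<^sup>+t. f (param V t) \<partial>(\<Pi>\<^sub>M c\<in>V. lborel)))"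
    using assms
  \<comment> \<open>Progress is measured by the number of vectors of \<open>V\<close> still missing
    from the current basis.\<close>
  proof (induction "card (V - B)" arbitrary: B rule: less_induct)
    case less
    note fin = less.prems(1,3)
    show ?case
    proof (cases "V \<subseteq> B")
      case True
      have "card V = card B"
        using less.prems by (metis dim_span_eq_card_independent dim_span)
      hence "V = B" using True fin by (metis card_subset_eq)
      thus ?thesis by (intro exI[of _ 1]) simp
    next
      case False
      then obtain v where v: "v \<in> V" "v \<notin> B" by auto
      have "v \<in> span B" using v(1) less.prems(5) span_base by blast
      define a where "a = (\<lambda>b. coord B b v)"
      have va: "v = (\<Sum>b\<in>B. a b *\<^sub>R b)"
        unfolding a_def using sum_coord[OF fin(1) less.prems(2) \<open>v \<in> span B\<close>] by simp
      \<comment> \<open>The vector to be removed must lie outside \<open>V\<close>, so that nothing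
        already exchanged is lost. If \<open>v\<close> had no coefficient there, it would be a
        combination of other vectors of \<open>V\<close>.\<close>
      have "\<exists>b\<in>B - V. a b \<noteq> 0"
      proof (rule ccontr)
        assume *: "\<not> ?thesis"
        have "v = (\<Sum>b\<in>B \<inter> V. a b *\<^sub>R b)"
          unfolding va using * fin(1) by (intro sum.mono_neutral_right) auto
        also have "\<dots> \<in> span (V - {v})"
          using v(2) by (intro span_sum span_scale span_base) auto
        finally show False using less.prems(4) v(1) by (auto simp: dependent_def)
      qed
      then obtain b where b: "b \<in> B" "b \<notin> V" "a b \<noteq> 0" by auto
      define B' where "B' = insert v (B - {b})"
      note ex = param_exchange[OF fin(1) less.prems(2) b(1) va b(3), folded B'_def]
      have bB': "b \<in> span B'"
      proof -
        have eq: "v = a b *\<^sub>R b + (\<Sum>c\<in>B - {b}. a c *\<^sub>R c)"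
          using va sum.remove[OF fin(1) b(1), of "\<lambda>c. a c *\<^sub>R c"] by simp
        have "v - (\<Sum>c\<in>B - {b}. a c *\<^sub>R c) = a b *\<^sub>R b"
          using eq by (metis add_diff_cancel_right')
        hence "b = (1 / a b) *\<^sub>R (v - (\<Sum>c\<in>B - {b}. a c *\<^sub>R c))"
          using b(3) by simp
        also have "\<dots> \<in> span B'"
          unfolding B'_def by (intro span_scale span_diff span_sum) (auto intro: span_base span_scale)
        finally show ?thesis .
      qed
      have sp: "span B' = span B"
      proof
        show "span B' \<subseteq> span B"
          unfolding B'_def using \<open>v \<in> span B\<close> by (intro span_minimal) (auto intro: span_base)
        show "span B \<subseteq> span B'"
        proof (rule span_minimal)
          show "B \<subseteq> span B'" using bB' by (auto simp: B'_def intro: span_base)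
        qed simp
      qed
      have finB': "finite B'" using fin by (simp add: B'_def)
      have cardB': "card B' = card B"
        unfolding B'_def using v(2) fin(1) card_Suc_Diff1[OF fin(1) b(1)] by simp
      have ind: "independent B'"
      proof -
        have "coord B b x = 0" if "x \<in> span (B - {b})" for x
          using that
        proof (rule span_induct)
          show "subspace {x. coord B b x = 0}"
            using linear_coord[OF less.prems(2)] by (rule linear_subspace_kernel)
          show "c \<in> B - {b} \<Longrightarrow> coord B b c = 0" for c
            using coord_basis[OF less.prems(2)] by auto
        qed
        hence "v \<notin> span (B - {b})" using b(3) unfolding a_def by blast
        thus ?thesis unfolding B'_def
          using independent_insertI[OF _ independent_mono[OF less.prems(2), of "B - {b}"]] by blast
      qed
      have "card (V - B') < card (V - B)"
        by (rule psubset_card_mono) (use fin v b in \<open>auto simp: B'_def\<close>)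
      from less.hyps[OF this finB' ind fin(2) less.prems(4)] sp less.prems(5)
      obtain k :: real where k: "k > 0" "\<And>f. (\<lambda>t. f (param B' t)) \<in> borel_measurable (\<Pi>\<^sub>M c\<in>B'. lborel) \<Longrightarrow>
        (\<integral>\<^sup>+t. f (param B' t) \<partial>(\<Pi>\<^sub>M c\<in>B'. lborel)) = ennreal k * (\<integral>\<^sup>+t. f (param V t) \<partial>(\<Pi>\<^sub>M c\<in>V. lborel))"
        by auto
      show ?thesis
      proof (intro exI[of _ "\<bar>a b\<bar> * k"] conjI allI impI)
        show "\<bar>a b\<bar> * k > 0" using b k by simp
        fix f :: "'a \<Rightarrow> ennreal" assume f: "(\<lambda>t. f (param B t)) \<in> borel_measurable (\<Pi>\<^sub>M c\<in>B. lborel)"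
        show "(\<integral>\<^sup>+t. f (param B t) \<partial>(\<Pi>\<^sub>M c\<in>B. lborel))
          = ennreal (\<bar>a b\<bar> * k) * (\<integral>\<^sup>+t. f (param V t) \<partial>(\<Pi>\<^sub>M c\<in>V. lborel))"
          using ex(2)[OF f] k(2)[OF ex(1)[OF f]] k(1) by (simp add: ennreal_mult mult.assoc)
      qed
    qed
  qed
  thus ?thesis using that by blast
qed

text \<open>As an identity of measures the comparison also transfers integrability and Bochner
  integrals. The shift by \<open>s\<close> accounts for the base point that
  \<open>aff_measure\<close> adds.\<close>

lemma PiM_lborel_change_basis:
  fixes B V :: "'a::real_vector set"
  assumes "finite B" "independent B" "finite V" "independent V" "span B = span V"
  defines "T \<equiv> \<lambda>s u. \<lambda>b\<in>B. coord B b (param V u - s)"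
  obtains k :: real where "k > 0"
    "\<And>s. T s \<in> measurable (\<Pi>\<^sub>M c\<in>V. lborel) (\<Pi>\<^sub>M c\<in>B. lborel)"
    "\<And>s. (\<Pi>\<^sub>M c\<in>B. lborel) = density (distr (\<Pi>\<^sub>M c\<in>V. lborel) (\<Pi>\<^sub>M c\<in>B. lborel) (T s)) (\<lambda>_. ennreal k)"
proof -
  obtain k :: real where k: "k > 0"
    "\<And>f. (\<lambda>t. f (param B t)) \<in> borel_measurable (\<Pi>\<^sub>M c\<in>B. lborel) \<Longrightarrow>
      (\<integral>\<^sup>+t. f (param B t) \<partial>(\<Pi>\<^sub>M c\<in>B. lborel)) = ennreal k * (\<integral>\<^sup>+t. f (param V t) \<partial>(\<Pi>\<^sub>M c\<in>V. lborel))"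
    using nn_integral_param_change_basis[OF assms(1-5)] by blast
  have m: "T s \<in> measurable (\<Pi>\<^sub>M c\<in>V. lborel) (\<Pi>\<^sub>M c\<in>B. lborel)" for s
    unfolding T_def
  proof (rule measurable_restrict)
    fix b assume "b \<in> B"
    have *: "coord B b (param V u - s) = (\<Sum>v\<in>V. u v * coord B b v) - coord B b s" for u
      by (simp add: param_def coord_diff[OF assms(2)] linear_sum[OF linear_coord[OF assms(2)]] coord_scaleR[OF assms(2)])
    have [measurable]: "(\<lambda>t. t v) \<in> borel_measurable (\<Pi>\<^sub>M c\<in>V. (lborel :: real measure))" if "v \<in> V" for v
      using measurable_component_singleton[OF that, of "\<lambda>_. lborel"] by simp
    show "(\<lambda>u. coord B b (param V u - s)) \<in> (\<Pi>\<^sub>M c\<in>V. lborel) \<rightarrow>\<^sub>M lborel"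
      unfolding * by measurable
  qed
  have "(\<Pi>\<^sub>M c\<in>B. lborel) = density (distr (\<Pi>\<^sub>M c\<in>V. lborel) (\<Pi>\<^sub>M c\<in>B. lborel) (T s)) (\<lambda>_. ennreal k)" for s
  proof (rule measure_eqI)
    fix A assume A: "A \<in> sets (\<Pi>\<^sub>M c\<in>B. (lborel :: real measure))"
    \<comment> \<open>Along \<open>param V\<close> this function is the indicator of
      \<open>A\<close> at \<open>T s u\<close>; along \<open>param B\<close> it is a translate of
      the indicator of \<open>A\<close>, with the same integral.\<close>
    define f :: "'a \<Rightarrow> ennreal" where "f = (\<lambda>x. indicator A (\<lambda>b\<in>B. coord B b (x - s)))"
    have fB: "f (param B t) = indicator A (\<lambda>b\<in>B. t b + - coord B b s)" for t
    proof -
      have "(\<lambda>b\<in>B. coord B b (param B t - s)) = (\<lambda>b\<in>B. t b + - coord B b s)"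
        by (auto simp: fun_eq_iff coord_diff[OF assms(2)] param_def coord_sum[OF assms(1,2)])
      thus ?thesis by (simp add: f_def)
    qed
    have fV: "f (param V u) = indicator A (T s u)" for u by (simp add: f_def T_def)
    have mA: "(\<lambda>t. indicator A t :: ennreal) \<in> borel_measurable (\<Pi>\<^sub>M c\<in>B. lborel)"
      using A by simp
    have mshift: "(\<lambda>t. \<lambda>b\<in>B. t b + - coord B b s) \<in> measurable (\<Pi>\<^sub>M c\<in>B. lborel) (\<Pi>\<^sub>M c\<in>B. (lborel :: real measure))"
      by measurable
    have mf: "(\<lambda>t. f (param B t)) \<in> borel_measurable (\<Pi>\<^sub>M c\<in>B. lborel)"
      unfolding fB using measurable_compose[OF mshift mA] .
    have "emeasure (\<Pi>\<^sub>M c\<in>B. lborel) A = (\<integral>\<^sup>+t. indicator A t \<partial>(\<Pi>\<^sub>M c\<in>B. lborel))"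
      using A by simp
    also have "\<dots> = (\<integral>\<^sup>+t. f (param B t) \<partial>(\<Pi>\<^sub>M c\<in>B. lborel))"
      unfolding fB by (rule nn_integral_PiM_lborel_shift[OF assms(1) mA, symmetric])
    also have "\<dots> = ennreal k * (\<integral>\<^sup>+u. indicator A (T s u) \<partial>(\<Pi>\<^sub>M c\<in>V. lborel))"
      using k(2)[OF mf] by (simp add: fV)
    also have "(\<integral>\<^sup>+u. indicator A (T s u) \<partial>(\<Pi>\<^sub>M c\<in>V. lborel)) = emeasure (distr (\<Pi>\<^sub>M c\<in>V. lborel) (\<Pi>\<^sub>M c\<in>B. lborel) (T s)) A"
      using A nn_integral_distr[OF m, of "indicator A" s] by simp
    also have "ennreal k * \<dots> = emeasure (density (distr (\<Pi>\<^sub>M c\<in>V. lborel) (\<Pi>\<^sub>M c\<in>B. lborel) (T s)) (\<lambda>_. ennreal k)) A"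
      using A by (simp add: emeasure_density_const)
    finally show "emeasure (\<Pi>\<^sub>M c\<in>B. lborel) A = \<dots>" .
  qed simp
  thus ?thesis using that k(1) m by blast
qed

section \<open>Simplicial cones\<close>

text \<open>One factor of an exponential on a simplicial cone. The built-in indicator makes the
  integral over the cone an integral of a product over the whole coordinate space.\<close>

definition ray_exp :: "complex \<Rightarrow> real \<Rightarrow> complex" where
  "ray_exp c t = indicator {0..} t *\<^sub>R exp (t *\<^sub>R c)"

lemma measurable_ray_exp [measurable]: "ray_exp c \<in> borel_measurable borel"
proof -
  have "(\<lambda>t::real. exp (t *\<^sub>R c)) \<in> borel_measurable borel"
    by (intro borel_measurable_continuous_onI continuous_intros)
  thus ?thesis unfolding ray_exp_def[abs_def] by measurable
qed

lemma norm_ray_exp: "norm (ray_exp c t) = indicator {0..} t * exp (Re c * t)"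
  by (simp add: ray_exp_def mult.commute indicator_def)

text \<open>The equivalence is recorded because \<open>I_conv\<close> has to be known exactly:
  \<open>mero_rep\<close> asks for its identity at every point of the convergence set.\<close>

lemma ray_exp:
  shows "integrable lborel (ray_exp c) \<longleftrightarrow> Re c < 0"
    and "Re c < 0 \<Longrightarrow> integral\<^sup>L lborel (ray_exp c) = - inverse c"
proof -
  have int: "integrable lborel (ray_exp c)" if c: "Re c < 0"
  proof -
    have "(\<integral>\<^sup>+t. ennreal (exp (Re c * t)) * indicator {0..} t \<partial>lborel) = ennreal (0 - exp (Re c * 0) / Re c)"
    proof (rule nn_integral_FTC_atLeast)
      show "((\<lambda>t. exp (Re c * t) / Re c) \<longlongrightarrow> 0) at_top"
        using c by real_asymp
    qed (use c in \<open>auto intro!: derivative_eq_intros\<close>)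
    hence "(\<integral>\<^sup>+t. ennreal (norm (ray_exp c t)) \<partial>lborel) < \<infinity>"
      by (simp add: norm_ray_exp ennreal_mult' mult.commute ennreal_indicator)
    thus ?thesis by (intro integrableI_bounded) auto
  qed
  \<comment> \<open>Otherwise the modulus is at least 1 on the half-line, which has infinite
    measure.\<close>
  have "Re c < 0" if "integrable lborel (ray_exp c)"
  proof (rule ccontr)
    assume c: "\<not> Re c < 0"
    have "(\<integral>\<^sup>+t. indicator {0::real..} t \<partial>lborel) \<le> (\<integral>\<^sup>+t. ennreal (norm (ray_exp c t)) \<partial>lborel)"
      using c by (intro nn_integral_mono) (auto simp: norm_ray_exp indicator_def)
    also have "\<dots> < \<infinity>" using that by (simp add: integrable_iff_bounded)
    finally have fin: "emeasure lborel {0::real..} < \<infinity>" by simp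
    then obtain r where r: "emeasure lborel {0::real..} = ennreal r" "0 \<le> r"
      by (cases "emeasure lborel {0::real..}") auto
    have "ennreal (r + 1) = emeasure lborel {0..r + 1}" using r(2) by simp
    also have "\<dots> \<le> ennreal r" unfolding r(1)[symmetric] by (intro emeasure_mono) auto
    finally show False using r(2) by simp
  qed
  thus "integrable lborel (ray_exp c) \<longleftrightarrow> Re c < 0" using int by blast
  assume c: "Re c < 0"
  hence c0: "c \<noteq> 0" by auto
  have "(LBINT t=ereal 0..\<infinity>. exp (t *\<^sub>R c)) = 0 - inverse c"
  proof (rule interval_integral_FTC_integrable)
    show "((\<lambda>t. inverse c * exp (t *\<^sub>R c)) has_vector_derivative exp (t *\<^sub>R c)) (at t)" for t
    proof -
      have "((\<lambda>t. t *\<^sub>R c) has_vector_derivative c) (at t)" by (auto intro!: derivative_eq_intros)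
      from has_vector_derivative_mult_right[OF field_vector_diff_chain_at[OF this DERIV_exp], of "inverse c"]
      show ?thesis using c0 by (simp add: o_def flip: mult.assoc)
    qed
    show "isCont (\<lambda>t. exp (t *\<^sub>R c)) t" for t by (intro continuous_intros)
    have "set_integrable lborel {0..} (\<lambda>t. exp (t *\<^sub>R c))"
      using int[OF c] by (simp add: set_integrable_def ray_exp_def[abs_def])
    thus "set_integrable lborel (einterval (ereal 0) \<infinity>) (\<lambda>t. exp (t *\<^sub>R c))"
      by (rule set_integrable_subset) (auto simp: einterval_def)
    have "((\<lambda>t. inverse c * exp (t *\<^sub>R c)) \<longlongrightarrow> inverse c * exp (0 *\<^sub>R c)) (at_right 0)"
      by (intro tendsto_intros)
    thus "(((\<lambda>t. inverse c * exp (t *\<^sub>R c)) \<circ> real_of_ereal) \<longlongrightarrow> inverse c) (at_right (ereal 0))"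
      by (simp add: ereal_tendsto_simps)
    have "((\<lambda>t. norm (inverse c) * exp (Re c * t)) \<longlongrightarrow> 0) at_top"
      using c by real_asymp
    hence "((\<lambda>t. inverse c * exp (t *\<^sub>R c)) \<longlongrightarrow> 0) at_top"
      by (subst tendsto_norm_zero_iff[symmetric]) (simp add: norm_mult mult.commute)
    thus "(((\<lambda>t. inverse c * exp (t *\<^sub>R c)) \<circ> real_of_ereal) \<longlongrightarrow> 0) (at_left \<infinity>)"
      by (simp add: ereal_tendsto_simps)
  qed simp
  \<comment> \<open>The interval integral runs over the open half-line, \<open>ray_exp\<close> over
    the closed one; the endpoint is a null set.\<close>
  moreover have "(LBINT t=ereal 0..\<infinity>. exp (t *\<^sub>R c)) = integral\<^sup>L lborel (ray_exp c)"
  proof -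
    have "(LBINT t=ereal 0..\<infinity>. exp (t *\<^sub>R c)) = (\<integral>t. indicator {0<..} t *\<^sub>R exp (t *\<^sub>R c) \<partial>lborel)"
      by (simp add: interval_lebesgue_integral_def set_lebesgue_integral_def einterval_def greaterThan_def)
    also have "\<dots> = integral\<^sup>L lborel (ray_exp c)"
    proof (rule integral_cong_AE)
      show "AE t in lborel. indicator {0<..} t *\<^sub>R exp (t *\<^sub>R c) = ray_exp c t"
        using AE_lborel_singleton[of 0] by eventually_elim (auto simp: ray_exp_def indicator_def)
    next
      have "(\<lambda>t::real. exp (t *\<^sub>R c)) \<in> borel_measurable borel"
        by (intro borel_measurable_continuous_onI continuous_intros)
      thus "(\<lambda>t. indicator {0<..} t *\<^sub>R exp (t *\<^sub>R c)) \<in> borel_measurable lborel" by measurable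
    qed simp
    finally show ?thesis .
  qed
  ultimately show "integral\<^sup>L lborel (ray_exp c) = - inverse c" by simp
qed

text \<open>For necessity, Tonelli turns the integral of the modulus into a product of one-variable
  integrals. None of them is 0, so a finite product forces every factor to be finite.\<close>

lemma prod_ray_exp:
  assumes "finite V"
  shows "integrable (\<Pi>\<^sub>M b\<in>V. lborel) (\<lambda>t. \<Prod>b\<in>V. ray_exp (c b) (t b)) \<longleftrightarrow> (\<forall>b\<in>V. Re (c b) < 0)"
    and "(\<forall>b\<in>V. Re (c b) < 0) \<Longrightarrow>
      integral\<^sup>L (\<Pi>\<^sub>M b\<in>V. lborel) (\<lambda>t. \<Prod>b\<in>V. ray_exp (c b) (t b)) = (\<Prod>b\<in>V. - inverse (c b))"
proof -
  show "integrable (\<Pi>\<^sub>M b\<in>V. lborel) (\<lambda>t. \<Prod>b\<in>V. ray_exp (c b) (t b)) \<longleftrightarrow> (\<forall>b\<in>V. Re (c b) < 0)"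
  proof
    assume "\<forall>b\<in>V. Re (c b) < 0"
    thus "integrable (\<Pi>\<^sub>M b\<in>V. lborel) (\<lambda>t. \<Prod>b\<in>V. ray_exp (c b) (t b))"
      by (intro lborel_product.product_integrable_prod assms) (simp add: ray_exp)
  next
    assume *: "integrable (\<Pi>\<^sub>M b\<in>V. lborel) (\<lambda>t. \<Prod>b\<in>V. ray_exp (c b) (t b))"
    show "\<forall>b\<in>V. Re (c b) < 0"
    proof
      fix b assume b: "b \<in> V"
      define I where "I = (\<lambda>b. \<integral>\<^sup>+t. ennreal (norm (ray_exp (c b) t)) \<partial>lborel)"
      have "(\<Prod>b\<in>V. I b) = (\<integral>\<^sup>+t. (\<Prod>b\<in>V. ennreal (norm (ray_exp (c b) (t b)))) \<partial>(\<Pi>\<^sub>M b\<in>V. lborel))"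
        unfolding I_def using assms by (subst lborel_product.product_nn_integral_prod) auto
      also have "\<dots> = (\<integral>\<^sup>+t. ennreal (norm (\<Prod>b\<in>V. ray_exp (c b) (t b))) \<partial>(\<Pi>\<^sub>M b\<in>V. lborel))"
        by (simp add: prod_ennreal flip: prod_norm)
      also have "\<dots> < \<infinity>" using * by (simp add: integrable_iff_bounded)
      finally have fin: "(\<Prod>b\<in>V. I b) < \<infinity>" .
      have nz: "I a \<noteq> 0" for a
      proof
        assume "I a = 0"
        hence "AE t in lborel. ennreal (norm (ray_exp (c a) t)) = 0"
          unfolding I_def by (subst (asm) nn_integral_0_iff_AE) auto
        hence "AE t in lborel. t \<notin> {0..(1::real)}"
          by eventually_elim (auto simp: norm_ray_exp indicator_def)
        hence "emeasure lborel {t. \<not> t \<notin> {0..(1::real)}} = 0"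
          by (subst (asm) AE_iff_measurable[OF _ refl]) auto
        moreover have "{t. \<not> t \<notin> {0..(1::real)}} = {0..1}" by auto
        ultimately show False by simp
      qed
      have "I b < \<infinity>"
      proof (rule ccontr)
        assume "\<not> ?thesis"
        hence "I b = \<infinity>" by (simp add: not_less top_unique)
        hence "(\<Prod>b\<in>V. I b) = \<infinity>" using nz assms b by (auto simp: ennreal_prod_eq_top)
        thus False using fin by simp
      qed
      hence "integrable lborel (ray_exp (c b))" unfolding I_def by (intro integrableI_bounded) auto
      thus "Re (c b) < 0" by (simp add: ray_exp)
    qed
  qed
  assume c: "\<forall>b\<in>V. Re (c b) < 0"
  thus "integral\<^sup>L (\<Pi>\<^sub>M b\<in>V. lborel) (\<lambda>t. \<Prod>b\<in>V. ray_exp (c b) (t b)) = (\<Prod>b\<in>V. - inverse (c b))"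
    using assms by (subst lborel_product.product_integral_prod) (auto simp: ray_exp)
qed


section \<open>Membership, lines and faces of simplicial cones\<close>

lemma convex_cone_hull_finite:
  assumes "finite V"
  shows "convex_cone hull V = {\<Sum>b\<in>V. t b *\<^sub>R b | t. \<forall>b\<in>V. t b \<ge> 0}" (is "_ = ?R")
proof
  show "convex_cone hull V \<subseteq> ?R"
  proof (rule hull_minimal)
    show "V \<subseteq> ?R"
    proof
      fix b assume b: "b \<in> V"
      have "(\<Sum>c\<in>V. (if c = b then 1 else 0) *\<^sub>R c) = (\<Sum>c\<in>V. if c = b then c else 0)"
        by (intro sum.cong) auto
      hence "b = (\<Sum>c\<in>V. (if c = b then 1 else 0) *\<^sub>R c)" using b assms by (simp add: sum.delta)
      thus "b \<in> ?R" by (intro CollectI exI[of _ "\<lambda>c. if c = b then 1 else 0"]) auto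
    qed
    show "convex_cone ?R"
    proof (subst convex_cone_iff, intro conjI ballI allI impI)
      fix x y assume "x \<in> ?R" "y \<in> ?R"
      then obtain s t where "x = (\<Sum>b\<in>V. s b *\<^sub>R b)" "y = (\<Sum>b\<in>V. t b *\<^sub>R b)"
        "\<forall>b\<in>V. s b \<ge> (0::real)" "\<forall>b\<in>V. t b \<ge> (0::real)" by auto
      thus "x + y \<in> ?R"
        by (intro CollectI exI[of _ "\<lambda>b. s b + t b"]) (auto simp: scaleR_add_left sum.distrib)
    next
      fix x and r :: real assume "x \<in> ?R" "0 \<le> r"
      then obtain t where "x = (\<Sum>b\<in>V. t b *\<^sub>R b)" "\<forall>b\<in>V. t b \<ge> (0::real)" by auto
      thus "r *\<^sub>R x \<in> ?R" using \<open>0 \<le> r\<close>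
        by (intro CollectI exI[of _ "\<lambda>b. r * t b"]) (auto simp: scaleR_sum_right)
    next
      show "0 \<in> ?R" by (intro CollectI exI[of _ "\<lambda>_. 0"]) simp
    qed
  qed
  show "?R \<subseteq> convex_cone hull V"
  proof safe
    fix t assume t: "\<forall>b\<in>V. t b \<ge> (0::real)"
    have "(\<Sum>b\<in>S. t b *\<^sub>R b) \<in> convex_cone hull V" if "S \<subseteq> V" for S
      using finite_subset[OF that assms] that
      by (induction S rule: finite_induct)
        (use t in \<open>auto simp: convex_cone_hull_contains_0 intro!: convex_cone_hull_add convex_cone_hull_mul intro: hull_inc\<close>)
    thus "(\<Sum>b\<in>V. t b *\<^sub>R b) \<in> convex_cone hull V" by simp
  qed
qed

lemma sum_mem_convex_cone_hull_iff:
  assumes "finite V" "independent V"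
  shows "(\<Sum>b\<in>V. t b *\<^sub>R b) \<in> convex_cone hull V \<longleftrightarrow> (\<forall>b\<in>V. t b \<ge> 0)"
proof
  assume "(\<Sum>b\<in>V. t b *\<^sub>R b) \<in> convex_cone hull V"
  then obtain u where u: "(\<Sum>b\<in>V. t b *\<^sub>R b) = (\<Sum>b\<in>V. u b *\<^sub>R b)" "\<forall>b\<in>V. u b \<ge> 0"
    by (auto simp: convex_cone_hull_finite[OF assms(1)])
  thus "\<forall>b\<in>V. t b \<ge> 0" using sum_scaleR_eqD[OF assms u(1)] by simp
next
  assume "\<forall>b\<in>V. t b \<ge> 0"
  thus "(\<Sum>b\<in>V. t b *\<^sub>R b) \<in> convex_cone hull V" by (auto simp: convex_cone_hull_finite[OF assms(1)])
qed

lemma lin_convex_cone_hull: "lin (convex_cone hull V) = span V"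
proof
  have sub: "convex_cone hull V \<subseteq> span V"
    by (intro hull_minimal span_superset convex_cone_span)
  show "lin (convex_cone hull V) \<subseteq> span V" unfolding lin_def
    by (rule span_minimal) (use sub in \<open>auto intro: span_diff\<close>)
  show "span V \<subseteq> lin (convex_cone hull V)" unfolding lin_def
  proof (rule span_mono, rule subsetI)
    fix b assume "b \<in> V"
    hence "b \<in> convex_cone hull V" by (rule hull_inc)
    thus "b \<in> {y - x |x y. x \<in> convex_cone hull V \<and> y \<in> convex_cone hull V}"
      using convex_cone_hull_contains_0[of V] by force
  qed
qed

lemma cdim_convex_cone_hull: "independent V \<Longrightarrow> cdim (convex_cone hull V) = card V"
  unfolding cdim_def lin_convex_cone_hull by (rule dim_span_eq_card_independent)

text \<open>Along a line every coordinate is an affine function of \<open>t\<close>; if it stays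
  non-negative for all \<open>t\<close>, its slope is 0.\<close>

lemma not_contains_line_cone:
  assumes "finite V" "independent V"
  shows "\<not> contains_line (convex_cone hull V)"
proof
  assume "contains_line (convex_cone hull V)"
  then obtain x v where v: "v \<noteq> 0" "\<And>t::real. x + t *\<^sub>R v \<in> convex_cone hull V"
    by (auto simp: contains_line_def)
  have sp: "convex_cone hull V \<subseteq> span V" by (intro hull_minimal span_superset convex_cone_span)
  have x: "x \<in> span V" using v(2)[of 0] sp by auto
  have "x + 1 *\<^sub>R v \<in> span V" using v(2)[of 1] sp by blast
  hence "(x + 1 *\<^sub>R v) - x \<in> span V" using x by (rule span_diff)
  hence vs: "v \<in> span V" by simp
  have pos: "coord V b x + t * coord V b v \<ge> 0" if "b \<in> V" for b t
  proof -
    have "x + t *\<^sub>R v \<in> span V" using x vs by (simp add: span_add span_scale)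
    from sum_coord[OF assms this] v(2)[of t]
    have "(\<Sum>b\<in>V. coord V b (x + t *\<^sub>R v) *\<^sub>R b) \<in> convex_cone hull V" by simp
    thus ?thesis using that sum_mem_convex_cone_hull_iff[OF assms] by (simp add: coord_add coord_scaleR assms)
  qed
  have "coord V b v = 0" if "b \<in> V" for b
  proof (rule ccontr)
    assume nz: "coord V b v \<noteq> 0"
    \<comment> \<open>This parameter makes the coordinate equal to -1.\<close>
    have "coord V b x + (- (coord V b x + 1) / coord V b v) * coord V b v \<ge> 0" by (rule pos[OF that])
    thus False using nz by simp
  qed
  hence "v = 0" using sum_coord[OF assms vs] by simp
  thus False using v by simp
qed

text \<open>The face property is used on segments through a point \<open>x\<close> of the face.
  Segments from 0 show that the face is itself a cone. Writing \<open>x\<close> as the midpoint of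
  twice one of its terms and twice the rest puts every generator that occurs in \<open>x\<close>
  into the face.\<close>

lemma faces_convex_cone_hull:
  assumes "finite V" "F \<in> faces (convex_cone hull V)"
  shows "F = convex_cone hull (V \<inter> F)"
proof -
  let ?C = "convex_cone hull V"
  have F: "F face_of ?C" "F \<noteq> {}" using assms(2) by (auto simp: faces_def)
  hence FC: "F \<subseteq> ?C" "convex F" by (auto simp: face_of_def)
  have seg: "a \<in> F \<and> b \<in> F" if "a \<in> ?C" "b \<in> ?C" "x \<in> F" "x \<in> open_segment a b" for a b x
    using F(1) that unfolding face_of_def by blast
  have zero: "0 \<in> F"
  proof -
    obtain x where x: "x \<in> F" using F by auto
    show ?thesis
    proof (cases "x = 0")
      case False
      have "x \<in> open_segment 0 (2 *\<^sub>R x)" unfolding in_segment using False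
        by (auto intro!: exI[of _ "1/2"])
      thus ?thesis using seg[of 0 "2 *\<^sub>R x" x] x FC(1) convex_cone_hull_contains_0 convex_cone_hull_mul[of x V 2] by auto
    qed (use x in simp)
  qed
  have scale: "r *\<^sub>R x \<in> F" if "x \<in> F" "0 \<le> r" for x r
  proof (cases "r \<le> 1")
    case True
    have "(1 - r) *\<^sub>R 0 + r *\<^sub>R x \<in> F" using FC(2) zero that True by (intro convexD) auto
    thus ?thesis by simp
  next
    case False
    show ?thesis
    proof (cases "x = 0")
      case False
      have "x \<in> open_segment 0 (r *\<^sub>R x)" unfolding in_segment using False \<open>\<not> r \<le> 1\<close>
        by (auto intro!: exI[of _ "inverse r"] simp: field_simps)
      thus ?thesis using seg[of 0 "r *\<^sub>R x" x] that FC(1) convex_cone_hull_contains_0 convex_cone_hull_mul[of x V r] by auto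
    qed (use zero in simp)
  qed
  have add: "x + y \<in> F" if "x \<in> F" "y \<in> F" for x y
  proof -
    have "(1/2) *\<^sub>R x + (1/2) *\<^sub>R y \<in> F" using FC(2) that by (intro convexD) auto
    from scale[OF this, of 2] show ?thesis by (simp add: scaleR_add_right)
  qed
  have cone: "convex_cone F" using scale add zero by (auto simp: convex_cone_iff)
  show ?thesis
  proof
    show "convex_cone hull (V \<inter> F) \<subseteq> F" using cone by (intro hull_minimal) auto
    show "F \<subseteq> convex_cone hull (V \<inter> F)"
    proof
      fix x assume x: "x \<in> F"
      then obtain t where t: "x = (\<Sum>b\<in>V. t b *\<^sub>R b)" "\<forall>b\<in>V. t b \<ge> 0"
        using FC(1) by (auto simp: convex_cone_hull_finite[OF assms(1)])
      have bF: "b \<in> F" if b: "b \<in> V" "t b \<noteq> 0" for b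
      proof -
        define y where "y = (\<Sum>c\<in>V - {b}. t c *\<^sub>R c)"
        have xy: "x = t b *\<^sub>R b + y" unfolding t(1) y_def using b assms(1) by (simp add: sum.remove)
        have "(\<Sum>c\<in>V. (if c = b then 0 else t c) *\<^sub>R c) \<in> ?C"
          using t(2) by (auto simp: convex_cone_hull_finite[OF assms(1)] intro!: exI[of _ "\<lambda>c. if c = b then 0 else t c"])
        also have "(\<Sum>c\<in>V. (if c = b then 0 else t c) *\<^sub>R c) = y"
          unfolding y_def using b assms(1) by (subst sum.remove[of V b]) (auto intro!: sum.cong)
        finally have yC: "y \<in> ?C" .
        have bC: "t b *\<^sub>R b \<in> ?C" using b t(2) by (intro convex_cone_hull_mul hull_inc) auto
        have "t b *\<^sub>R b \<in> F"
        proof (cases "t b *\<^sub>R b = y")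
          \<comment> \<open>If the two halves coincide, the open segment between them is empty and
            the face property gives nothing; but then each half is
            \<open>(1/2) *\<^sub>R x\<close>.\<close>
          case True
          hence "t b *\<^sub>R b = (1/2) *\<^sub>R x" unfolding xy by (simp flip: scaleR_add_left add: scaleR_2[symmetric])
          thus ?thesis using scale[OF x, of "1/2"] by simp
        next
          case False
          hence "2 *\<^sub>R (t b *\<^sub>R b) \<noteq> 2 *\<^sub>R y" by (simp only: scaleR_cancel_left) simp
          moreover have "x = (1 - 1/2) *\<^sub>R (2 *\<^sub>R (t b *\<^sub>R b)) + (1/2) *\<^sub>R (2 *\<^sub>R y)"
            unfolding xy by simp
          ultimately have "x \<in> open_segment (2 *\<^sub>R (t b *\<^sub>R b)) (2 *\<^sub>R y)"
            unfolding in_segment by (intro conjI exI[of _ "1/2"]) auto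
          hence "2 *\<^sub>R (t b *\<^sub>R b) \<in> F"
            using seg[OF _ _ x] convex_cone_hull_mul[OF bC, of 2] convex_cone_hull_mul[OF yC, of 2] by auto
          from scale[OF this, of "1/2"] show ?thesis by simp
        qed
        from scale[OF this, of "inverse (t b)"] show ?thesis using b t(2) by auto
      qed
      have "x = (\<Sum>b\<in>V \<inter> F. t b *\<^sub>R b)"
        unfolding t(1) using bF assms(1) by (intro sum.mono_neutral_right) auto
      thus "x \<in> convex_cone hull (V \<inter> F)"
        using t(2) assms(1) by (auto simp: convex_cone_hull_finite)
    qed
  qed
qed

lemma finite_faces_cone:
  assumes "finite V"
  shows "finite (faces (convex_cone hull V))"
proof (rule finite_subset)
  show "faces (convex_cone hull V) \<subseteq> (\<lambda>W. convex_cone hull W) ` Pow V"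
    using faces_convex_cone_hull[OF assms] by blast
qed (use assms in simp)

text \<open>If a convex combination with positive weights of two points with non-negative
  coordinates vanishes, then all these coordinates vanish.\<close>

lemma zero_face_cone:
  assumes "finite V" "independent V"
  shows "{0} \<in> faces (convex_cone hull V)"
proof -
  have "a = 0 \<and> b = 0" if ab: "a \<in> convex_cone hull V" "b \<in> convex_cone hull V" "0 \<in> open_segment a b" for a b
  proof -
    obtain u where u: "0 < u" "u < 1" "(1 - u) *\<^sub>R a + u *\<^sub>R b = 0"
      using ab(3) by (auto simp: in_segment)
    obtain s where s: "a = (\<Sum>b\<in>V. s b *\<^sub>R b)" "\<forall>b\<in>V. s b \<ge> 0"
      using ab(1) by (auto simp: convex_cone_hull_finite[OF assms(1)])
    obtain t where t: "b = (\<Sum>b\<in>V. t b *\<^sub>R b)" "\<forall>b\<in>V. t b \<ge> 0"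
      using ab(2) by (auto simp: convex_cone_hull_finite[OF assms(1)])
    have "(\<Sum>b\<in>V. ((1 - u) * s b + u * t b) *\<^sub>R b) = (\<Sum>b\<in>V. 0 *\<^sub>R b)"
      using u(3) unfolding s(1) t(1) by (simp add: scaleR_sum_right scaleR_add_left sum.distrib)
    hence "(1 - u) * s b + u * t b = 0" if "b \<in> V" for b
      using sum_scaleR_eqD[OF assms, of "\<lambda>b. (1 - u) * s b + u * t b" "\<lambda>_. 0"] that by blast
    hence "s b = 0 \<and> t b = 0" if "b \<in> V" for b
      using u s(2) t(2) that add_nonneg_eq_0_iff[of "(1 - u) * s b" "u * t b"] by force
    thus ?thesis unfolding s(1) t(1) by simp
  qed
  thus ?thesis unfolding faces_def face_of_def
    using convex_cone_hull_contains_0[of V] by auto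
qed

section \<open>Exponential sums and integrals over unimodular cones\<close>

text \<open>\<open>aff_measure\<close> parametrises by an arbitrarily chosen \<int>-basis of the
  lattice of the face, which may differ from \<open>V\<close>. Equality of the spans is the input to
  the change of basis.\<close>

lemma zbasis_lin_cone:
  assumes "is_zbasis B (lat X)" "V \<subseteq> B"
  defines "Z \<equiv> zbasis (lin (convex_cone hull V) \<inter> lat X)"
  shows "finite Z" "independent Z" "span Z = span V"
proof -
  have B: "finite B" "independent B" "lat X = int_span B" using assms(1) by (auto simp: is_zbasis_def)
  note V = zbasis_subset[OF assms(1,2)]
  have "lin (convex_cone hull V) \<inter> lat X = int_span V"
    unfolding lin_convex_cone_hull B(3) by (rule span_Int_int_span[OF B(1,2) assms(2)])
  hence Z: "Z = zbasis (int_span V)" by (simp add: Z_def)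
  have "is_lattice (int_span V) (span V)" using V by (auto simp: is_lattice_def is_zbasis_def)
  hence "is_zbasis Z (int_span V)" unfolding Z by (rule is_zbasis_zbasis)
  thus f: "finite Z" "independent Z" and "span Z = span V"
    using span_int_span[OF V] span_int_span[of Z] by (auto simp: is_zbasis_def)
qed

lemma cone_exp_indicator:
  assumes V: "finite V" "independent V" "V \<subseteq> vs X" and X: "subspace (vs X)" and \<xi>: "\<xi> \<in> dual X"
    and x: "x \<in> span V"
  shows "indicator (convex_cone hull V) x *\<^sub>R exp (\<xi> x) = (\<Prod>b\<in>V. ray_exp (\<xi> b) (coord V b x))"
proof -
  have eq: "x = (\<Sum>b\<in>V. coord V b x *\<^sub>R b)" using sum_coord[OF V(1,2) x] by simp
  have mem: "x \<in> convex_cone hull V \<longleftrightarrow> (\<forall>b\<in>V. coord V b x \<ge> 0)"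
    using sum_mem_convex_cone_hull_iff[OF V(1,2), of "\<lambda>b. coord V b x"] eq by simp
  have "\<xi> x = (\<Sum>b\<in>V. coord V b x *\<^sub>R \<xi> b)"
    using dual_sum[OF \<xi> X V(1,3), of "\<lambda>b. coord V b x"] eq by simp
  hence ex: "exp (\<xi> x) = (\<Prod>b\<in>V. exp (coord V b x *\<^sub>R \<xi> b))" using V(1) by (simp add: exp_sum)
  show ?thesis
  proof (cases "\<forall>b\<in>V. coord V b x \<ge> 0")
    case True
    thus ?thesis using mem ex by (auto simp: ray_exp_def intro!: prod.cong)
  next
    case False
    then obtain b where "b \<in> V" "coord V b x < 0" by fastforce
    hence "(\<Prod>b\<in>V. ray_exp (\<xi> b) (coord V b x)) = 0"
      using V(1) by (intro prod_zero bexI[of _ b]) (auto simp: ray_exp_def)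
    thus ?thesis using False mem by simp
  qed
qed

text \<open>The constant \<open>k\<close> compares the chosen lattice basis with \<open>V\<close>
  and is fixed before \<xi>. The same \<open>k\<close> thus serves \<xi> and its quotients by
  \<open>N\<close>, which yields homogeneity.\<close>

lemma cone_integral:
  fixes X :: "'a::real_vector ratspace"
  assumes X: "rational_space X" and B: "is_zbasis B (lat X)" "V \<subseteq> B"
  defines "F \<equiv> convex_cone hull V"
  obtains k :: real where "k > 0"
    "\<And>\<xi>. \<xi> \<in> dual X \<Longrightarrow> set_integrable (aff_measure X F) F (\<lambda>x. exp (\<xi> x)) \<longleftrightarrow> (\<forall>b\<in>V. Re (\<xi> b) < 0)"
    "\<And>\<xi>. \<xi> \<in> dual X \<Longrightarrow> \<forall>b\<in>V. Re (\<xi> b) < 0 \<Longrightarrow>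
      poly_integral X F (\<lambda>x. exp (\<xi> x)) = of_real k * (\<Prod>b\<in>V. - inverse (\<xi> b))"
proof -
  note V = zbasis_subset[OF B]
  have sub: "subspace (vs X)" using rational_spaceD[OF X] by simp
  have VX: "V \<subseteq> vs X" using vs_eq_span[OF X B(1)] B(2) span_superset by blast
  define Z where "Z = zbasis (lin F \<inter> lat X)"
  note Z = zbasis_lin_cone[OF B, folded F_def, folded Z_def]
  define s where "s = (SOME s. s \<in> F)"
  have "s \<in> F" unfolding s_def F_def by (rule someI) (rule convex_cone_hull_contains_0)
  moreover have "F \<subseteq> span V" unfolding F_def by (intro hull_minimal span_superset convex_cone_span)
  ultimately have s: "s \<in> span V" by auto
  define e where "e = (\<lambda>t. s + (\<Sum>b\<in>Z. t b *\<^sub>R b))"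
  define PZ where "PZ = (\<Pi>\<^sub>M b\<in>Z. (lborel :: real measure))"
  define PV where "PV = (\<Pi>\<^sub>M b\<in>V. (lborel :: real measure))"
  have am: "aff_measure X F = embed_measure PZ e"
    unfolding aff_measure_def Let_def Z_def[symmetric] s_def[symmetric] e_def PZ_def ..
  \<comment> \<open>Injectivity is claimed on \<open>space PZ\<close>, whose members are
    extensional; off \<open>Z\<close> the map \<open>e\<close> ignores its argument.\<close>
  have inj: "inj_on e (space PZ)"
  proof (rule inj_onI)
    fix t u assume tu: "t \<in> space PZ" "u \<in> space PZ" "e t = e u"
    show "t = u"
    proof (rule extensionalityI)
      show "t \<in> extensional Z" "u \<in> extensional Z" using tu(1,2) by (simp_all add: PZ_def space_PiM PiE_iff)
      show "t b = u b" if "b \<in> Z" for b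
        using sum_scaleR_eqD[OF Z(1,2), of t u b] tu(3) that by (simp add: e_def)
    qed
  qed
  have e_span: "e t \<in> span V" for t
    unfolding e_def using s Z(3) by (intro span_add span_sum span_scale) (auto intro: span_base)
  obtain k :: real where k: "k > 0"
    "\<And>s. (\<lambda>u. \<lambda>b\<in>Z. coord Z b (param V u - s)) \<in> measurable PV PZ"
    "\<And>s. PZ = density (distr PV PZ (\<lambda>u. \<lambda>b\<in>Z. coord Z b (param V u - s))) (\<lambda>_. ennreal k)"
    using PiM_lborel_change_basis[OF Z(1,2) V Z(3)] unfolding PZ_def PV_def by blast
  define T where "T = (\<lambda>u. \<lambda>b\<in>Z. coord Z b (param V u - s))"
  have T: "T \<in> measurable PV PZ" "PZ = density (distr PV PZ T) (\<lambda>_. ennreal k)"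
    unfolding T_def using k(2,3)[of s] by auto
  \<comment> \<open>\<open>T\<close> absorbs both the base point \<open>s\<close> and the choice of
    \<open>Z\<close>: after it, the hull is parametrised linearly by \<open>V\<close>.\<close>
  have eT: "e (T u) = param V u" for u
  proof -
    have "param V u - s \<in> span Z"
      unfolding Z(3) param_def using s by (intro span_diff span_sum span_scale) (auto intro: span_base)
    from sum_coord[OF Z(1,2) this] show ?thesis by (simp add: e_def T_def)
  qed
  have PZ1: "integrable PZ H \<longleftrightarrow> integrable PV (\<lambda>u. H (T u))"
    and PZ2: "integral\<^sup>L PZ H = k *\<^sub>R integral\<^sup>L PV (\<lambda>u. H (T u))"
    if H: "H \<in> borel_measurable PZ" for H :: "_ \<Rightarrow> complex"
  proof -
    have "integrable PZ H \<longleftrightarrow> integrable (density (distr PV PZ T) (\<lambda>_. ennreal k)) H"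
      using T(2) by metis
    also have "\<dots> \<longleftrightarrow> integrable (distr PV PZ T) (\<lambda>x. k *\<^sub>R H x)"
      using H k(1) by (intro integrable_density) auto
    also have "\<dots> \<longleftrightarrow> integrable (distr PV PZ T) H"
    proof
      assume "integrable (distr PV PZ T) (\<lambda>x. k *\<^sub>R H x)"
      hence "integrable (distr PV PZ T) (\<lambda>x. inverse k *\<^sub>R (k *\<^sub>R H x))"
        by (rule integrable_scaleR_right)
      thus "integrable (distr PV PZ T) H" using k(1) by simp
    qed (rule integrable_scaleR_right)
    also have "\<dots> \<longleftrightarrow> integrable PV (\<lambda>u. H (T u))"
      using H by (intro integrable_distr_eq T)
    finally show "integrable PZ H \<longleftrightarrow> integrable PV (\<lambda>u. H (T u))" .
    have "integral\<^sup>L PZ H = integral\<^sup>L (density (distr PV PZ T) (\<lambda>_. ennreal k)) H"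
      using T(2) by metis
    also have "\<dots> = integral\<^sup>L (distr PV PZ T) (\<lambda>x. k *\<^sub>R H x)"
      using H k(1) by (intro integral_density) auto
    also have "\<dots> = k *\<^sub>R integral\<^sup>L (distr PV PZ T) H" by simp
    also have "integral\<^sup>L (distr PV PZ T) H = integral\<^sup>L PV (\<lambda>u. H (T u))"
      using H by (intro integral_distr T)
    finally show "integral\<^sup>L PZ H = k *\<^sub>R integral\<^sup>L PV (\<lambda>u. H (T u))" .
  qed
  have main: "set_integrable (aff_measure X F) F (\<lambda>x. exp (\<xi> x)) \<longleftrightarrow>
        integrable PV (\<lambda>u. \<Prod>b\<in>V. ray_exp (\<xi> b) (u b))"
    "poly_integral X F (\<lambda>x. exp (\<xi> x)) = k *\<^sub>R integral\<^sup>L PV (\<lambda>u. \<Prod>b\<in>V. ray_exp (\<xi> b) (u b))"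
    if \<xi>: "\<xi> \<in> dual X" for \<xi>
  proof -
    define g where "g = (\<lambda>x. indicator F x *\<^sub>R exp (\<xi> x))"
    have g: "g x = (\<Prod>b\<in>V. ray_exp (\<xi> b) (coord V b x))" if "x \<in> span V" for x
      unfolding g_def F_def by (rule cone_exp_indicator[OF V VX sub \<xi> that])
    have coord_e: "coord V b (e t) = coord V b s + (\<Sum>z\<in>Z. t z * coord V b z)" for b t
      by (simp add: e_def coord_add V(2) linear_sum[OF linear_coord[OF V(2)]] coord_scaleR[OF V(2)])
    have [measurable]: "(\<lambda>t. t z) \<in> borel_measurable PZ" if "z \<in> Z" for z
      using measurable_component_singleton[OF that, of "\<lambda>_. lborel"] by (simp add: PZ_def)
    have mcoord: "(\<lambda>t. coord V b (e t)) \<in> borel_measurable PZ" for b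
      unfolding coord_e by (intro borel_measurable_add borel_measurable_const borel_measurable_sum borel_measurable_times) auto
    have mge: "(\<lambda>t. g (e t)) \<in> borel_measurable PZ"
      unfolding g[OF e_span] by (intro borel_measurable_prod measurable_compose[OF mcoord measurable_ray_exp])
    have mg: "g \<in> borel_measurable (embed_measure PZ e)"
      by (rule measurable_embed_measure1[where g = g and f = e, OF mge])
    have me: "e \<in> measurable PZ (embed_measure PZ e)" by (rule measurable_embed_measure2'[OF inj])
    have gT: "g (e (T u)) = (\<Prod>b\<in>V. ray_exp (\<xi> b) (u b))" for u
    proof -
      have "param V u \<in> span V" unfolding param_def by (intro span_sum span_scale span_base)
      thus ?thesis unfolding eT using g[of "param V u"] by (simp add: param_def coord_sum[OF V])
    qed
    have "set_integrable (aff_measure X F) F (\<lambda>x. exp (\<xi> x)) \<longleftrightarrow> integrable (embed_measure PZ e) g"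
      by (simp add: set_integrable_def am g_def)
    also have "\<dots> \<longleftrightarrow> integrable PZ (\<lambda>t. g (e t))"
      using integrable_distr_eq[OF me mg] embed_measure_eq_distr'[OF inj] by simp
    also have "\<dots> \<longleftrightarrow> integrable PV (\<lambda>u. \<Prod>b\<in>V. ray_exp (\<xi> b) (u b))"
      by (subst PZ1[OF mge]) (simp add: gT)
    finally show "set_integrable (aff_measure X F) F (\<lambda>x. exp (\<xi> x)) \<longleftrightarrow>
        integrable PV (\<lambda>u. \<Prod>b\<in>V. ray_exp (\<xi> b) (u b))" .
    have "poly_integral X F (\<lambda>x. exp (\<xi> x)) = integral\<^sup>L (embed_measure PZ e) g"
      by (simp add: poly_integral_def set_lebesgue_integral_def am g_def)
    also have "\<dots> = integral\<^sup>L PZ (\<lambda>t. g (e t))"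
      using integral_distr[OF me mg] embed_measure_eq_distr'[OF inj] by simp
    also have "\<dots> = k *\<^sub>R integral\<^sup>L PV (\<lambda>u. \<Prod>b\<in>V. ray_exp (\<xi> b) (u b))"
      by (subst PZ2[OF mge]) (simp add: gT)
    finally show "poly_integral X F (\<lambda>x. exp (\<xi> x)) = \<dots>" .
  qed
  show ?thesis
  proof (rule that[OF k(1)])
    fix \<xi> assume \<xi>: "\<xi> \<in> dual X"
    show "set_integrable (aff_measure X F) F (\<lambda>x. exp (\<xi> x)) \<longleftrightarrow> (\<forall>b\<in>V. Re (\<xi> b) < 0)"
      unfolding main(1)[OF \<xi>] PV_def by (rule prod_ray_exp(1)[OF V(1)])
    assume "\<forall>b\<in>V. Re (\<xi> b) < 0"
    from prod_ray_exp(2)[OF V(1) this]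
    show "poly_integral X F (\<lambda>x. exp (\<xi> x)) = of_real k * (\<Prod>b\<in>V. - inverse (\<xi> b))"
      unfolding main(2)[OF \<xi>] PV_def by (simp add: scaleR_conv_of_real)
  qed
qed

text \<open>Since \<open>V\<close> is part of a \<int>-basis, lattice points of its span have
  integer coordinates, and in the cone these are non-negative. Unimodularity thus turns the lattice
  sum into a product of geometric series.\<close>

lemma cone_Int_lattice:
  assumes B: "is_zbasis B \<Lambda>" "V \<subseteq> B"
  shows "bij_betw (\<lambda>n. \<Sum>b\<in>V. of_nat (n b) *\<^sub>R b) (\<Pi>\<^sub>E b\<in>V. UNIV) (convex_cone hull V \<inter> \<Lambda>)"
proof -
  have B': "finite B" "independent B" "\<Lambda> = int_span B" using B(1) by (auto simp: is_zbasis_def)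
  note V = zbasis_subset[OF B]
  have sp: "convex_cone hull V \<subseteq> span V" by (intro hull_minimal span_superset convex_cone_span)
  have L: "convex_cone hull V \<inter> \<Lambda> = convex_cone hull V \<inter> int_span V"
    using sp span_Int_int_span[OF B'(1,2) B(2)] B'(3) by blast
  show ?thesis unfolding L bij_betw_def
  proof
    show "inj_on (\<lambda>n. \<Sum>b\<in>V. of_nat (n b) *\<^sub>R b) (\<Pi>\<^sub>E b\<in>V. UNIV)"
    proof (rule inj_onI)
      fix m n assume mn: "m \<in> (\<Pi>\<^sub>E b\<in>V. UNIV)" "n \<in> (\<Pi>\<^sub>E b\<in>V. (UNIV :: nat set))"
        "(\<Sum>b\<in>V. of_nat (m b) *\<^sub>R b) = (\<Sum>b\<in>V. of_nat (n b) *\<^sub>R b)"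
      from sum_scaleR_eqD[OF V mn(3)] show "m = n" by (intro PiE_ext[OF mn(1,2)]) auto
    qed
    show "(\<lambda>n. \<Sum>b\<in>V. of_nat (n b) *\<^sub>R b) ` (\<Pi>\<^sub>E b\<in>V. UNIV) = convex_cone hull V \<inter> int_span V"
    proof safe
      fix n :: "'a \<Rightarrow> nat"
      show "(\<Sum>b\<in>V. of_nat (n b) *\<^sub>R b) \<in> convex_cone hull V"
        by (simp add: sum_mem_convex_cone_hull_iff[OF V])
      show "(\<Sum>b\<in>V. of_nat (n b) *\<^sub>R b) \<in> int_span V"
        unfolding int_span_iff[OF V]
        by (intro conjI span_sum span_scale span_base) (simp_all add: coord_sum[OF V])
    next
      fix x assume x: "x \<in> convex_cone hull V" "x \<in> int_span V"
      then obtain k :: "'a \<Rightarrow> int" where k: "x = (\<Sum>b\<in>V. of_int (k b) *\<^sub>R b)"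
        by (auto simp: int_span_def)
      have pos: "\<forall>b\<in>V. k b \<ge> 0" using x(1) unfolding k sum_mem_convex_cone_hull_iff[OF V] by simp
      have "x = (\<Sum>b\<in>V. of_nat ((\<lambda>b\<in>V. nat (k b)) b) *\<^sub>R b)"
        unfolding k using pos by (intro sum.cong) auto
      thus "x \<in> (\<lambda>n. \<Sum>b\<in>V. of_nat (n b) *\<^sub>R b) ` (\<Pi>\<^sub>E b\<in>V. UNIV)"
        by (intro image_eqI[of _ _ "\<lambda>b\<in>V. nat (k b)"]) auto
    qed
  qed
qed

text \<open>The sum is a product of geometric series in the \<open>exp (\<xi> b)\<close>. As for the
  integrals, the convergence set is needed exactly.\<close>

lemma cone_exp_sum:
  assumes X: "rational_space X" and B: "is_zbasis B (lat X)" "V \<subseteq> B" and \<xi>: "\<xi> \<in> dual X"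
  defines "C \<equiv> convex_cone hull V"
  shows "(\<lambda>\<gamma>. norm (exp (\<xi> \<gamma>))) summable_on (C \<inter> lat X) \<longleftrightarrow> (\<forall>b\<in>V. Re (\<xi> b) < 0)"
    and "\<forall>b\<in>V. Re (\<xi> b) < 0 \<Longrightarrow> (\<Sum>\<^sub>\<infinity>\<gamma>\<in>C \<inter> lat X. exp (\<xi> \<gamma>)) = (\<Prod>b\<in>V. inverse (1 - exp (\<xi> b)))"
proof -
  note V = zbasis_subset[OF B]
  have sub: "subspace (vs X)" using rational_spaceD[OF X] by simp
  have VX: "V \<subseteq> vs X" using vs_eq_span[OF X B(1)] B(2) span_superset by blast
  note bij = cone_Int_lattice[OF B, folded C_def]
  have ex: "exp (\<xi> (\<Sum>b\<in>V. of_nat (n b) *\<^sub>R b)) = (\<Prod>b\<in>V. exp (\<xi> b) ^ n b)" for n :: "'a \<Rightarrow> nat"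
    using V(1) by (simp add: dual_sum[OF \<xi> sub V(1) VX] exp_sum scaleR_conv_of_real exp_of_nat_mult)
  have sum_iff: "(\<lambda>\<gamma>. norm (exp (\<xi> \<gamma>))) summable_on (C \<inter> lat X) \<longleftrightarrow>
      (\<lambda>n. norm (\<Prod>b\<in>V. exp (\<xi> b) ^ n b)) summable_on (\<Pi>\<^sub>E b\<in>V. UNIV)"
    by (subst summable_on_reindex_bij_betw[OF bij, symmetric]) (simp add: ex)
  have geo: "(\<lambda>n. norm (exp (\<xi> b) ^ n)) summable_on UNIV" "(\<Sum>\<^sub>\<infinity>n. exp (\<xi> b) ^ n) = inverse (1 - exp (\<xi> b))"
    if "Re (\<xi> b) < 0" for b
  proof -
    have n: "norm (exp (\<xi> b)) < 1" using that by simp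
    show s: "(\<lambda>n. norm (exp (\<xi> b) ^ n)) summable_on UNIV"
      using n by (intro norm_summable_imp_summable_on) (simp add: norm_power summable_geometric)
    show "(\<Sum>\<^sub>\<infinity>n. exp (\<xi> b) ^ n) = inverse (1 - exp (\<xi> b))"
      using has_sum_imp_sums[OF has_sum_infsum[OF abs_summable_summable[OF s]]] suminf_geometric[OF n]
      by (simp add: sums_iff inverse_eq_divide)
  qed
  show "(\<lambda>\<gamma>. norm (exp (\<xi> \<gamma>))) summable_on (C \<inter> lat X) \<longleftrightarrow> (\<forall>b\<in>V. Re (\<xi> b) < 0)"
    unfolding sum_iff
  proof
    assume "\<forall>b\<in>V. Re (\<xi> b) < 0"
    thus "(\<lambda>n. norm (\<Prod>b\<in>V. exp (\<xi> b) ^ n b)) summable_on (\<Pi>\<^sub>E b\<in>V. UNIV)"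
      using V(1) geo(1) abs_summable_on_prod_PiE[OF V(1), of "\<lambda>_. UNIV" "\<lambda>b n. exp (\<xi> b) ^ n"]
      by (simp flip: abs_summable_equivalent)
  next
    assume s: "(\<lambda>n. norm (\<Prod>b\<in>V. exp (\<xi> b) ^ n b)) summable_on (\<Pi>\<^sub>E b\<in>V. UNIV)"
    show "\<forall>b\<in>V. Re (\<xi> b) < 0"
    proof
      fix b assume b: "b \<in> V"
      \<comment> \<open>\<open>j\<close> picks out the multiples of the single generator
        \<open>b\<close>; over them the sum is the geometric series of
        \<open>exp (\<xi> b)\<close>.\<close>
      define j where "j = (\<lambda>k::nat. \<lambda>c\<in>V. if c = b then k else 0)"
      have inj: "inj j"
      proof (rule injI)
        fix k l assume "j k = j l"
        hence "j k b = j l b" by simp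
        thus "k = l" using b by (simp add: j_def)
      qed
      have "j ` UNIV \<subseteq> (\<Pi>\<^sub>E b\<in>V. UNIV)" by (auto simp: j_def)
      from summable_on_subset_banach[OF s this]
      have "((\<lambda>n. norm (\<Prod>b\<in>V. exp (\<xi> b) ^ n b)) \<circ> j) summable_on UNIV"
        by (subst (asm) summable_on_reindex[OF inj])
      also have "((\<lambda>n. norm (\<Prod>b\<in>V. exp (\<xi> b) ^ n b)) \<circ> j) = (\<lambda>k. norm (exp (\<xi> b)) ^ k)"
      proof
        fix k
        have "(\<Prod>c\<in>V. exp (\<xi> c) ^ j k c) = (\<Prod>c\<in>V. if c = b then exp (\<xi> b) ^ k else 1)"
          by (intro prod.cong) (auto simp: j_def)
        also have "\<dots> = exp (\<xi> b) ^ k" using b V(1) by (simp add: prod.delta)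
        finally show "((\<lambda>n. norm (\<Prod>b\<in>V. exp (\<xi> b) ^ n b)) \<circ> j) k = norm (exp (\<xi> b)) ^ k"
          by (simp add: norm_power)
      qed
      finally have "summable (\<lambda>k. norm (exp (\<xi> b)) ^ k)" by (rule summable_on_imp_summable)
      thus "Re (\<xi> b) < 0" by (simp add: summable_geometric_iff)
    qed
  qed
  assume neg: "\<forall>b\<in>V. Re (\<xi> b) < 0"
  have "(\<Sum>\<^sub>\<infinity>\<gamma>\<in>C \<inter> lat X. exp (\<xi> \<gamma>)) = (\<Sum>\<^sub>\<infinity>n\<in>(\<Pi>\<^sub>E b\<in>V. UNIV). \<Prod>b\<in>V. exp (\<xi> b) ^ n b)"
    by (subst infsum_reindex_bij_betw[OF bij, symmetric]) (simp add: ex)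
  also have "\<dots> = (\<Prod>b\<in>V. \<Sum>\<^sub>\<infinity>n. exp (\<xi> b) ^ n)"
    using geo(1) neg by (intro infsum_prod_PiE_abs V) auto
  also have "\<dots> = (\<Prod>b\<in>V. inverse (1 - exp (\<xi> b)))" using geo(2) neg by simp
  finally show "(\<Sum>\<^sub>\<infinity>\<gamma>\<in>C \<inter> lat X. exp (\<xi> \<gamma>)) = (\<Prod>b\<in>V. inverse (1 - exp (\<xi> b)))" .
qed

section \<open>Entire and meromorphic functions on the dual\<close>

lemma entire_on_dual_cong:
  "entire_on_dual X f \<Longrightarrow> (\<And>\<xi>. \<xi> \<in> dual X \<Longrightarrow> f \<xi> = g \<xi>) \<Longrightarrow> entire_on_dual X g"
  unfolding entire_on_dual_def by auto

lemma entire_on_dual_add: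
  assumes "entire_on_dual X f" "entire_on_dual X g"
  shows "entire_on_dual X (\<lambda>\<xi>. f \<xi> + g \<xi>)"
proof -
  obtain c d where "\<And>\<xi>. \<xi> \<in> dual X \<Longrightarrow> ((\<lambda>\<alpha>. c \<alpha> * dmonom X \<alpha> \<xi>) has_sum f \<xi>) (multi_idx X)"
    "\<And>\<xi>. \<xi> \<in> dual X \<Longrightarrow> ((\<lambda>\<alpha>. d \<alpha> * dmonom X \<alpha> \<xi>) has_sum g \<xi>) (multi_idx X)"
    using assms unfolding entire_on_dual_def by blast
  thus ?thesis unfolding entire_on_dual_def
    by (intro exI[of _ "\<lambda>\<alpha>. c \<alpha> + d \<alpha>"]) (auto simp: distrib_right intro!: has_sum_add)
qed

lemma entire_on_dual_scale:
  assumes "entire_on_dual X f"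
  shows "entire_on_dual X (\<lambda>\<xi>. r * f \<xi>)"
proof -
  obtain c where "\<And>\<xi>. \<xi> \<in> dual X \<Longrightarrow> ((\<lambda>\<alpha>. c \<alpha> * dmonom X \<alpha> \<xi>) has_sum f \<xi>) (multi_idx X)"
    using assms unfolding entire_on_dual_def by blast
  thus ?thesis unfolding entire_on_dual_def
    by (intro exI[of _ "\<lambda>\<alpha>. r * c \<alpha>"]) (auto simp: mult.assoc intro!: has_sum_cmult_right)
qed

lemma entire_on_dual_0: "entire_on_dual X (\<lambda>_. 0)"
  unfolding entire_on_dual_def by (intro exI[of _ "\<lambda>_. 0"]) auto

lemma entire_on_dual_sum:
  "finite S \<Longrightarrow> (\<And>i. i \<in> S \<Longrightarrow> entire_on_dual X (f i)) \<Longrightarrow> entire_on_dual X (\<lambda>\<xi>. \<Sum>i\<in>S. f i \<xi>)"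
  by (induction S rule: finite_induct) (auto intro: entire_on_dual_0 entire_on_dual_add)

text \<open>Multiplication by a coordinate raises one exponent: the coefficients of \<open>f\<close>
  move along \<open>up\<close>, and multi-indices outside its range get 0.\<close>

lemma entire_on_dual_mult_coordinate:
  assumes X: "rational_space X" and z: "z \<in> zbasis (lat X)" and f: "entire_on_dual X f"
  shows "entire_on_dual X (\<lambda>\<xi>. \<xi> z * f \<xi>)"
proof -
  let ?Z = "zbasis (lat X)"
  note Z = zbasis_rational_space[OF X]
  obtain c where c: "\<And>\<xi>. \<xi> \<in> dual X \<Longrightarrow> ((\<lambda>\<alpha>. c \<alpha> * dmonom X \<alpha> \<xi>) has_sum f \<xi>) (multi_idx X)"
    using f unfolding entire_on_dual_def by blast
  define up :: "('a \<Rightarrow> nat) \<Rightarrow> ('a \<Rightarrow> nat)" where "up = (\<lambda>\<alpha>. \<alpha>(z := \<alpha> z + 1))"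
  define c' where "c' = (\<lambda>\<alpha>. if \<alpha> z = 0 then 0 else c (\<alpha>(z := \<alpha> z - 1)))"
  have up_in: "up ` multi_idx X \<subseteq> multi_idx X"
    using z by (auto simp: multi_idx_def up_def)
  have inj: "inj_on up (multi_idx X)"
  proof (rule inj_onI)
    fix \<alpha> \<beta> assume "up \<alpha> = up \<beta>"
    hence "(up \<alpha>)(z := up \<alpha> z - 1) = (up \<beta>)(z := up \<beta> z - 1)" by simp
    thus "\<alpha> = \<beta>" by (simp add: up_def)
  qed
  have mon: "dmonom X (up \<alpha>) \<xi> = \<xi> z * dmonom X \<alpha> \<xi>" for \<alpha> \<xi>
  proof -
    have "(\<Prod>b\<in>?Z - {z}. \<xi> b ^ up \<alpha> b) = (\<Prod>b\<in>?Z - {z}. \<xi> b ^ \<alpha> b)"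
      by (intro prod.cong) (auto simp: up_def)
    thus ?thesis unfolding dmonom_def using z Z(2)
      by (simp add: prod.remove[of ?Z z] up_def mult_ac)
  qed
  have "((\<lambda>\<alpha>. c' \<alpha> * dmonom X \<alpha> \<xi>) has_sum (\<xi> z * f \<xi>)) (multi_idx X)" if \<xi>: "\<xi> \<in> dual X" for \<xi>
  proof -
    have "((\<lambda>\<alpha>. \<xi> z * (c \<alpha> * dmonom X \<alpha> \<xi>)) has_sum (\<xi> z * f \<xi>)) (multi_idx X)"
      by (rule has_sum_cmult_right[OF c[OF \<xi>]])
    also have "(\<lambda>\<alpha>. \<xi> z * (c \<alpha> * dmonom X \<alpha> \<xi>)) = (\<lambda>\<alpha>. c' \<alpha> * dmonom X \<alpha> \<xi>) \<circ> up"
    proof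
      fix \<alpha>
      have "c' (up \<alpha>) = c \<alpha>" by (simp add: c'_def up_def)
      thus "\<xi> z * (c \<alpha> * dmonom X \<alpha> \<xi>) = ((\<lambda>\<alpha>. c' \<alpha> * dmonom X \<alpha> \<xi>) \<circ> up) \<alpha>"
        by (simp add: mon)
    qed
    finally have "((\<lambda>\<alpha>. c' \<alpha> * dmonom X \<alpha> \<xi>) has_sum (\<xi> z * f \<xi>)) (up ` multi_idx X)"
      by (subst has_sum_reindex[OF inj])
    thus ?thesis
    proof (rule has_sum_cong_neutral[THEN iffD1, rotated -1])
      fix \<alpha> assume \<alpha>: "\<alpha> \<in> multi_idx X - up ` multi_idx X"
      have "\<alpha> z = 0"
      proof (rule ccontr)
        assume "\<alpha> z \<noteq> 0"
        hence "\<alpha> = up (\<alpha>(z := \<alpha> z - 1))" by (simp add: up_def)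
        moreover have "\<alpha>(z := \<alpha> z - 1) \<in> multi_idx X"
          using \<alpha> z by (auto simp: multi_idx_def PiE_iff extensional_def)
        ultimately show False using \<alpha> by blast
      qed
      thus "c' \<alpha> * dmonom X \<alpha> \<xi> = 0" by (simp add: c'_def)
    qed (use up_in in auto)
  qed
  thus ?thesis unfolding entire_on_dual_def by blast
qed

lemma entire_on_dual_mult_linear:
  assumes X: "rational_space X" and v: "v \<in> vs X" and f: "entire_on_dual X f"
  shows "entire_on_dual X (\<lambda>\<xi>. \<xi> v * f \<xi>)"
proof -
  let ?Z = "zbasis (lat X)"
  note Z = zbasis_rational_space[OF X]
  have veq: "v = (\<Sum>z\<in>?Z. coord ?Z z v *\<^sub>R z)" using sum_coord[OF Z(2,3)] Z(4) v by simp
  have "\<xi> v = (\<Sum>z\<in>?Z. coord ?Z z v *\<^sub>R \<xi> z)" if "\<xi> \<in> dual X" for \<xi>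
    using dual_sum[OF that rational_spaceD(1)[OF X] Z(2,5), of "\<lambda>z. coord ?Z z v"] veq by simp
  moreover have "entire_on_dual X (\<lambda>\<xi>. \<Sum>z\<in>?Z. of_real (coord ?Z z v) * (\<xi> z * f \<xi>))"
    by (intro entire_on_dual_sum entire_on_dual_scale entire_on_dual_mult_coordinate X f Z)
  ultimately show ?thesis
  proof (elim entire_on_dual_cong)
    fix \<xi> assume *: "\<And>\<xi>. \<xi> \<in> dual X \<Longrightarrow> \<xi> v = (\<Sum>z\<in>?Z. coord ?Z z v *\<^sub>R \<xi> z)" "\<xi> \<in> dual X"
    show "(\<Sum>z\<in>?Z. of_real (coord ?Z z v) * (\<xi> z * f \<xi>)) = \<xi> v * f \<xi>"
      unfolding *(1)[OF *(2)] by (simp add: sum_distrib_right scaleR_conv_of_real mult.assoc)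
  qed
qed

text \<open>The exponential series in the separate basis coordinates are multiplied; absolute
  convergence turns their product into one sum over multi-indices.\<close>

lemma entire_on_dual_exp:
  assumes X: "rational_space X" and v: "v \<in> vs X"
  shows "entire_on_dual X (\<lambda>\<xi>. exp (\<xi> v))"
  unfolding entire_on_dual_def
proof (intro exI ballI)
  let ?Z = "zbasis (lat X)"
  note Z = zbasis_rational_space[OF X]
  define a where "a = (\<lambda>z. coord ?Z z v)"
  fix \<xi> assume \<xi>: "\<xi> \<in> dual X"
  have veq: "v = (\<Sum>z\<in>?Z. a z *\<^sub>R z)" using sum_coord[OF Z(2,3)] Z(4) v by (simp add: a_def)
  have \<xi>v: "\<xi> v = (\<Sum>z\<in>?Z. a z *\<^sub>R \<xi> z)"
    using dual_sum[OF \<xi> rational_spaceD(1)[OF X] Z(2,5), of a] veq by simp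
  define t where "t = (\<lambda>z n. (a z *\<^sub>R \<xi> z) ^ n /\<^sub>R fact n)"
  have s: "(\<lambda>n. norm (t z n)) summable_on UNIV" for z
    unfolding t_def using summable_norm_exp[of "a z *\<^sub>R \<xi> z"]
    by (intro norm_summable_imp_summable_on) (simp only: real_norm_def abs_norm_cancel)
  have "Infinite_Sum.abs_summable_on (\<lambda>n. \<Prod>z\<in>?Z. t z (n z)) (\<Pi>\<^sub>E z\<in>?Z. UNIV)"
    using s abs_summable_on_prod_PiE[OF Z(2), of "\<lambda>_. UNIV" t] by (simp flip: abs_summable_equivalent)
  hence 1: "((\<lambda>n. \<Prod>z\<in>?Z. t z (n z)) has_sum (\<Sum>\<^sub>\<infinity>n\<in>(\<Pi>\<^sub>E z\<in>?Z. UNIV). \<Prod>z\<in>?Z. t z (n z))) (\<Pi>\<^sub>E z\<in>?Z. UNIV)"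
    by (rule has_sum_infsum[OF abs_summable_summable])
  have "(\<Sum>\<^sub>\<infinity>n\<in>(\<Pi>\<^sub>E z\<in>?Z. UNIV). \<Prod>z\<in>?Z. t z (n z)) = (\<Prod>z\<in>?Z. \<Sum>\<^sub>\<infinity>n. t z n)"
    using s by (intro infsum_prod_PiE_abs Z(2)) auto
  also have "\<dots> = (\<Prod>z\<in>?Z. exp (a z *\<^sub>R \<xi> z))"
  proof (rule prod.cong[OF refl])
    fix z
    show "(\<Sum>\<^sub>\<infinity>n. t z n) = exp (a z *\<^sub>R \<xi> z)"
      using has_sum_imp_sums[OF has_sum_infsum[OF abs_summable_summable[OF s[of z]]]]
      by (simp add: sums_iff exp_def t_def)
  qed
  also have "\<dots> = exp (\<xi> v)" using \<xi>v Z(2) by (simp add: exp_sum)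
  finally have "((\<lambda>n. \<Prod>z\<in>?Z. t z (n z)) has_sum exp (\<xi> v)) (\<Pi>\<^sub>E z\<in>?Z. UNIV)" using 1 by simp
  also have "(\<lambda>n. \<Prod>z\<in>?Z. t z (n z)) = (\<lambda>\<alpha>. (\<Prod>z\<in>?Z. of_real (a z) ^ \<alpha> z / fact (\<alpha> z)) * dmonom X \<alpha> \<xi>)"
  proof
    fix \<alpha> :: "'a \<Rightarrow> nat"
    have "t z n = of_real (a z) ^ n / fact n * \<xi> z ^ n" for z n
      by (simp add: t_def scaleR_conv_of_real power_mult_distrib divide_inverse mult_ac)
    thus "(\<Prod>z\<in>?Z. t z (\<alpha> z)) = (\<Prod>z\<in>?Z. of_real (a z) ^ \<alpha> z / fact (\<alpha> z)) * dmonom X \<alpha> \<xi>"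
      by (simp only: dmonom_def prod.distrib)
  qed
  finally show "((\<lambda>\<alpha>. (\<Prod>z\<in>?Z. of_real (a z) ^ \<alpha> z / fact (\<alpha> z)) * dmonom X \<alpha> \<xi>) has_sum exp (\<xi> v)) (multi_idx X)"
    by (simp add: multi_idx_def)
qed

text \<open>The constant is the exponential at the vector 0.\<close>

lemma entire_on_dual_1:
  assumes X: "rational_space X"
  shows "entire_on_dual X (\<lambda>\<xi>. 1)"
proof -
  have "0 \<in> vs X" using rational_spaceD[OF X] subspace_0 by blast
  show ?thesis
  proof (rule entire_on_dual_cong[OF entire_on_dual_exp[OF X \<open>0 \<in> vs X\<close>]])
    fix \<xi> assume "\<xi> \<in> dual X"
    from dualD(2)[OF this \<open>0 \<in> vs X\<close>, of 0] show "exp (\<xi> 0) = 1" by simp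
  qed
qed

lemma entire_on_dual_prod_linear:
  assumes X: "rational_space X" and "finite V" "V \<subseteq> vs X"
  shows "entire_on_dual X (\<lambda>\<xi>. \<Prod>b\<in>V. \<xi> b)"
  using assms(2,3)
proof (induction V rule: finite_induct)
  case (insert b V)
  thus ?case using entire_on_dual_mult_linear[OF X, of b "\<lambda>\<xi>. \<Prod>b\<in>V. \<xi> b"] by simp
qed (simp add: entire_on_dual_1[OF X])

lemma entire_on_dual_prod_one_minus_exp:
  assumes X: "rational_space X" and "finite V" "V \<subseteq> vs X"
  shows "entire_on_dual X (\<lambda>\<xi>. \<Prod>b\<in>V. 1 - exp (\<xi> b))"
proof -
  have sub: "subspace (vs X)" using rational_spaceD[OF X] by simp
  \<comment> \<open>The extra factor \<open>exp (\<xi> w)\<close> avoids multiplying two power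
    series: the induction step is the difference of the instances for \<open>w\<close> and for
    \<open>w + b\<close>.\<close>
  have "entire_on_dual X (\<lambda>\<xi>. exp (\<xi> w) * (\<Prod>b\<in>V. 1 - exp (\<xi> b)))" if "w \<in> vs X" for w
    using assms(2,3) that
  proof (induction V arbitrary: w rule: finite_induct)
    case empty
    thus ?case using entire_on_dual_exp[OF X] by simp
  next
    case (insert b V)
    have "b \<in> vs X" "w + b \<in> vs X" using insert.prems subspace_add[OF sub] by auto
    hence "entire_on_dual X (\<lambda>\<xi>. exp (\<xi> w) * (\<Prod>b\<in>V. 1 - exp (\<xi> b)) +
        (- 1) * (exp (\<xi> (w + b)) * (\<Prod>b\<in>V. 1 - exp (\<xi> b))))"
      using insert by (intro entire_on_dual_add entire_on_dual_scale insert.IH) auto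
    thus ?case
    proof (rule entire_on_dual_cong)
      fix \<xi> assume "\<xi> \<in> dual X"
      from dualD(1)[OF this insert.prems(2) \<open>b \<in> vs X\<close>]
      show "exp (\<xi> w) * (\<Prod>b\<in>V. 1 - exp (\<xi> b)) + (- 1) * (exp (\<xi> (w + b)) * (\<Prod>b\<in>V. 1 - exp (\<xi> b)))
          = exp (\<xi> w) * (\<Prod>b\<in>insert b V. 1 - exp (\<xi> b))"
        using insert.hyps by (simp add: exp_add algebra_simps)
    qed
  qed
  from this[OF subspace_0[OF sub]] show ?thesis
  proof (rule entire_on_dual_cong)
    fix \<xi> assume "\<xi> \<in> dual X"
    from dualD(2)[OF this subspace_0[OF sub], of 0]
    show "exp (\<xi> 0) * (\<Prod>b\<in>V. 1 - exp (\<xi> b)) = (\<Prod>b\<in>V. 1 - exp (\<xi> b))" by simp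
  qed
qed

text \<open>
  On the set \<open>A\<close> itself every representation evaluates to \<open>f\<close>, so the uniqueness of meromorphic
  continuation is never needed.
\<close>

lemma mero_repI:
  assumes "(g, h) \<in> mero_rep X A f" "\<xi> \<in> A" "\<xi> \<in> dual X" "h \<xi> \<noteq> 0"
  shows "\<xi> \<in> mero_dom X A f" "mero_val X A f \<xi> = f \<xi>"
proof -
  show "\<xi> \<in> mero_dom X A f" using assms unfolding mero_dom_def by blast
  have "h' \<xi> * f \<xi> = g' \<xi>" if "(g', h') \<in> mero_rep X A f" for g' h'
    using that assms(2) by (auto simp: mero_rep_def)
  hence *: "f \<xi> = g' \<xi> / h' \<xi>" if "(g', h') \<in> mero_rep X A f" "h' \<xi> \<noteq> 0" for g' h'
    using that by (metis nonzero_mult_div_cancel_left)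
  show "mero_val X A f \<xi> = f \<xi>" unfolding mero_val_def
  proof (rule the_equality)
    show "\<exists>(g, h)\<in>mero_rep X A f. h \<xi> \<noteq> 0 \<and> f \<xi> = g \<xi> / h \<xi>"
      using assms * by blast
  qed (use * in auto)
qed

section \<open>Quotients of rational spaces\<close>

lemma ip_bilinear:
  assumes "rational_space X" "x \<in> vs X" "y \<in> vs X"
  shows "ip X x y = ip X y x" "ip X (r *\<^sub>R x) y = r * ip X x y" "ip X 0 y = 0" "ip X y 0 = 0"
    "z \<in> vs X \<Longrightarrow> ip X (x + z) y = ip X x y + ip X z y"
    "z \<in> vs X \<Longrightarrow> ip X (x - z) y = ip X x y - ip X z y"
    "z \<in> vs X \<Longrightarrow> ip X y (x + z) = ip X y x + ip X y z"
    "ip X y (r *\<^sub>R x) = r * ip X y x"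
proof -
  note V = rational_spaceD[OF assms(1)]
  note I = inner_product_onD[OF V(2)]
  have z: "0 \<in> vs X" using subspace_0[OF V(1)] .
  show c: "ip X x y = ip X y x" and s: "ip X (r *\<^sub>R x) y = r * ip X x y"
    using I(1,3) assms by auto
  show "ip X 0 y = 0" using I(3)[OF z assms(3), of 0] by simp
  thus "ip X y 0 = 0" using I(1)[OF assms(3) z] by simp
  show "ip X (x + z) y = ip X x y + ip X z y" if "z \<in> vs X" using I(2) assms that by auto
  show "ip X (x - z) y = ip X x y - ip X z y" if "z \<in> vs X"
    using inner_product_on_diff[OF V(2,1)] assms that by auto
  show "ip X y (x + z) = ip X y x + ip X y z" if "z \<in> vs X"
    using I(1)[OF assms(3) subspace_add[OF V(1) assms(2) that]] I(2)[OF assms(2) that assms(3)]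
      I(1)[OF assms(3)] assms that by simp
  show "ip X y (r *\<^sub>R x) = r * ip X y x"
    using I(1)[OF assms(3) subspace_scale[OF V(1) assms(2)]] s c by simp
qed

lemma subspace_perp:
  assumes X: "rational_space X" and L: "L \<subseteq> vs X"
  shows "subspace (perp X L)"
proof (rule subspaceI)
  note V = rational_spaceD[OF X]
  show "0 \<in> perp X L" using ip_bilinear(3)[OF X] subspace_0[OF V(1)] L by (auto simp: perp_def)
  show "x + y \<in> perp X L" if "x \<in> perp X L" "y \<in> perp X L" for x y
    using that ip_bilinear(5)[OF X] L subspace_add[OF V(1)] by (auto simp: perp_def subset_iff)
  show "c *\<^sub>R x \<in> perp X L" if "x \<in> perp X L" for x c
    using that ip_bilinear(2)[OF X] L subspace_scale[OF V(1)] by (auto simp: perp_def subset_iff)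
qed

lemma rational_subspaceD:
  assumes "rational_subspace X L"
  shows "subspace L" "L \<subseteq> vs X"
  using assms by (auto simp: rational_subspace_def)

lemma qproj_linear:
  assumes X: "rational_space X" and L: "rational_subspace X L" and "x \<in> vs X" "y \<in> vs X"
  shows "qproj X L (x + y) = qproj X L x + qproj X L y" "qproj X L (r *\<^sub>R x) = r *\<^sub>R qproj X L x"
    "qproj X L (x - y) = qproj X L x - qproj X L y"
proof -
  note V = rational_spaceD(1)[OF X] and q = qproj[OF X L] and L' = rational_subspaceD[OF L]
  note P = subspace_perp[OF X L'(2)]
  have add: "qproj X L (x + y) = qproj X L x + qproj X L y" if "y \<in> vs X" for y
  proof (rule q(3))
    show "x + y \<in> vs X" using V assms that by (simp add: subspace_add)
    show "qproj X L x + qproj X L y \<in> perp X L" using P q(1) assms that by (simp add: subspace_add)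
    have "(x - qproj X L x) + (y - qproj X L y) \<in> L" using L'(1) q(2) assms that by (simp add: subspace_add)
    thus "x + y - (qproj X L x + qproj X L y) \<in> L" by (simp add: algebra_simps)
  qed
  have scale: "qproj X L (r *\<^sub>R x) = r *\<^sub>R qproj X L x" if "x \<in> vs X" for r x
  proof (rule q(3))
    show "r *\<^sub>R x \<in> vs X" using V assms that by (simp add: subspace_scale)
    show "r *\<^sub>R qproj X L x \<in> perp X L" using P q(1) assms that by (simp add: subspace_scale)
    have "r *\<^sub>R (x - qproj X L x) \<in> L" using L'(1) q(2) assms that by (simp add: subspace_scale)
    thus "r *\<^sub>R x - r *\<^sub>R qproj X L x \<in> L" by (simp add: algebra_simps)
  qed
  show "qproj X L (x + y) = qproj X L x + qproj X L y" "qproj X L (r *\<^sub>R x) = r *\<^sub>R qproj X L x"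
    using add scale assms by auto
  show "qproj X L (x - y) = qproj X L x - qproj X L y"
    using add[of "- y"] scale[of y "-1"] assms subspace_neg[OF V] by auto
qed

lemma qproj_vanish:
  assumes X: "rational_space X" and L: "rational_subspace X L" and "x \<in> vs X"
  shows "qproj X L x = 0 \<longleftrightarrow> x \<in> L"
proof
  note q = qproj[OF X L] and L' = rational_subspaceD[OF L]
  show "qproj X L x = 0 \<Longrightarrow> x \<in> L" using q(2)[OF assms(3)] by simp
  show "x \<in> L \<Longrightarrow> qproj X L x = 0"
    using q(3)[OF assms(3) subspace_0[OF subspace_perp[OF X L'(2)]]] by simp
qed

lemma qproj_perp:
  assumes X: "rational_space X" and L: "rational_subspace X L" and "x \<in> perp X L"
  shows "qproj X L x = x"
  using assms(3) subspace_0[OF rational_subspaceD(1)[OF L]]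
  by (intro qproj(3)[OF X L]) (auto simp: perp_def)

lemma qproj_sum:
  assumes X: "rational_space X" and L: "rational_subspace X L" and "finite S" "\<And>b. b \<in> S \<Longrightarrow> f b \<in> vs X"
  shows "qproj X L (\<Sum>b\<in>S. t b *\<^sub>R f b) = (\<Sum>b\<in>S. t b *\<^sub>R qproj X L (f b))"
  using assms(3,4)
proof (induction S rule: finite_induct)
  case empty
  show ?case using qproj_vanish[OF X L] subspace_0[OF rational_subspaceD(1)[OF L]] rational_subspaceD(2)[OF L] by auto
next
  case (insert b S)
  note V = rational_spaceD(1)[OF X]
  have "(\<Sum>b\<in>S. t b *\<^sub>R f b) \<in> vs X" "t b *\<^sub>R f b \<in> vs X" "f b \<in> vs X"
    using insert.prems by (auto intro!: subspace_sum[OF V] subspace_scale[OF V])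
  thus ?case using insert qproj_linear[OF X L] by simp
qed

section \<open>Rational points and the rationality of orthogonal projection\<close>

lemma rational_point_lat: "rational_space X \<Longrightarrow> x \<in> lat X \<Longrightarrow> rational_point X x"
  using lat_memberships[of X] by (auto simp: rational_point_def intro!: exI[of _ 1])

lemma lat_closed:
  assumes X: "rational_space X" and "x \<in> lat X" "y \<in> lat X"
  shows "x + y \<in> lat X" "x - y \<in> lat X" "of_int k *\<^sub>R x \<in> lat X"
proof -
  note Z = zbasis_rational_space[OF X]
  define B where "B = zbasis (lat X)"
  have eq: "lat X = int_span B" using Z(1) by (simp add: is_zbasis_def B_def)
  note Z = Z(2,3)[folded B_def]
  show "x + y \<in> lat X" "x - y \<in> lat X" "of_int k *\<^sub>R x \<in> lat X"
    using assms(2,3) unfolding eq int_span_iff[OF Z]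
    by (auto simp: coord_add coord_diff coord_scaleR Z(2) intro: span_add span_diff span_scale)
qed

lemma lat_sum:
  assumes X: "rational_space X" and "\<And>b. b \<in> S \<Longrightarrow> f b \<in> lat X"
  shows "(\<Sum>b\<in>S. of_int (k b) *\<^sub>R f b) \<in> lat X"
  using assms(2) lat_memberships(1)[OF X]
  by (induction S rule: infinite_finite_induct) (auto intro: lat_closed[OF X])

lemma rational_point_combine:
  assumes X: "rational_space X" and x: "rational_point X x" and y: "rational_point X y" and r: "r \<in> \<rat>"
  shows "rational_point X (x + r *\<^sub>R y)"
proof -
  note V = rational_spaceD(1)[OF X]
  obtain p q :: int where p: "p \<noteq> 0" "of_int p *\<^sub>R x \<in> lat X" and q: "q \<noteq> 0" "of_int q *\<^sub>R y \<in> lat X"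
    using x y by (auto simp: rational_point_def)
  obtain a b :: int where ab: "b \<noteq> 0" "r = of_int a / of_int b"
    using r by (elim Rats_cases') (metis less_irrefl)
  have "of_int (b * q) *\<^sub>R (of_int p *\<^sub>R x) + of_int (p * a) *\<^sub>R (of_int q *\<^sub>R y) \<in> lat X"
    by (intro lat_closed(1)[OF X] lat_closed(3)[OF X _ p(2)] p q)
  also have "of_int (b * q) *\<^sub>R (of_int p *\<^sub>R x) + of_int (p * a) *\<^sub>R (of_int q *\<^sub>R y)
      = of_int (b * q * p) *\<^sub>R (x + r *\<^sub>R y)"
    using ab by (simp add: scaleR_add_right algebra_simps)
  finally have "of_int (b * q * p) *\<^sub>R (x + r *\<^sub>R y) \<in> lat X" .
  moreover have "b * q * p \<noteq> 0" using ab p q by simp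
  moreover have "x + r *\<^sub>R y \<in> vs X"
    using x y V by (auto simp: rational_point_def intro: subspace_add subspace_scale)
  ultimately show ?thesis unfolding rational_point_def by blast
qed

lemma orthogonal_span:
  assumes X: "rational_space X" and "B \<subseteq> vs X" "y \<in> vs X" "\<And>m. m \<in> B \<Longrightarrow> ip X y m = 0" "m \<in> span B"
  shows "ip X y m = 0"
proof -
  note V = rational_spaceD(1)[OF X]
  have "subspace {m \<in> vs X. ip X y m = 0}"
    using ip_bilinear[OF X _ assms(3)] ip_bilinear(4)[OF X assms(3,3)] V
    by (auto intro!: subspaceI simp: subspace_0 subspace_add subspace_scale)
  moreover have "B \<subseteq> {m \<in> vs X. ip X y m = 0}" using assms by auto
  ultimately show ?thesis using assms(5) span_minimal by blast
qed

text \<open>Gram--Schmidt over the rationals: the inner product of rational points is rational,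
  hence so are all projection coefficients. This is why the quotient inherits a rational inner
  product.\<close>

lemma rational_orthogonal_decomposition:
  assumes X: "rational_space X" and "finite B" "\<And>b. b \<in> B \<Longrightarrow> rational_point X b" "rational_point X x"
  shows "\<exists>l\<in>span B. rational_point X l \<and> (\<forall>m\<in>B. ip X (x - l) m = 0)"
  using assms(2-4)
proof (induction B arbitrary: x rule: finite_induct)
  case empty
  have "rational_point X 0" using rational_point_lat[OF X] lat_memberships[OF X] by blast
  thus ?case by simp
next
  case (insert b B)
  note V = rational_spaceD(1)[OF X]
  have vs: "rational_point X u \<Longrightarrow> u \<in> vs X" for u by (simp add: rational_point_def)
  have BV: "B \<subseteq> vs X" using insert.prems vs by auto
  obtain p where p: "p \<in> span B" "rational_point X p" "\<forall>m\<in>B. ip X (b - p) m = 0"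
    using insert.IH[of b] insert.prems by auto
  obtain q where q: "q \<in> span B" "rational_point X q" "\<forall>m\<in>B. ip X (x - q) m = 0"
    using insert.IH[of x] insert.prems by auto
  define e where "e = b - p"
  have eR: "rational_point X e"
    using rational_point_combine[OF X _ p(2), of b "-1"] insert.prems by (simp add: e_def)
  have xqR: "rational_point X (x - q)"
    using rational_point_combine[OF X insert.prems(2) q(2), of "-1"] by simp
  \<comment> \<open>If \<open>e = 0\<close>, division by zero gives \<open>r = 0\<close>, and
    \<open>l\<close> is just \<open>q\<close>.\<close>
  define r where "r = ip X (x - q) e / ip X e e"
  have rat: "rational_point X u \<Longrightarrow> rational_point X v \<Longrightarrow> ip X u v \<in> \<rat>" for u v
    using X by (auto simp: rational_space_def)
  have rR: "r \<in> \<rat>" unfolding r_def using rat eR xqR by simp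
  define l where "l = q + r *\<^sub>R e"
  have lR: "rational_point X l" unfolding l_def by (rule rational_point_combine[OF X q(2) eR rR])
  have e_span: "e \<in> span (insert b B)"
    unfolding e_def using p(1) span_mono[of B "insert b B"] by (auto intro: span_diff span_base)
  have l_span: "l \<in> span (insert b B)"
    unfolding l_def using q(1) e_span span_mono[of B "insert b B"] by (auto intro: span_add span_scale)
  note mem = vs[OF eR] vs[OF xqR] vs[OF p(2)] vs[OF lR]
  have xl: "x - l = (x - q) - r *\<^sub>R e" by (simp add: l_def)
  have xlV: "x - l \<in> vs X" unfolding xl using mem V by (simp add: subspace_diff subspace_scale)
  have ipl: "ip X (x - l) m = ip X (x - q) m - r * ip X e m" if "m \<in> vs X" for m
    unfolding xl using ip_bilinear(2,6)[OF X] mem that subspace_scale[OF V] by simp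
  have B0: "ip X (x - l) m = 0" if "m \<in> B" for m
    using ipl[of m] that BV p(3) q(3) by (auto simp: e_def)
  have e0: "ip X (x - l) e = 0"
  proof (cases "e = 0")
    case True
    thus ?thesis using ip_bilinear(4)[OF X xlV xlV] by simp
  next
    case False
    hence "ip X e e \<noteq> 0" using inner_product_onD(4)[OF rational_spaceD(2)[OF X] mem(1,1)] by simp
    thus ?thesis using ipl[OF mem(1)] by (simp add: r_def)
  qed
  have "ip X (x - l) (e + p) = 0"
    using ip_bilinear(7)[OF X mem(1) xlV mem(3)] e0 orthogonal_span[OF X BV xlV B0 p(1)] by simp
  hence "ip X (x - l) b = 0" by (simp add: e_def)
  thus ?case using l_span lR B0 by (intro bexI[of _ l]) auto
qed

lemma rational_point_qproj:
  assumes X: "rational_space X" and L: "rational_subspace X L" and x: "rational_point X x"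
  shows "rational_point X (qproj X L x)"
proof -
  note V = rational_spaceD(1)[OF X]
  obtain B where B: "is_zbasis B (L \<inter> lat X)" "span B = L"
    using L by (auto simp: rational_subspace_def is_lattice_def)
  hence fin: "finite B" "independent B" by (auto simp: is_zbasis_def)
  have "B \<subseteq> lat X"
  proof
    fix b assume "b \<in> B"
    hence "b \<in> int_span B" unfolding int_span_iff[OF fin] by (auto simp: coord_basis fin span_base)
    thus "b \<in> lat X" using B(1) by (auto simp: is_zbasis_def)
  qed
  hence "\<And>b. b \<in> B \<Longrightarrow> rational_point X b" using rational_point_lat[OF X] by blast
  from rational_orthogonal_decomposition[OF X fin(1) this x]
  obtain l where l: "l \<in> span B" "rational_point X l" "\<forall>m\<in>B. ip X (x - l) m = 0" by blast
  have xl: "rational_point X (x - l)" using rational_point_combine[OF X x l(2), of "-1"] by simp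
  have "qproj X L x = x - l"
  proof (rule qproj(3)[OF X L])
    show "x \<in> vs X" using x by (simp add: rational_point_def)
    have "ip X (x - l) m = 0" if "m \<in> L" for m
      using orthogonal_span[OF X, of B "x - l" m] l(3) B(2) that xl span_superset[of B] rational_subspaceD(2)[OF L]
      by (auto simp: rational_point_def)
    thus "x - l \<in> perp X L" using xl by (auto simp: perp_def rational_point_def)
  qed (use l B in auto)
  thus ?thesis using xl by simp
qed

lemma quot_simps [simp]: "vs (quot X L) = perp X L" "lat (quot X L) = qproj X L ` lat X" "ip (quot X L) = ip X"
  by (simp_all add: quot_def)

text \<open>The \<int>-basis of the projected lattice is an assumption, which unimodularity of a
  cone supplies in the applications. Rational points of the quotient are rational in
  \<open>X\<close> by \<open>rational_point_qproj\<close>, so the inner product stays rational on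
  them.\<close>

lemma rational_space_quot:
  assumes X: "rational_space X" and L: "rational_subspace X L" and B: "is_zbasis B (lat (quot X L))"
  shows "rational_space (quot X L)"
proof -
  note V = rational_spaceD[OF X] and Z = zbasis_rational_space[OF X] and L' = rational_subspaceD[OF L]
  have fin: "finite B" "independent B" "qproj X L ` lat X = int_span B"
    using B unfolding is_zbasis_def quot_simps by blast+
  have "span B = perp X L"
  proof
    have "int_span B \<subseteq> perp X L"
      unfolding fin(3)[symmetric] using qproj(1)[OF X L] lat_memberships(2)[OF X] by (auto simp del: quot_simps)
    thus "span B \<subseteq> perp X L"
      using span_minimal[OF _ subspace_perp[OF X L'(2)]] span_int_span[OF fin(1,2)] by blast
    show "perp X L \<subseteq> span B"
    proof
      fix x assume x: "x \<in> perp X L"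
      let ?Z = "zbasis (lat X)"
      have xv: "x \<in> vs X" using x by (simp add: perp_def)
      have "x = qproj X L (\<Sum>z\<in>?Z. coord ?Z z x *\<^sub>R z)"
        using sum_coord[OF Z(2,3)] Z(4) xv qproj_perp[OF X L x] by simp
      also have "\<dots> = (\<Sum>z\<in>?Z. coord ?Z z x *\<^sub>R qproj X L z)" using Z(5) by (intro qproj_sum[OF X L Z(2)]) auto
      also have "\<dots> \<in> span (int_span B)"
      proof (intro span_sum span_scale span_base)
        fix z assume "z \<in> ?Z"
        hence "z \<in> int_span ?Z" unfolding int_span_iff[OF Z(2,3)] by (auto simp: coord_basis Z(3) span_base)
        hence "z \<in> lat X" using Z(1) by (simp add: is_zbasis_def)
        thus "qproj X L z \<in> int_span B" unfolding fin(3)[symmetric] by (rule imageI)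
      qed
      finally show "x \<in> span B" using span_int_span[OF fin(1,2)] by simp
    qed
  qed
  hence "is_lattice (lat (quot X L)) (vs (quot X L))" using B by (auto simp: is_lattice_def)
  moreover have "inner_product_on (perp X L) (ip X)"
    using V(2) by (simp add: inner_product_on_def perp_def)
  moreover have "rational_point X x" if xr: "rational_point (quot X L) x" for x
  proof -
    obtain q :: int and y where q: "q \<noteq> 0" "of_int q *\<^sub>R x = qproj X L y" "y \<in> lat X" "x \<in> perp X L"
      using xr by (auto simp: rational_point_def)
    have "rational_point X (qproj X L y)"
      by (rule rational_point_qproj[OF X L rational_point_lat[OF X q(3)]])
    hence "rational_point X (0 + inverse (of_int q) *\<^sub>R (of_int q *\<^sub>R x))"
      unfolding q(2) using rational_point_lat[OF X lat_memberships(1)[OF X]]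
      by (intro rational_point_combine[OF X]) auto
    thus ?thesis using q(1) by simp
  qed
  ultimately show ?thesis using X by (simp add: rational_space_def)
qed

text \<open>The premise concerns the indexed family, so it also excludes repetitions:
  \<open>f a = f b\<close> would give a relation with coefficients 1 and -1.\<close>

lemma independent_image_explicit:
  assumes "finite S" "\<And>c. (\<Sum>b\<in>S. c b *\<^sub>R f b) = 0 \<Longrightarrow> \<forall>b\<in>S. c b = (0::real)"
  shows "inj_on f S" "independent (f ` S)"
proof -
  show inj: "inj_on f S"
  proof (rule inj_onI, rule ccontr)
    fix a b assume ab: "a \<in> S" "b \<in> S" "f a = f b" "a \<noteq> b"
    have "(\<Sum>c\<in>S. (if c = a then 1 else if c = b then -1 else 0) *\<^sub>R f c)
        = (\<Sum>c\<in>{a, b}. (if c = a then 1 else if c = b then -1 else 0) *\<^sub>R f c)"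
      using assms(1) ab by (intro sum.mono_neutral_right) auto
    also have "\<dots> = 0" using ab by simp
    finally have "\<forall>c\<in>S. (if c = a then 1 else if c = b then -1 else 0) = (0::real)" by (rule assms(2))
    thus False using ab by fastforce
  qed
  show "independent (f ` S)"
  proof
    assume "dependent (f ` S)"
    then obtain u v where uv: "v \<in> f ` S" "u v \<noteq> 0" "(\<Sum>v\<in>f ` S. u v *\<^sub>R v) = 0"
      using assms(1) by (auto simp: dependent_finite)
    hence "(\<Sum>b\<in>S. u (f b) *\<^sub>R f b) = 0" using inj by (simp add: sum.reindex)
    from assms(2)[OF this] uv show False by auto
  qed
qed

text \<open>\<open>P\<close> is integrality when the sums form a lattice and non-negativity when
  they form a cone.\<close>

lemma sums_over_image:
  assumes "finite S" "inj_on f S"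
  shows "{\<Sum>c\<in>f ` S. t c *\<^sub>R c | t. \<forall>c\<in>f ` S. P (t c)} = {\<Sum>b\<in>S. (t b :: real) *\<^sub>R f b | t. \<forall>b\<in>S. P (t b)}"
proof safe
  fix t assume "\<forall>c\<in>f ` S. P (t c :: real)"
  thus "\<exists>u. (\<Sum>c\<in>f ` S. t c *\<^sub>R c) = (\<Sum>b\<in>S. u b *\<^sub>R f b) \<and> (\<forall>b\<in>S. P (u b))"
    using assms by (intro exI[of _ "t \<circ> f"]) (auto simp: sum.reindex)
next
  fix t assume t: "\<forall>b\<in>S. P (t b :: real)"
  have "t (inv_into S f (f b)) = t b" if "b \<in> S" for b using assms(2) that by (simp add: inv_into_f_f)
  thus "\<exists>u. (\<Sum>b\<in>S. t b *\<^sub>R f b) = (\<Sum>c\<in>f ` S. u c *\<^sub>R c) \<and> (\<forall>c\<in>f ` S. P (u c))"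
    using assms t by (intro exI[of _ "t \<circ> inv_into S f"]) (auto simp: sum.reindex intro!: sum.cong)
qed

lemma int_span_Ints: "int_span B = {\<Sum>b\<in>B. t b *\<^sub>R b | t. \<forall>b\<in>B. t b \<in> \<int>}"
proof safe
  fix x assume "x \<in> int_span B"
  then obtain k :: "'a \<Rightarrow> int" where "x = (\<Sum>b\<in>B. of_int (k b) *\<^sub>R b)" by (auto simp: int_span_def)
  thus "\<exists>t. x = (\<Sum>b\<in>B. t b *\<^sub>R b) \<and> (\<forall>b\<in>B. t b \<in> \<int>)" by (intro exI[of _ "\<lambda>b. of_int (k b)"]) auto
next
  fix t :: "'a \<Rightarrow> real" assume "\<forall>b\<in>B. t b \<in> \<int>"
  hence "(\<Sum>b\<in>B. t b *\<^sub>R b) = (\<Sum>b\<in>B. of_int \<lfloor>t b\<rfloor> *\<^sub>R b)" by (intro sum.cong) (auto elim: Ints_cases)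
  thus "(\<Sum>b\<in>B. t b *\<^sub>R b) \<in> int_span B" unfolding int_span_def
    by (intro CollectI exI[of _ "\<lambda>b. \<lfloor>t b\<rfloor>"]) simp
qed


text \<open>
  A lattice basis of \<open>L\<close> together with lifts of a lattice basis of \<open>M\<close> is a lattice basis of \<open>L + M\<close>.
\<close>

lemma quot_quot:
  assumes X: "rational_space X" and L: "rational_subspace X L" and Y: "rational_space (quot X L)"
    and M: "rational_subspace (quot X L) M"
  defines "L' \<equiv> {l + m | l m. l \<in> L \<and> m \<in> M}"
  shows "rational_subspace X L'" "quot (quot X L) M = quot X L'"
proof -
  let ?\<pi> = "qproj X L"
  note V = rational_spaceD(1)[OF X] and Ls = rational_subspaceD[OF L] and Ms = rational_subspaceD[OF M]
  have MP: "M \<subseteq> perp X L" using Ms(2) by simp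
  have L'0: "l \<in> L'" if "l \<in> L" for l
    unfolding L'_def using that subspace_0[OF Ms(1)] by (intro CollectI exI[of _ l] exI[of _ 0]) auto
  have L'1: "m \<in> L'" if "m \<in> M" for m
    unfolding L'_def using that subspace_0[OF Ls(1)] by (intro CollectI exI[of _ 0] exI[of _ m]) auto
  have sub: "subspace L'"
    unfolding L'_def by (rule subspace_sums[OF Ls(1) Ms(1)])
  have L'V: "L' \<subseteq> vs X"
    unfolding L'_def using Ls(2) MP subspace_add[OF V] by (auto simp: perp_def subset_iff)
  have \<pi>M: "?\<pi> m = m" if "m \<in> M" for m using qproj_perp[OF X L] MP that by blast
  have \<pi>L': "?\<pi> x \<in> M" if x: "x \<in> L'" for x
  proof -
    obtain l m where lm: "x = l + m" "l \<in> L" "m \<in> M" using x by (auto simp: L'_def)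
    have "l \<in> vs X" "m \<in> vs X" using lm Ls(2) MP by (auto simp: perp_def)
    moreover from this have "?\<pi> l = 0" using qproj_vanish[OF X L] lm(2) by blast
    ultimately show ?thesis using qproj_linear(1)[OF X L] lm \<pi>M by simp
  qed
  obtain B1 where B1: "is_zbasis B1 (L \<inter> lat X)" "span B1 = L"
    using L by (auto simp: rational_subspace_def is_lattice_def)
  obtain B2 where B2: "is_zbasis B2 (M \<inter> lat (quot X L))" "span B2 = M"
    using M unfolding rational_subspace_def is_lattice_def by blast
  have f1: "finite B1" "independent B1" "L \<inter> lat X = int_span B1"
    and f2: "finite B2" "independent B2" "M \<inter> lat (quot X L) = int_span B2"
    using B1 B2 unfolding is_zbasis_def by blast+
  have B1in: "b \<in> L" "b \<in> lat X" if "b \<in> B1" for b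
  proof -
    have "b \<in> int_span B1" unfolding int_span_iff[OF f1(1,2)] using that by (auto simp: coord_basis f1 span_base)
    thus "b \<in> L" "b \<in> lat X" using f1(3) by auto
  qed
  have "\<exists>y\<in>lat X. b = ?\<pi> y" if "b \<in> B2" for b
  proof -
    have "b \<in> int_span B2" unfolding int_span_iff[OF f2(1,2)] using that by (auto simp: coord_basis f2 span_base)
    hence "b \<in> lat (quot X L)" using f2(3) by blast
    thus ?thesis by auto
  qed
  then obtain g where g: "\<And>b. b \<in> B2 \<Longrightarrow> g b \<in> lat X" "\<And>b. b \<in> B2 \<Longrightarrow> ?\<pi> (g b) = b" by metis
  have latV: "x \<in> lat X \<Longrightarrow> x \<in> vs X" for x using lat_memberships(2)[OF X] by blast
  have B2M: "B2 \<subseteq> M" using B2(2) span_superset by blast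
  have gL': "g b \<in> L'" if "b \<in> B2" for b
  proof -
    have "g b - b \<in> L" using qproj(2)[OF X L latV[OF g(1)[OF that]]] g(2)[OF that] by simp
    hence "(g b - b) + b \<in> L'" using that B2M unfolding L'_def by blast
    thus ?thesis by simp
  qed
  \<comment> \<open>The disjoint sum keeps the basis of \<open>L\<close> and the lifts apart as
    indices; that their values are distinct comes out of independence.\<close>
  define f where "f = case_sum (\<lambda>b. b) g"
  define S where "S = B1 <+> B2"
  have finS: "finite S" unfolding S_def using f1 f2 by simp
  have sumS: "(\<Sum>b\<in>S. c b *\<^sub>R f b) = (\<Sum>b\<in>B1. c (Inl b) *\<^sub>R b) + (\<Sum>b\<in>B2. c (Inr b) *\<^sub>R g b)" for c :: "_ \<Rightarrow> real"
    unfolding S_def f_def using f1 f2 by (subst sum.Plus) auto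
  have sum1: "(\<Sum>b\<in>B1. c b *\<^sub>R b) \<in> L" for c :: "_ \<Rightarrow> real"
    using B1in by (intro subspace_sum subspace_scale Ls(1)) auto
  have sum2V: "(\<Sum>b\<in>B2. c b *\<^sub>R g b) \<in> vs X" for c :: "_ \<Rightarrow> real"
    using g latV by (intro subspace_sum subspace_scale V) auto
  have \<pi>sum: "?\<pi> (\<Sum>b\<in>S. c b *\<^sub>R f b) = (\<Sum>b\<in>B2. c (Inr b) *\<^sub>R b)" for c :: "_ \<Rightarrow> real"
  proof -
    have "?\<pi> (\<Sum>b\<in>B2. c (Inr b) *\<^sub>R g b) = (\<Sum>b\<in>B2. c (Inr b) *\<^sub>R ?\<pi> (g b))"
      by (rule qproj_sum[OF X L f2(1)]) (rule latV[OF g(1)])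
    hence "?\<pi> (\<Sum>b\<in>B2. c (Inr b) *\<^sub>R g b) = (\<Sum>b\<in>B2. c (Inr b) *\<^sub>R b)" using g(2) by simp
    moreover have s1: "(\<Sum>b\<in>B1. c (Inl b) *\<^sub>R b) \<in> vs X" using sum1[of "\<lambda>b. c (Inl b)"] Ls(2) by blast
    moreover from s1 have "?\<pi> (\<Sum>b\<in>B1. c (Inl b) *\<^sub>R b) = 0"
      using qproj_vanish[OF X L] sum1[of "\<lambda>b. c (Inl b)"] by blast
    ultimately show ?thesis
      unfolding sumS using qproj_linear(1)[OF X L s1 sum2V[of "\<lambda>b. c (Inr b)"]] by simp
  qed
  have ind: "\<forall>b\<in>S. c b = 0" if c: "(\<Sum>b\<in>S. c b *\<^sub>R f b) = 0" for c :: "_ \<Rightarrow> real"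
  proof -
    have "(\<Sum>b\<in>B2. c (Inr b) *\<^sub>R b) = (\<Sum>b\<in>B2. 0 *\<^sub>R b)"
      using \<pi>sum[of c] qproj_vanish[OF X L subspace_0[OF V]] subspace_0[OF Ls(1)] c by simp
    hence c2: "c (Inr b) = 0" if "b \<in> B2" for b
      using sum_scaleR_eqD[OF f2(1,2), of "\<lambda>b. c (Inr b)" "\<lambda>_. 0"] that by blast
    hence "(\<Sum>b\<in>B1. c (Inl b) *\<^sub>R b) = (\<Sum>b\<in>B1. 0 *\<^sub>R b)" using c unfolding sumS by simp
    hence "c (Inl b) = 0" if "b \<in> B1" for b
      using sum_scaleR_eqD[OF f1(1,2), of "\<lambda>b. c (Inl b)" "\<lambda>_. 0"] that by blast
    thus ?thesis using c2 by (auto simp: S_def)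
  qed
  note img = independent_image_explicit[OF finS ind]
  have fS: "f ` S \<subseteq> L' \<inter> lat X"
    unfolding S_def f_def using B1in g(1) gL' L'0 by auto
  have "L' \<inter> lat X = int_span (f ` S)"
  proof
    show "int_span (f ` S) \<subseteq> L' \<inter> lat X"
    proof
      fix x assume "x \<in> int_span (f ` S)"
      then obtain k :: "'a \<Rightarrow> int" where k: "x = (\<Sum>b\<in>f ` S. of_int (k b) *\<^sub>R b)" by (auto simp: int_span_def)
      have "x \<in> L'" unfolding k using fS by (intro subspace_sum subspace_scale sub) auto
      moreover have "x \<in> lat X" unfolding k using fS by (intro lat_sum[OF X]) auto
      ultimately show "x \<in> L' \<inter> lat X" by simp
    qed
    show "L' \<inter> lat X \<subseteq> int_span (f ` S)"
    proof
      fix x assume x: "x \<in> L' \<inter> lat X"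
      have "?\<pi> x \<in> M \<inter> lat (quot X L)" using x \<pi>L' by auto
      then obtain k :: "'a \<Rightarrow> int" where k: "?\<pi> x = (\<Sum>b\<in>B2. of_int (k b) *\<^sub>R b)"
        unfolding f2(3) by (auto simp: int_span_def)
      \<comment> \<open>Subtracting the lift of the projection leaves a lattice point that projects
        to 0, hence one in \<open>L\<close>.\<close>
      define y where "y = x - (\<Sum>b\<in>B2. of_int (k b) *\<^sub>R g b)"
      have ylat: "y \<in> lat X" unfolding y_def using x g(1) by (intro lat_closed(2)[OF X] lat_sum[OF X]) auto
      have "?\<pi> (\<Sum>b\<in>B2. of_int (k b) *\<^sub>R g b) = (\<Sum>b\<in>B2. of_int (k b) *\<^sub>R b)"
        using \<pi>sum[of "case_sum (\<lambda>_. 0) (\<lambda>b. of_int (k b))"] unfolding sumS by simp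
      hence "?\<pi> y = 0" unfolding y_def using k x latV sum2V qproj_linear(3)[OF X L] by simp
      hence "y \<in> L" using qproj_vanish[OF X L latV[OF ylat]] by simp
      hence "y \<in> int_span B1" using ylat f1(3) by blast
      then obtain j :: "'a \<Rightarrow> int" where j: "y = (\<Sum>b\<in>B1. of_int (j b) *\<^sub>R b)" by (auto simp: int_span_def)
      define c where "c = case_sum (\<lambda>b. of_int (j b)) (\<lambda>b. of_int (k b) :: real)"
      have "x = (\<Sum>b\<in>S. c b *\<^sub>R f b)" unfolding sumS using j by (simp add: c_def y_def algebra_simps)
      moreover have "\<forall>b\<in>S. c b \<in> \<int>" by (auto simp: c_def S_def)
      ultimately show "x \<in> int_span (f ` S)"
        using sums_over_image[OF finS img(1), where P = "\<lambda>t. t \<in> \<int>"] unfolding int_span_Ints by blast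
    qed
  qed
  moreover have "span (f ` S) = L'"
  proof
    show "span (f ` S) \<subseteq> L'" using fS by (intro span_minimal sub) auto
    show "L' \<subseteq> span (f ` S)"
    proof
      fix x assume "x \<in> L'"
      then obtain l m where lm: "x = l + m" "l \<in> L" "m \<in> M" by (auto simp: L'_def)
      have b1: "L \<subseteq> span (f ` S)"
      proof -
        have "B1 \<subseteq> f ` S" by (force simp: f_def S_def)
        thus ?thesis unfolding B1(2)[symmetric] by (rule span_mono)
      qed
      have "B2 \<subseteq> span (f ` S)"
      proof
        fix b assume b: "b \<in> B2"
        have "g b \<in> f ` S" using b by (force simp: f_def S_def)
        moreover have "g b - b \<in> L" using qproj(2)[OF X L latV[OF g(1)[OF b]]] g(2)[OF b] by simp
        ultimately have "g b - (g b - b) \<in> span (f ` S)" using b1 by (blast intro: span_diff span_base)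
        thus "b \<in> span (f ` S)" by simp
      qed
      hence "M \<subseteq> span (f ` S)" unfolding B2(2)[symmetric] by (intro span_minimal) auto
      thus "x \<in> span (f ` S)" unfolding lm(1) using lm b1 by (intro span_add) auto
    qed
  qed
  ultimately have "is_lattice (L' \<inter> lat X) L'"
    using img(2) finS unfolding is_lattice_def is_zbasis_def by blast
  thus L'rat: "rational_subspace X L'" using sub L'V by (simp add: rational_subspace_def)
  have perp_eq: "perp (quot X L) M = perp X L'"
  proof (intro set_eqI iffI)
    fix x assume "x \<in> perp (quot X L) M"
    hence x: "x \<in> vs X" "\<forall>l\<in>L. ip X x l = 0" "\<forall>m\<in>M. ip X x m = 0" by (auto simp: perp_def[of "quot X L"]) (auto simp: perp_def)
    have "ip X x (l + m) = 0" if "l \<in> L" "m \<in> M" for l m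
    proof -
      have "l \<in> vs X" "m \<in> vs X" using that Ls(2) MP by (auto simp: perp_def)
      thus ?thesis using ip_bilinear(7)[OF X _ x(1)] x that by simp
    qed
    thus "x \<in> perp X L'" using x(1) by (auto simp: perp_def L'_def)
  next
    fix x assume x: "x \<in> perp X L'"
    hence "x \<in> perp X L" using L'0 by (auto simp: perp_def)
    moreover have "\<forall>m\<in>M. ip X x m = 0" using x L'1 by (auto simp: perp_def)
    ultimately show "x \<in> perp (quot X L) M" unfolding perp_def[of "quot X L"] by simp
  qed
  have qeq: "qproj X L' x = qproj (quot X L) M (?\<pi> x)" if x: "x \<in> vs X" for x
  proof (rule qproj(3)[OF X L'rat x])
    have px: "?\<pi> x \<in> vs (quot X L)" using qproj(1)[OF X L x] by simp
    note q = qproj[OF Y M px]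
    show "qproj (quot X L) M (?\<pi> x) \<in> perp X L'" using q(1) perp_eq by simp
    have "(x - ?\<pi> x) + (?\<pi> x - qproj (quot X L) M (?\<pi> x)) \<in> L'"
      unfolding L'_def using qproj(2)[OF X L x] q(2) by blast
    thus "x - qproj (quot X L) M (?\<pi> x) \<in> L'" by simp
  qed
  have "qproj (quot X L) M ` lat (quot X L) = qproj X L' ` lat X"
    using qeq latV by (auto simp: image_image)
  thus "quot (quot X L) M = quot X L'"
    unfolding quot_def[of "quot X L"] quot_def[of X L'] using perp_eq by (simp add: quot_def)
qed

text \<open>By \<open>quot_quot\<close> a quotient of \<open>X/L\<close> is literally the same
  record as a quotient of \<open>X\<close>, so its conditions are among those for
  \<open>X\<close>.\<close>

lemma BV_family_quot:
  assumes "rational_space X" "rational_subspace X L" "rational_space (quot X L)" "BV_family X \<mu>"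
  shows "BV_family (quot X L) \<mu>"
  unfolding BV_family_def
proof (intro allI impI)
  fix M W A assume *: "rational_subspace (quot X L) M \<and> W = quot (quot X L) M \<and> rational_affine_cone W A"
  define L' where "L' = {l + m | l m. l \<in> L \<and> m \<in> M}"
  have "rational_subspace X L' \<and> W = quot X L' \<and> rational_affine_cone W A"
    using quot_quot[OF assms(1-3), of M, folded L'_def] * by blast
  thus "analytic_at0_rat W (\<mu> W A) \<and>
        (vs W = {0} \<longrightarrow> A = {0} \<longrightarrow> near0 W (\<lambda>\<xi>. \<mu> W A \<xi> = 1)) \<and>
        (contains_line A \<longrightarrow> near0 W (\<lambda>\<xi>. \<mu> W A \<xi> = 0)) \<and>
        near0 W (\<lambda>\<xi>. \<xi> \<in> S_dom W A \<longrightarrow> (\<forall>F\<in>faces A. \<xi> \<in> I_dom W F) \<longrightarrow>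
           S_mero W A \<xi> =
             (\<Sum>F\<in>faces A. \<mu> (quot W (lin F)) (transverse_cone W A F) (dproj W (lin F) \<xi>)
                            * I_mero W F \<xi>))"
    by (rule assms(4)[unfolded BV_family_def, THEN spec, THEN spec, THEN spec, THEN mp])
qed

lemma dproj_dual:
  assumes X: "rational_space X" and L: "rational_subspace X L" and \<xi>: "\<xi> \<in> dual X"
  shows "dproj X L \<xi> \<in> dual (quot X L)"
proof -
  have "qproj X L x = x" if "x \<in> perp X L" for x using qproj_perp[OF X L that] .
  moreover note P = subspace_perp[OF X rational_subspaceD(2)[OF L]]
  ultimately show ?thesis
    using dualD[OF \<xi>] subspace_add[OF P] subspace_scale[OF P]
    unfolding dual_def dproj_def by (simp add: perp_def)
qed

section \<open>Asymptotic series\<close>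

text \<open>Adds the case \<open>M = 0\<close> to a definition that starts at 1. The shift lemma
  meets it when the truncated difference \<open>M - m\<close> is 0.\<close>

lemma asymptotic_seriesD: "asymptotic_series R a \<Longrightarrow>
    (\<lambda>N. R N - (\<Sum>n<M. a n / of_nat N ^ n)) \<in> O(\<lambda>N. 1 / of_nat N ^ M)"
proof (cases "M = 0")
  case True
  assume "asymptotic_series R a"
  hence 1: "(\<lambda>N. R N - (\<Sum>n<1. a n / of_nat N ^ n)) \<in> O(\<lambda>N. 1 / of_nat N ^ 1)"
    unfolding asymptotic_series_def by blast
  have "(\<lambda>N. 1 / of_nat N ^ 1 :: complex) \<in> O(\<lambda>_. 1)"
  proof (rule landau_o.bigI[of 1])
    show "\<forall>\<^sub>F N in sequentially. norm (1 / of_nat N ^ 1 :: complex) \<le> 1 * norm (1::complex)"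
      using eventually_ge_at_top[of 1] by eventually_elim (auto simp: norm_divide field_simps)
  qed simp
  from landau_o.big_trans[OF 1 this] have "(\<lambda>N. (R N - a 0) + a 0) \<in> O(\<lambda>_. 1)"
    by (intro sum_in_bigo(1)) auto
  thus ?thesis using True by simp
qed (simp add: asymptotic_series_def)

lemma asymptotic_seriesI: "(\<And>M. (\<lambda>N. R N - (\<Sum>n<M. a n / of_nat N ^ n)) \<in> O(\<lambda>N. 1 / of_nat N ^ M)) \<Longrightarrow> asymptotic_series R a"
  by (simp add: asymptotic_series_def)

lemma asymptotic_series_cong:
  assumes "\<forall>\<^sub>F N in sequentially. R N = R' N" "asymptotic_series R a"
  shows "asymptotic_series R' a"
proof (rule asymptotic_seriesI)
  fix M
  have "\<forall>\<^sub>F N in sequentially. R N - (\<Sum>n<M. a n / of_nat N ^ n) = R' N - (\<Sum>n<M. a n / of_nat N ^ n)"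
    using assms(1) by eventually_elim simp
  from landau_o.big.in_cong[OF this] asymptotic_seriesD[OF assms(2), of M]
  show "(\<lambda>N. R' N - (\<Sum>n<M. a n / of_nat N ^ n)) \<in> O(\<lambda>N. 1 / of_nat N ^ M)" by blast
qed

text \<open>When all earlier coefficients agree, the partial sums differ by
  \<open>(a n - b n) / N^n\<close>, yet also by O(\<open>N^(-n-1)\<close>); so
  \<open>a n - b n\<close> is at most a multiple of \<open>1/N\<close>.\<close>

lemma asymptotic_series_unique:
  assumes "asymptotic_series R a" "asymptotic_series R b"
  shows "a n = b n"
proof (induction n rule: less_induct)
  case (less n)
  have "(\<lambda>N. (R N - (\<Sum>k<Suc n. b k / of_nat N ^ k)) - (R N - (\<Sum>k<Suc n. a k / of_nat N ^ k)))
      \<in> O(\<lambda>N. 1 / of_nat N ^ Suc n)"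
    by (intro sum_in_bigo asymptotic_seriesD assms)
  moreover have "(R N - (\<Sum>k<Suc n. b k / of_nat N ^ k)) - (R N - (\<Sum>k<Suc n. a k / of_nat N ^ k))
      = (a n - b n) / of_nat N ^ n" for N
    using less by (simp add: diff_divide_distrib)
  ultimately have "(\<lambda>N. (a n - b n) / of_nat N ^ n) \<in> O(\<lambda>N. 1 / of_nat N ^ Suc n)" by simp
  then obtain K where K: "K > 0"
    "\<forall>\<^sub>F N in sequentially. norm ((a n - b n) / of_nat N ^ n) \<le> K * norm (1 / of_nat N ^ Suc n :: complex)"
    by (elim landau_o.bigE)
  have "\<forall>\<^sub>F N in sequentially. norm (a n - b n) \<le> K / real N"
    using K(2) eventually_gt_at_top[of 0]
    by eventually_elim (simp add: norm_divide norm_power norm_mult field_simps)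
  moreover have "(\<lambda>N. K / real N) \<longlonglongrightarrow> 0" by (rule lim_const_over_n)
  ultimately have "norm (a n - b n) \<le> 0"
    by (intro tendsto_lowerbound[where f = "\<lambda>N. K / real N" and F = sequentially]) auto
  thus ?case by simp
qed

lemma asymptotic_series_scale:
  assumes "asymptotic_series R a"
  shows "asymptotic_series (\<lambda>N. r * R N) (\<lambda>n. r * a n)"
proof (rule asymptotic_seriesI)
  fix M
  have "(\<lambda>N. r * (R N - (\<Sum>n<M. a n / of_nat N ^ n))) \<in> O(\<lambda>N. 1 / of_nat N ^ M)"
    using asymptotic_seriesD[OF assms] by (cases "r = 0") auto
  thus "(\<lambda>N. r * R N - (\<Sum>n<M. r * a n / of_nat N ^ n)) \<in> O(\<lambda>N. 1 / of_nat N ^ M)"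
    by (simp add: algebra_simps sum_distrib_left)
qed

lemma asymptotic_series_sum:
  assumes "finite I" "\<And>i. i \<in> I \<Longrightarrow> asymptotic_series (R i) (a i)"
  shows "asymptotic_series (\<lambda>N. \<Sum>i\<in>I. R i N) (\<lambda>n. \<Sum>i\<in>I. a i n)"
proof (rule asymptotic_seriesI)
  fix M
  have "(\<lambda>N. \<Sum>i\<in>I. R i N - (\<Sum>n<M. a i n / of_nat N ^ n)) \<in> O(\<lambda>N. 1 / of_nat N ^ M)"
    by (intro big_sum_in_bigo asymptotic_seriesD assms)
  moreover have "(\<Sum>i\<in>I. R i N - (\<Sum>n<M. a i n / of_nat N ^ n)) =
      (\<Sum>i\<in>I. R i N) - (\<Sum>n<M. (\<Sum>i\<in>I. a i n) / of_nat N ^ n)" for N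
    by (simp add: sum_subtractf sum_divide_distrib) (rule sum.swap)
  ultimately show "(\<lambda>N. (\<Sum>i\<in>I. R i N) - (\<Sum>n<M. (\<Sum>i\<in>I. a i n) / of_nat N ^ n)) \<in> O(\<lambda>N. 1 / of_nat N ^ M)"
    by simp
qed

lemma asymptotic_series_shift:
  assumes "asymptotic_series R a"
  shows "asymptotic_series (\<lambda>N. R N / of_nat N ^ m) (\<lambda>n. if m \<le> n then a (n - m) else 0)"
proof (rule asymptotic_seriesI)
  fix M
  have "(\<lambda>N. (R N - (\<Sum>n<M - m. a n / of_nat N ^ n)) * (1 / of_nat N ^ m))
      \<in> O(\<lambda>N. 1 / of_nat N ^ (M - m) * (1 / of_nat N ^ m))"
    by (intro landau_o.big.mult asymptotic_seriesD assms) auto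
  \<comment> \<open>The exponents add up to \<open>M - m + m\<close>, which exceeds \<open>M\<close>
    when the subtraction truncates; \<open>1 \<le> N\<close> suffices in both cases.\<close>
  moreover have "(\<lambda>N. 1 / of_nat N ^ (M - m) * (1 / of_nat N ^ m) :: complex) \<in> O(\<lambda>N. 1 / of_nat N ^ M)"
  proof (rule landau_o.bigI[of 1])
    show "\<forall>\<^sub>F N in sequentially. norm (1 / of_nat N ^ (M - m) * (1 / of_nat N ^ m) :: complex)
        \<le> 1 * norm (1 / of_nat N ^ M :: complex)"
      using eventually_ge_at_top[of 1]
    proof eventually_elim
      case (elim N)
      have "real N ^ M \<le> real N ^ (M - m + m)" using elim by (intro power_increasing) auto
      thus ?case using elim by (simp add: norm_divide norm_mult norm_power field_simps flip: power_add)
    qed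
  qed simp
  ultimately have "(\<lambda>N. (R N - (\<Sum>n<M - m. a n / of_nat N ^ n)) * (1 / of_nat N ^ m)) \<in> O(\<lambda>N. 1 / of_nat N ^ M)"
    by (rule landau_o.big_trans)
  moreover have "(\<Sum>n<M. (if m \<le> n then a (n - m) else 0) / of_nat N ^ n)
      = (\<Sum>n<M - m. a n / of_nat N ^ n) * (1 / of_nat N ^ m)" for N
  proof -
    have "(\<Sum>n<M. (if m \<le> n then a (n - m) else 0) / of_nat N ^ n)
        = (\<Sum>n\<in>(\<lambda>n. n + m) ` {..<M - m}. a (n - m) / of_nat N ^ n)"
    proof (rule sum.mono_neutral_cong_right)
      have "n \<in> (\<lambda>n. n + m) ` {..<M - m}" if "m \<le> n" "n < M" for n
        using that by (intro image_eqI[of _ _ "n - m"]) auto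
      thus "\<forall>n\<in>{..<M} - (\<lambda>n. n + m) ` {..<M - m}. (if m \<le> n then a (n - m) else 0) / of_nat N ^ n = 0"
        by auto
    qed auto
    also have "\<dots> = (\<Sum>n<M - m. a n / of_nat N ^ (n + m))"
      by (subst sum.reindex) (auto simp: inj_on_def)
    finally show ?thesis by (simp add: sum_divide_distrib power_add)
  qed
  ultimately show "(\<lambda>N. R N / of_nat N ^ m - (\<Sum>n<M. (if m \<le> n then a (n - m) else 0) / of_nat N ^ n)) \<in> O(\<lambda>N. 1 / of_nat N ^ M)"
    by (simp add: algebra_simps)
qed

section \<open>Taylor expansions at the points \<xi>/N\<close>

lemma dual_divide: "\<xi> \<in> dual X \<Longrightarrow> (\<lambda>x. \<xi> x / of_nat N) \<in> dual X"
  by (auto simp: dual_def add_divide_distrib scaleR_conv_of_real)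

lemma eventually_near0:
  assumes X: "rational_space X" and \<xi>: "\<xi> \<in> dual X" and P: "near0 X P"
  shows "\<forall>\<^sub>F N in sequentially. P (\<lambda>x. \<xi> x / of_nat N)"
proof -
  note Z = zbasis_rational_space[OF X]
  obtain r where r: "r > 0" "\<And>\<xi>. \<xi> \<in> dual X \<Longrightarrow> (\<forall>b\<in>zbasis (lat X). norm (\<xi> b) < r) \<Longrightarrow> P \<xi>"
    using P by (auto simp: near0_def)
  have "\<forall>\<^sub>F N in sequentially. norm (\<xi> b / of_nat N) < r" for b
  proof -
    have "(\<lambda>N. norm (\<xi> b / of_nat N)) \<longlonglongrightarrow> 0" by (rule tendsto_norm_zero) (rule lim_const_over_n)
    thus ?thesis using r(1) by (rule order_tendstoD)
  qed
  hence "\<forall>\<^sub>F N in sequentially. \<forall>b\<in>zbasis (lat X). norm (\<xi> b / of_nat N) < r"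
    using Z(2) by (simp add: eventually_ball_finite_distrib)
  thus ?thesis by eventually_elim (intro r dual_divide \<xi>)
qed

text \<open>A monomial of degree \<open>k\<close> at \<xi>/N carries \<open>N^(-k)\<close>, so
  grouping by degree produces the coefficients. The remainder is compared with the one at a fixed
  \<open>N0\<close> where the series converges absolutely: in degree at least \<open>M\<close> each
  term is at most \<open>(N0/N)^M\<close> times its modulus at \<open>N0\<close>.\<close>

lemma asymptotic_series_hom_part:
  assumes X: "rational_space X" and \<xi>: "\<xi> \<in> dual X" and f: "analytic_at0_rat X f"
  shows "asymptotic_series (\<lambda>N. f (\<lambda>x. \<xi> x / of_nat N)) (\<lambda>k. hom_part X k f \<xi>)"
proof (rule asymptotic_seriesI)
  fix M
  let ?Z = "zbasis (lat X)"
  note Z = zbasis_rational_space[OF X]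
  \<comment> \<open>This repeats the choice made inside \<open>hom_part\<close>, so unfolding that
    definition yields these coefficients.\<close>
  define c where "c = (SOME c. is_taylor X f c)"
  have "is_taylor X f c" unfolding c_def using f by (auto simp: analytic_at0_rat_def intro: someI[of "is_taylor X f"])
  hence ev: "\<forall>\<^sub>F N in sequentially. ((\<lambda>\<alpha>. c \<alpha> * dmonom X \<alpha> (\<lambda>x. \<xi> x / of_nat N)) has_sum f (\<lambda>x. \<xi> x / of_nat N)) (multi_idx X)"
    unfolding is_taylor_def by (rule eventually_near0[OF X \<xi>])
  define deg where "deg = (\<lambda>\<alpha> :: 'a \<Rightarrow> nat. \<Sum>b\<in>?Z. \<alpha> b)"
  have degE: "(\<Sum>b\<in>?Z. \<alpha> b) = deg \<alpha>" for \<alpha> by (simp add: deg_def)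
  define a where "a = (\<lambda>\<alpha>. c \<alpha> * dmonom X \<alpha> \<xi>)"
  have term_eq: "c \<alpha> * dmonom X \<alpha> (\<lambda>x. \<xi> x / of_nat N) = a \<alpha> / of_nat N ^ deg \<alpha>" for \<alpha> N
    by (simp add: a_def dmonom_def deg_def power_divide prod_dividef power_sum)
  from ev obtain N1 where N1: "\<And>N. N \<ge> N1 \<Longrightarrow> ((\<lambda>\<alpha>. a \<alpha> / of_nat N ^ deg \<alpha>) has_sum f (\<lambda>x. \<xi> x / of_nat N)) (multi_idx X)"
    unfolding term_eq eventually_sequentially by blast
  define N0 where "N0 = max N1 1"
  have hs: "((\<lambda>\<alpha>. a \<alpha> / of_nat N ^ deg \<alpha>) has_sum f (\<lambda>x. \<xi> x / of_nat N)) (multi_idx X)" if "N \<ge> N0" for N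
    using N1 that by (simp add: N0_def)
  define T where "T = {\<alpha>\<in>multi_idx X. deg \<alpha> < M}"
  have finT: "finite T"
  proof (rule finite_subset)
    have le: "\<alpha> b \<le> deg \<alpha>" if "b \<in> ?Z" for b \<alpha>
      unfolding deg_def using that Z(2) by (intro member_le_sum) auto
    show "T \<subseteq> (\<Pi>\<^sub>E b\<in>?Z. {..M})"
    proof
      fix \<alpha> assume "\<alpha> \<in> T"
      thus "\<alpha> \<in> (\<Pi>\<^sub>E b\<in>?Z. {..M})"
        by (auto simp: T_def multi_idx_def PiE_iff) (metis le le_trans less_imp_le_nat)
    qed
  qed (use Z in \<open>auto intro: finite_PiE\<close>)
  have hom: "(\<Sum>k<M. hom_part X k f \<xi> / of_nat N ^ k) = (\<Sum>\<alpha>\<in>T. a \<alpha> / of_nat N ^ deg \<alpha>)" for N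
  proof -
    have "(\<Sum>k<M. hom_part X k f \<xi> / of_nat N ^ k)
        = (\<Sum>k<M. \<Sum>\<alpha>\<in>{\<alpha>\<in>T. deg \<alpha> = k}. a \<alpha> / of_nat N ^ deg \<alpha>)"
    proof (intro sum.cong refl)
      fix k assume "k \<in> {..<M}"
      hence "{\<alpha>\<in>multi_idx X. deg \<alpha> = k} = {\<alpha>\<in>T. deg \<alpha> = k}" by (auto simp: T_def)
      thus "hom_part X k f \<xi> / of_nat N ^ k = (\<Sum>\<alpha>\<in>{\<alpha>\<in>T. deg \<alpha> = k}. a \<alpha> / of_nat N ^ deg \<alpha>)"
        unfolding hom_part_def degE c_def[symmetric] a_def[symmetric]
        by (simp add: sum_divide_distrib)
    qed
    also have "\<dots> = (\<Sum>\<alpha>\<in>T. a \<alpha> / of_nat N ^ deg \<alpha>)"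
      using finT by (intro sum.group) (auto simp: T_def)
    finally show ?thesis .
  qed
  define S where "S = multi_idx X - T"
  have "(\<lambda>\<alpha>. a \<alpha> / of_nat N0 ^ deg \<alpha>) summable_on S"
    using hs[of N0] summable_on_subset_banach unfolding S_def by (metis Diff_subset order.refl summable_on_def)
  hence sumS: "(\<lambda>\<alpha>. norm (a \<alpha> / of_nat N0 ^ deg \<alpha>)) summable_on S"
    by (simp add: summable_on_iff_abs_summable_on_complex)
  define K where "K = (\<Sum>\<^sub>\<infinity>\<alpha>\<in>S. norm (a \<alpha> / of_nat N0 ^ deg \<alpha>))"
  have bound: "norm (f (\<lambda>x. \<xi> x / of_nat N) - (\<Sum>k<M. hom_part X k f \<xi> / of_nat N ^ k))
      \<le> (K * real N0 ^ M) * norm (1 / of_nat N ^ M :: complex)" if N: "N \<ge> N0" for N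
  proof -
    have N0: "real N0 > 0" "real N > 0" "real N0 \<le> real N" using N by (auto simp: N0_def)
    have "((\<lambda>\<alpha>. a \<alpha> / of_nat N ^ deg \<alpha>) has_sum
        (f (\<lambda>x. \<xi> x / of_nat N) - (\<Sum>\<alpha>\<in>T. a \<alpha> / of_nat N ^ deg \<alpha>))) S"
      unfolding S_def by (intro has_sum_Diff hs N has_sum_finite finT) (auto simp: T_def)
    moreover have "((\<lambda>\<alpha>. (real N0 / real N) ^ M * norm (a \<alpha> / of_nat N0 ^ deg \<alpha>)) has_sum ((real N0 / real N) ^ M * K)) S"
      unfolding K_def by (intro has_sum_cmult_right has_sum_infsum sumS)
    moreover have "norm (a \<alpha> / of_nat N ^ deg \<alpha>) \<le> (real N0 / real N) ^ M * norm (a \<alpha> / of_nat N0 ^ deg \<alpha>)"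
      if "\<alpha> \<in> S" for \<alpha>
    proof -
      have "M \<le> deg \<alpha>" using that by (auto simp: S_def T_def)
      hence "(real N0 / real N) ^ deg \<alpha> \<le> (real N0 / real N) ^ M"
        using N0 by (intro power_decreasing) auto
      hence "(real N0 / real N) ^ deg \<alpha> * norm (a \<alpha> / of_nat N0 ^ deg \<alpha>)
          \<le> (real N0 / real N) ^ M * norm (a \<alpha> / of_nat N0 ^ deg \<alpha>)"
        by (rule mult_right_mono) simp
      also have "(real N0 / real N) ^ deg \<alpha> * norm (a \<alpha> / of_nat N0 ^ deg \<alpha>) = norm (a \<alpha> / of_nat N ^ deg \<alpha>)"
        using N0 by (simp add: norm_divide norm_power power_divide)
      finally show ?thesis .
    qed
    ultimately have "norm (f (\<lambda>x. \<xi> x / of_nat N) - (\<Sum>\<alpha>\<in>T. a \<alpha> / of_nat N ^ deg \<alpha>)) \<le> (real N0 / real N) ^ M * K"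
      by (rule norm_infsum_le)
    also have "\<dots> = (K * real N0 ^ M) * norm (1 / of_nat N ^ M :: complex)"
      by (simp add: norm_divide norm_power power_divide)
    finally show ?thesis unfolding hom .
  qed
  show "(\<lambda>N. f (\<lambda>x. \<xi> x / of_nat N) - (\<Sum>k<M. hom_part X k f \<xi> / of_nat N ^ k)) \<in> O(\<lambda>N. 1 / of_nat N ^ M)"
    by (rule bigoI[of _ "K * real N0 ^ M"]) (use bound in \<open>auto simp: eventually_sequentially\<close>)
qed

section \<open>Unimodular cones and their faces\<close>

text \<open>The projection kills \<open>V'\<close> and keeps the rest of \<open>B\<close>
  independent. Hence the images of \<open>B - V'\<close> are a lattice basis of the quotient, and
  those of \<open>V - V'\<close> generate the projected cone, which has fewer generators unless
  \<open>V'\<close> is empty. The last claim replaces the transverse cone of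
  \<open>BV_family\<close> by the projected cone of the Riemann sum expansion.\<close>

lemma unimodular_cone_quot:
  assumes X: "rational_space X" and B: "is_zbasis B (lat X)" and V: "V \<subseteq> B" and V': "V' \<subseteq> V"
  defines "L \<equiv> span V'" and "C \<equiv> convex_cone hull V"
  shows "rational_subspace X L" (is ?sub)
    and "is_zbasis (qproj X L ` (B - V')) (lat (quot X L))" (is ?bas)
    and "qproj X L ` C = convex_cone hull (qproj X L ` (V - V'))" (is ?cone)
    and "card (qproj X L ` (V - V')) = card V - card V'" (is ?card)
    and "rational_space (quot X L)" (is ?rat)
    and "transverse_cone X C (convex_cone hull V') = qproj X L ` C" (is ?trans)
proof -
  let ?\<pi> = "qproj X L"
  have V'B: "V' \<subseteq> B" using V V' by auto
  have Bf: "finite B" "independent B" "lat X = int_span B" using B by (auto simp: is_zbasis_def)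
  note Vf = zbasis_subset[OF B V] and V'f = zbasis_subset[OF B V'B]
  note vs = vs_eq_span[OF X B] and sub = rational_spaceD(1)[OF X]
  have Bvs: "B \<subseteq> vs X" using vs span_superset by metis
  have "L \<inter> lat X = int_span V'" unfolding L_def Bf(3) by (rule span_Int_int_span[OF Bf(1,2) V'B])
  hence "is_lattice (L \<inter> lat X) L" unfolding is_lattice_def is_zbasis_def using V'f L_def by blast
  moreover have "L \<subseteq> vs X" unfolding L_def vs using V'B by (rule span_mono)
  ultimately show L: ?sub unfolding rational_subspace_def by (simp add: L_def)
  have ker: "?\<pi> b = 0" if "b \<in> V'" for b
    using qproj_vanish[OF X L, of b] that V'B Bvs by (auto simp: L_def span_base)
  have finS: "finite (B - V')" using Bf by simp
  have \<pi>sum: "?\<pi> (\<Sum>b\<in>T. t b *\<^sub>R b) = (\<Sum>b\<in>T - V'. t b *\<^sub>R ?\<pi> b)" if "T \<subseteq> B" for T t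
  proof -
    have fT: "finite T" using that Bf(1) finite_subset by blast
    have "?\<pi> (\<Sum>b\<in>T. t b *\<^sub>R b) = (\<Sum>b\<in>T. t b *\<^sub>R ?\<pi> b)"
      using that Bvs by (intro qproj_sum[OF X L fT]) auto
    also have "\<dots> = (\<Sum>b\<in>T - V'. t b *\<^sub>R ?\<pi> b)"
      using ker fT by (intro sum.mono_neutral_right) auto
    finally show ?thesis .
  qed
  have ind: "\<forall>b\<in>B - V'. c b = 0" if c: "(\<Sum>b\<in>B - V'. c b *\<^sub>R ?\<pi> b) = 0" for c :: "'a \<Rightarrow> real"
  proof
    fix b assume b: "b \<in> B - V'"
    let ?x = "\<Sum>b\<in>B - V'. c b *\<^sub>R b"
    have "?\<pi> ?x = 0" using \<pi>sum[of "B - V'" c] c by (simp add: Diff_idemp)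
    moreover have "?x \<in> vs X" using Bvs by (intro subspace_sum subspace_scale sub) auto
    ultimately have xL: "?x \<in> span V'" using qproj_vanish[OF X L] by (simp add: L_def)
    \<comment> \<open>\<open>?x\<close> lies in \<open>span V'\<close> but is built from vectors off
      \<open>V'\<close>, so its coordinate at \<open>b\<close> is 0 on the one hand and
      \<open>c b\<close> on the other.\<close>
    have "coord B b ?x = 0"
      using coord_sum[OF V'f(1) Bf(2) V'B, of b "\<lambda>v. coord V' v ?x"] sum_coord[OF V'f xL] b by simp
    thus "c b = 0" using coord_sum[OF finS Bf(2), of b c] b by simp
  qed
  note img = independent_image_explicit[where f = ?\<pi>, OF finS ind]
  have "?\<pi> ` lat X = int_span (?\<pi> ` (B - V'))"
  proof -
    have "?\<pi> ` int_span B = {\<Sum>b\<in>B - V'. t b *\<^sub>R ?\<pi> b | t. \<forall>b\<in>B - V'. t b \<in> \<int>}" (is "_ = ?R")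
    proof
      show "?\<pi> ` int_span B \<subseteq> ?R" unfolding int_span_Ints[of B] using \<pi>sum[of B] by auto
      show "?R \<subseteq> ?\<pi> ` int_span B"
      proof safe
        fix t :: "'a \<Rightarrow> real" assume t: "\<forall>b\<in>B - V'. t b \<in> \<int>"
        have "(\<Sum>b\<in>B. (if b \<in> V' then 0 else t b) *\<^sub>R b) \<in> int_span B"
          unfolding int_span_Ints[of B] using t
          by (intro CollectI exI[of _ "\<lambda>b. if b \<in> V' then 0 else t b"] conjI refl ballI) simp
        moreover have "?\<pi> (\<Sum>b\<in>B. (if b \<in> V' then 0 else t b) *\<^sub>R b) = (\<Sum>b\<in>B - V'. t b *\<^sub>R ?\<pi> b)"
          unfolding \<pi>sum[OF order.refl] by (intro sum.cong) auto
        ultimately show "(\<Sum>b\<in>B - V'. t b *\<^sub>R ?\<pi> b) \<in> ?\<pi> ` int_span B" by (rule rev_image_eqI[OF _ sym])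
      qed
    qed
    also have "\<dots> = int_span (?\<pi> ` (B - V'))"
      unfolding int_span_Ints using sums_over_image[OF finS img(1), where P = "\<lambda>t. t \<in> \<int>"] by simp
    finally show ?thesis by (simp only: Bf(3))
  qed
  thus bas: ?bas unfolding is_zbasis_def quot_simps using img(2) finS by blast
  show ?rat by (rule rational_space_quot[OF X L bas])
  have injV: "inj_on ?\<pi> (V - V')" using img(1) V by (auto intro: inj_on_subset)
  show ?card using card_image[OF injV] card_Diff_subset[OF V'f(1) V'] by simp
  have finV: "finite (V - V')" using Vf by simp
  have "?\<pi> ` C = {\<Sum>b\<in>V - V'. t b *\<^sub>R ?\<pi> b | t. \<forall>b\<in>V - V'. t b \<ge> 0}" (is "_ = ?R")
  proof
    show "?\<pi> ` C \<subseteq> ?R" unfolding C_def convex_cone_hull_finite[OF Vf(1)] using \<pi>sum[OF V] by auto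
    show "?R \<subseteq> ?\<pi> ` C"
    proof safe
      fix t :: "'a \<Rightarrow> real" assume t: "\<forall>b\<in>V - V'. t b \<ge> 0"
      have "(\<Sum>b\<in>V. (if b \<in> V' then 0 else t b) *\<^sub>R b) \<in> C"
        unfolding C_def convex_cone_hull_finite[OF Vf(1)]
        using t by (intro CollectI exI[of _ "\<lambda>b. if b \<in> V' then 0 else t b"] conjI refl ballI) simp
      moreover have "?\<pi> (\<Sum>b\<in>V. (if b \<in> V' then 0 else t b) *\<^sub>R b) = (\<Sum>b\<in>V - V'. t b *\<^sub>R ?\<pi> b)"
        unfolding \<pi>sum[OF V] by (intro sum.cong) auto
      ultimately show "(\<Sum>b\<in>V - V'. t b *\<^sub>R ?\<pi> b) \<in> ?\<pi> ` C" by (rule rev_image_eqI[OF _ sym])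
    qed
  qed
  also have "\<dots> = convex_cone hull (?\<pi> ` (V - V'))"
    using sums_over_image[OF finV injV, where P = "\<lambda>t. t \<ge> 0"] finV by (simp add: convex_cone_hull_finite)
  finally show ?cone .
  have CV: "C \<subseteq> vs X" unfolding C_def vs using V
    by (meson hull_minimal convex_cone_span span_superset order_trans)
  have F: "convex_cone hull V' \<subseteq> L" unfolding L_def by (intro hull_minimal span_superset convex_cone_span)
  have FC: "convex_cone hull V' \<subseteq> C" unfolding C_def by (rule hull_mono[OF V'])
  have LV: "L \<subseteq> vs X" by (rule rational_subspaceD(2)[OF L])
  have subL: "subspace L" unfolding L_def by simp
  show ?trans unfolding transverse_cone_def lin_convex_cone_hull L_def[symmetric]
  proof
    \<comment> \<open>The tangent cone lies in \<open>C - L\<close>, and elements of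
      \<open>L\<close> disappear under the projection.\<close>
    have tan: "tangent_cone C (convex_cone hull V') \<subseteq> {y - x | x y. x \<in> L \<and> y \<in> C}"
      unfolding tangent_cone_def
    proof (rule hull_minimal)
      show "{y - x |x y. y \<in> C \<and> x \<in> convex_cone hull V'} \<subseteq> {y - x | x y. x \<in> L \<and> y \<in> C}" using F by blast
      show "convex_cone {y - x | x y. x \<in> L \<and> y \<in> C}"
      proof (subst convex_cone_iff, intro conjI ballI allI impI)
        show "0 \<in> {y - x | x y. x \<in> L \<and> y \<in> C}"
          using subspace_0[OF subL] convex_cone_hull_contains_0[of V] unfolding C_def by force
        fix u assume "u \<in> {y - x | x y. x \<in> L \<and> y \<in> C}"
        then obtain x y where u: "u = y - x" "x \<in> L" "y \<in> C" by auto
        show "r *\<^sub>R u \<in> {y - x | x y. x \<in> L \<and> y \<in> C}" if "0 \<le> r" for r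
          using u that subspace_scale[OF subL] convex_cone_hull_mul[of y V r] unfolding C_def
          by (intro CollectI exI[of _ "r *\<^sub>R x"] exI[of _ "r *\<^sub>R y"]) (auto simp: scaleR_diff_right)
        fix w assume "w \<in> {y - x | x y. x \<in> L \<and> y \<in> C}"
        then obtain x' y' where w: "w = y' - x'" "x' \<in> L" "y' \<in> C" by auto
        show "u + w \<in> {y - x | x y. x \<in> L \<and> y \<in> C}"
          using u w subspace_add[OF subL] convex_cone_hull_add[of y V y'] unfolding C_def
          by (intro CollectI exI[of _ "x + x'"] exI[of _ "y + y'"]) auto
      qed
    qed
    have aff: "affine hull (convex_cone hull V') \<subseteq> L"
      by (rule hull_minimal) (rule F, rule subspace_imp_affine[OF subL])
    show "?\<pi> ` {a + c |a c. a \<in> affine hull (convex_cone hull V') \<and> c \<in> tangent_cone C (convex_cone hull V')} \<subseteq> ?\<pi> ` C"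
    proof safe
      fix a c assume a: "a \<in> affine hull (convex_cone hull V')" and c: "c \<in> tangent_cone C (convex_cone hull V')"
      obtain x y where xy: "c = y - x" "x \<in> L" "y \<in> C" using c tan by blast
      have ax: "a - x \<in> L" using a aff xy subspace_diff[OF subL] by blast
      hence axV: "a - x \<in> vs X" using LV by blast
      have yV: "y \<in> vs X" using xy CV by blast
      have e: "a + c = (a - x) + y" using xy by simp
      have "?\<pi> (a + c) = ?\<pi> y"
        unfolding e qproj_linear(1)[OF X L axV yV] using qproj_vanish[OF X L axV] ax by simp
      thus "?\<pi> (a + c) \<in> ?\<pi> ` C" using xy by simp
    qed
    show "?\<pi> ` C \<subseteq> ?\<pi> ` {a + c |a c. a \<in> affine hull (convex_cone hull V') \<and> c \<in> tangent_cone C (convex_cone hull V')}"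
    proof (rule image_mono, rule subsetI)
      fix y assume y: "y \<in> C"
      have 0: "0 \<in> convex_cone hull V'" by (rule convex_cone_hull_contains_0)
      have "y - 0 \<in> tangent_cone C (convex_cone hull V')"
        unfolding tangent_cone_def by (rule hull_inc) (use y 0 in blast)
      moreover have "0 \<in> affine hull (convex_cone hull V')" by (rule hull_inc[OF 0])
      ultimately show "y \<in> {a + c |a c. a \<in> affine hull (convex_cone hull V') \<and> c \<in> tangent_cone C (convex_cone hull V')}"
        by (intro CollectI exI[of _ 0] exI[of _ y]) auto
    qed
  qed
qed

text \<open>The continuation is the reciprocal of the product of the
  \<open>1 - exp (\<xi> b)\<close>, a denominator without zeros where the sum converges. There the
  meromorphic value is the sum itself.\<close>

lemma S_mero_cone:
  assumes X: "rational_space X" and B: "is_zbasis B (lat X)" "V \<subseteq> B"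
    and \<xi>: "\<xi> \<in> dual X" "\<forall>b\<in>V. Re (\<xi> b) < 0"
  defines "C \<equiv> convex_cone hull V"
  shows "\<xi> \<in> S_dom X C" "S_mero X C \<xi> = (\<Sum>\<^sub>\<infinity>\<gamma>\<in>C \<inter> lat X. exp (\<xi> \<gamma>))"
proof -
  note V = zbasis_subset[OF B]
  have Vvs: "V \<subseteq> vs X" using vs_eq_span[OF X B(1)] B(2) span_superset by blast
  have nl: "\<not> contains_line C" unfolding C_def by (rule not_contains_line_cone[OF V])
  note sums = cone_exp_sum[OF X B, folded C_def]
  have S: "\<zeta> \<in> S_conv X C \<longleftrightarrow> \<zeta> \<in> dual X \<and> (\<forall>b\<in>V. Re (\<zeta> b) < 0)" for \<zeta>
    using nl sums(1) by (auto simp: S_conv_def)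
  have nz: "(\<Prod>b\<in>V. 1 - exp (\<zeta> b)) \<noteq> 0" if "\<forall>b\<in>V. Re (\<zeta> b) < 0" for \<zeta>
  proof -
    have "exp (\<zeta> b) \<noteq> 1" if "b \<in> V" for b
      using \<open>\<forall>b\<in>V. Re (\<zeta> b) < 0\<close> that by (metis exp_less_one_iff norm_exp_eq_Re norm_one less_irrefl)
    thus ?thesis using V(1) by auto
  qed
  have rep: "((\<lambda>_. 1), (\<lambda>\<zeta>. \<Prod>b\<in>V. 1 - exp (\<zeta> b))) \<in> mero_rep X (S_conv X C) (S_sum X C)"
    unfolding mero_rep_def
  proof (intro CollectI case_prodI conjI ballI)
    show "entire_on_dual X (\<lambda>_. 1)" by (rule entire_on_dual_1[OF X])
    show "entire_on_dual X (\<lambda>\<zeta>. \<Prod>b\<in>V. 1 - exp (\<zeta> b))"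
      by (rule entire_on_dual_prod_one_minus_exp[OF X V(1) Vvs])
    show "\<exists>\<xi>\<in>dual X. (\<Prod>b\<in>V. 1 - exp (\<xi> b)) \<noteq> 0" using \<xi> nz by blast
    fix \<zeta> assume "\<zeta> \<in> S_conv X C"
    hence *: "\<zeta> \<in> dual X" "\<forall>b\<in>V. Re (\<zeta> b) < 0" using S by auto
    have "(\<Prod>b\<in>V. 1 - exp (\<zeta> b)) * (\<Prod>b\<in>V. inverse (1 - exp (\<zeta> b))) = 1"
      unfolding prod.distrib[symmetric] using nz[OF *(2)] V(1) by (intro prod.neutral) auto
    thus "(\<Prod>b\<in>V. 1 - exp (\<zeta> b)) * S_sum X C \<zeta> = 1"
      using sums(2)[OF *] nl by (simp add: S_sum_def)
  qed
  have in_S: "\<xi> \<in> S_conv X C" using S \<xi> by blast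
  have nz\<xi>: "(\<Prod>b\<in>V. 1 - exp (\<xi> b)) \<noteq> 0" by (rule nz) (rule \<xi>(2))
  note m = mero_repI[where \<xi> = \<xi>, OF rep in_S \<xi>(1)]
  show "\<xi> \<in> S_dom X C" by (rule m(1)[OF nz\<xi>])
  show "S_mero X C \<xi> = (\<Sum>\<^sub>\<infinity>\<gamma>\<in>C \<inter> lat X. exp (\<xi> \<gamma>))"
    unfolding m(2)[OF nz\<xi>] using nl by (simp add: S_sum_def)
qed

text \<open>The continuation is a constant divided by the product of the \<open>\<xi> b\<close>. Its
  degree \<open>- card V\<close> produces the powers of \<open>N\<close> in the expansion, and the
  non-vanishing allows the integral over the face \<open>{0}\<close> to be cancelled.\<close>

lemma I_mero_cone:
  assumes X: "rational_space X" and B: "is_zbasis B (lat X)" "V \<subseteq> B"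
    and \<xi>: "\<xi> \<in> dual X" "\<forall>b\<in>V. Re (\<xi> b) < 0"
  defines "F \<equiv> convex_cone hull V"
  shows "\<xi> \<in> I_dom X F" "I_mero X F \<xi> = poly_integral X F (\<lambda>x. exp (\<xi> x))"
    "poly_integral X F (\<lambda>x. exp (\<xi> x)) \<noteq> 0"
    "N > 0 \<Longrightarrow> poly_integral X F (\<lambda>x. exp (\<xi> x / of_nat N)) = of_nat N ^ card V * poly_integral X F (\<lambda>x. exp (\<xi> x))"
proof -
  note V = zbasis_subset[OF B]
  have Vvs: "V \<subseteq> vs X" using vs_eq_span[OF X B(1)] B(2) span_superset by blast
  have nl: "\<not> contains_line F" unfolding F_def by (rule not_contains_line_cone[OF V])
  obtain k :: real where k: "k > 0"
    "\<And>\<xi>. \<xi> \<in> dual X \<Longrightarrow> set_integrable (aff_measure X F) F (\<lambda>x. exp (\<xi> x)) \<longleftrightarrow> (\<forall>b\<in>V. Re (\<xi> b) < 0)"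
    "\<And>\<xi>. \<xi> \<in> dual X \<Longrightarrow> \<forall>b\<in>V. Re (\<xi> b) < 0 \<Longrightarrow>
      poly_integral X F (\<lambda>x. exp (\<xi> x)) = of_real k * (\<Prod>b\<in>V. - inverse (\<xi> b))"
    using cone_integral[OF X B] unfolding F_def by blast
  have S: "\<zeta> \<in> I_conv X F \<longleftrightarrow> \<zeta> \<in> dual X \<and> (\<forall>b\<in>V. Re (\<zeta> b) < 0)" for \<zeta>
    using nl k(2) by (auto simp: I_conv_def)
  have nzb: "\<zeta> b \<noteq> 0" if "\<forall>b\<in>V. Re (\<zeta> b) < 0" "b \<in> V" for \<zeta> b using that by auto
  have nz: "(\<Prod>b\<in>V. \<zeta> b) \<noteq> 0" if "\<forall>b\<in>V. Re (\<zeta> b) < 0" for \<zeta>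
    using V(1) nzb[OF that] by auto
  have rep: "((\<lambda>_. of_real k * (-1) ^ card V * 1), (\<lambda>\<zeta>. \<Prod>b\<in>V. \<zeta> b)) \<in> mero_rep X (I_conv X F) (I_int X F)"
    unfolding mero_rep_def
  proof (intro CollectI case_prodI conjI ballI)
    show "entire_on_dual X (\<lambda>_. of_real k * (-1) ^ card V * 1)"
      by (intro entire_on_dual_scale entire_on_dual_1[OF X])
    show "entire_on_dual X (\<lambda>\<zeta>. \<Prod>b\<in>V. \<zeta> b)" by (rule entire_on_dual_prod_linear[OF X V(1) Vvs])
    show "\<exists>\<xi>\<in>dual X. (\<Prod>b\<in>V. \<xi> b) \<noteq> 0" using \<xi> nz by blast
    fix \<zeta> assume "\<zeta> \<in> I_conv X F"
    hence *: "\<zeta> \<in> dual X" "\<forall>b\<in>V. Re (\<zeta> b) < 0" using S by auto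
    have "(\<Prod>b\<in>V. \<zeta> b) * (\<Prod>b\<in>V. - inverse (\<zeta> b)) = (\<Prod>b\<in>V. -1)"
      unfolding prod.distrib[symmetric] using nzb[OF *(2)] by (intro prod.cong) auto
    thus "(\<Prod>b\<in>V. \<zeta> b) * I_int X F \<zeta> = of_real k * (-1) ^ card V * 1"
      using k(3)[OF *] nl by (simp add: I_int_def)
  qed
  have in_S: "\<xi> \<in> I_conv X F" using S \<xi> by blast
  have nz\<xi>: "(\<Prod>b\<in>V. \<xi> b) \<noteq> 0" by (rule nz) (rule \<xi>(2))
  note m = mero_repI[where \<xi> = \<xi>, OF rep in_S \<xi>(1)]
  show "\<xi> \<in> I_dom X F" by (rule m(1)[OF nz\<xi>])
  show "I_mero X F \<xi> = poly_integral X F (\<lambda>x. exp (\<xi> x))"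
    unfolding m(2)[OF nz\<xi>] using nl by (simp add: I_int_def)
  show "poly_integral X F (\<lambda>x. exp (\<xi> x)) \<noteq> 0"
    using k(1) k(3)[OF \<xi>] V(1) nzb[OF \<xi>(2)] by auto
  assume N: "N > 0"
  have neg: "\<forall>b\<in>V. Re (\<xi> b / of_nat N) < 0" using \<xi>(2) N by (auto simp: divide_neg_pos)
  have "poly_integral X F (\<lambda>x. exp (\<xi> x / of_nat N)) = of_real k * (\<Prod>b\<in>V. - inverse (\<xi> b / of_nat N))"
    by (rule k(3)[OF dual_divide[OF \<xi>(1)] neg])
  also have "(\<Prod>b\<in>V. - inverse (\<xi> b / of_nat N)) = (\<Prod>b\<in>V. of_nat N * - inverse (\<xi> b))"
    by (intro prod.cong) (auto simp: field_simps)
  also have "\<dots> = of_nat N ^ card V * (\<Prod>b\<in>V. - inverse (\<xi> b))" by (simp only: prod.distrib prod_constant)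
  finally show "poly_integral X F (\<lambda>x. exp (\<xi> x / of_nat N)) = of_nat N ^ card V * poly_integral X F (\<lambda>x. exp (\<xi> x))"
    using k(3)[OF \<xi>] by simp
qed

section \<open>Uniqueness of the symbols\<close>

text \<open>The functions are compared on \<open>F\<close> only, because the test function is the
  exponential only near the cone. Non-integrable functions are covered too, their integral being 0
  by convention.\<close>

lemma poly_integral_scale:
  assumes "\<And>x. x \<in> F \<Longrightarrow> f x = s * g x"
  shows "poly_integral X F f = s * poly_integral X F g"
proof -
  have *: "(\<lambda>x. indicator F x *\<^sub>R f x) = (\<lambda>x. s * (indicator F x *\<^sub>R g x))"
    using assms by (auto simp: indicator_def fun_eq_iff)
  show ?thesis unfolding poly_integral_def set_lebesgue_integral_def *
    by (rule integral_mult_right_zero)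
qed

lemma unimodular_cone_face_quot:
  assumes X: "rational_space X" and B: "is_zbasis B (lat X)" and V: "V \<subseteq> B" and V': "V' \<subseteq> V"
  shows "unimodular_cone (quot X (span V')) (qproj X (span V') ` (convex_cone hull V))"
    and "cdim (qproj X (span V') ` (convex_cone hull V)) = card V - card V'"
proof -
  note Q = unimodular_cone_quot[OF assms]
  have sub: "qproj X (span V') ` (V - V') \<subseteq> qproj X (span V') ` (B - V')" using V by auto
  show "unimodular_cone (quot X (span V')) (qproj X (span V') ` (convex_cone hull V))"
    unfolding unimodular_cone_def using Q(2,3) sub by blast
  show "cdim (qproj X (span V') ` (convex_cone hull V)) = card V - card V'"
    unfolding Q(3) Q(4)[symmetric] by (rule cdim_convex_cone_hull[OF zbasis_subset(2)[OF Q(2) sub]])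
qed

lemma cone_face:
  assumes B: "is_zbasis B \<Lambda>" "V \<subseteq> B" and F: "F \<in> faces (convex_cone hull V)"
  obtains V' where "V' \<subseteq> V" "F = convex_cone hull V'" "lin F = span V'" "cdim F = card V'" "card V' \<le> card V"
proof -
  note V = zbasis_subset[OF B]
  define V' where "V' = V \<inter> F"
  have F': "F = convex_cone hull V'" unfolding V'_def by (rule faces_convex_cone_hull[OF V(1) F])
  have V': "V' \<subseteq> V" by (simp add: V'_def)
  have "V' \<subseteq> B" using V' B(2) by auto
  note V'f = zbasis_subset[OF B(1) this]
  show ?thesis
    using that[OF V' F'] lin_convex_cone_hull[of V'] cdim_convex_cone_hull[OF V'f(2)] F' card_mono[OF V(1) V']
    by simp
qed

text \<open>Locality of the operators is the point. The test function is the exponential on a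
  neighbourhood \<open>U\<close> of the cone, so on each face an operator multiplies it by the
  symbol, and the Riemann sum samples it at points of the cone.\<close>

lemma asymptotic_series_riemann:
  fixes D :: "('a::real_vector) ratspace \<Rightarrow> 'a set \<Rightarrow> 'a set \<Rightarrow> nat \<Rightarrow> ('a \<Rightarrow> complex) \<Rightarrow> 'a \<Rightarrow> complex"
  assumes diff_op: "\<And>X L C n. rational_space X \<Longrightarrow> rational_subspace X L \<Longrightarrow>
      unimodular_cone (quot X L) C \<Longrightarrow> cdim C \<le> n \<Longrightarrow> hom_diff_op X (n - cdim C) (D X L C n)"
    and riemann: "\<And>X C \<phi>. rational_space X \<Longrightarrow> unimodular_cone X C \<Longrightarrow> schwartz X \<phi> \<Longrightarrow>
      asymptotic_series (riemann_sum X C \<phi>)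
        (\<lambda>n. \<Sum>F | F \<in> faces C \<and> cdim C \<le> cdim F + n.
               poly_integral X F (D X (lin F) (qproj X (lin F) ` C) n \<phi>))"
    and X: "rational_space X" and B: "is_zbasis B (lat X)" "V \<subseteq> B"
    and \<xi>: "\<xi> \<in> dual X" "\<forall>b\<in>V. Re (\<xi> b) < 0"
  defines "C \<equiv> convex_cone hull V"
  shows "asymptotic_series (\<lambda>N. (\<Sum>\<^sub>\<infinity>\<gamma>\<in>C \<inter> lat X. exp (\<xi> \<gamma> / of_nat N)) / of_nat N ^ card V)
     (\<lambda>n. \<Sum>F | F \<in> faces C \<and> cdim C \<le> cdim F + n.
        symbol X (D X (lin F) (qproj X (lin F) ` C) n) \<xi> * poly_integral X F (\<lambda>x. exp (\<xi> x)))"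
proof -
  have Bf: "finite B" "independent B" using B(1) by (auto simp: is_zbasis_def)
  note V = zbasis_subset[OF B]
  note vs = vs_eq_span[OF X B(1)] and sub = rational_spaceD(1)[OF X]
  have Bvs: "B \<subseteq> vs X" using vs span_superset by metis
  obtain \<phi> where \<phi>: "\<phi> \<in> tensors B"
    "\<And>x. (\<And>b. b \<in> V \<Longrightarrow> coord B b x > -1) \<Longrightarrow> (\<And>b. b \<in> B - V \<Longrightarrow> \<bar>coord B b x\<bar> < 1) \<Longrightarrow>
       \<phi> x = exp (\<Sum>b\<in>B. coord B b x *\<^sub>R \<xi> b)"
    using tensors_exp_near_cone[OF Bf(1) B(2), of \<xi>] \<xi>(2) by blast
  note sch = schwartz_tensors[OF X B(1) \<phi>(1)]
  define U where "U = {x \<in> vs X. (\<forall>b\<in>V. coord B b x > -1) \<and> (\<forall>b\<in>B - V. \<bar>coord B b x\<bar> < 1)}"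
  have U\<phi>: "\<phi> x = exp (\<xi> x)" if "x \<in> U" for x
  proof -
    have x: "x \<in> vs X" using that by (simp add: U_def)
    have "\<phi> x = exp (\<Sum>b\<in>B. coord B b x *\<^sub>R \<xi> b)" using that by (intro \<phi>(2)) (auto simp: U_def)
    also have "(\<Sum>b\<in>B. coord B b x *\<^sub>R \<xi> b) = \<xi> (\<Sum>b\<in>B. coord B b x *\<^sub>R b)"
      by (rule dual_sum[OF \<xi>(1) sub Bf(1) Bvs, symmetric])
    also have "(\<Sum>b\<in>B. coord B b x *\<^sub>R b) = x" using sum_coord[OF Bf] x vs by simp
    finally show ?thesis .
  qed
  have Uopen: "\<forall>\<^sub>F t in nhds (0::real). x + t *\<^sub>R v \<in> U" if x: "x \<in> U" and v: "v \<in> vs X" for x v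
  proof -
    have lim: "((\<lambda>t. coord B b (x + t *\<^sub>R v)) \<longlongrightarrow> coord B b x) (nhds 0)" for b
    proof -
      have "((\<lambda>t. coord B b x + t * coord B b v) \<longlongrightarrow> coord B b x + 0 * coord B b v) (nhds 0)"
        by (intro tendsto_intros filterlim_ident)
      thus ?thesis by (simp add: coord_add coord_scaleR Bf(2))
    qed
    have "\<forall>\<^sub>F t in nhds 0. coord B b (x + t *\<^sub>R v) > -1" if "b \<in> V" for b
      by (rule order_tendstoD(1)[OF lim]) (use x that in \<open>simp add: U_def\<close>)
    moreover have "\<forall>\<^sub>F t in nhds 0. \<bar>coord B b (x + t *\<^sub>R v)\<bar> < 1" if "b \<in> B - V" for b
      by (rule order_tendstoD(2)[OF tendsto_rabs[OF lim]]) (use x that in \<open>simp add: U_def\<close>)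
    ultimately have "\<forall>\<^sub>F t in nhds 0. (\<forall>b\<in>V. coord B b (x + t *\<^sub>R v) > -1) \<and> (\<forall>b\<in>B - V. \<bar>coord B b (x + t *\<^sub>R v)\<bar> < 1)"
      using V(1) Bf(1) by (intro eventually_conj eventually_ball_finite) auto
    thus ?thesis
    proof eventually_elim
      case (elim t)
      have "x + t *\<^sub>R v \<in> vs X" using x v by (auto simp: U_def intro!: subspace_add subspace_scale sub)
      thus ?case using elim by (simp add: U_def)
    qed
  qed
  have CU: "C \<subseteq> U"
  proof
    fix x assume "x \<in> C"
    then obtain t where t: "x = (\<Sum>b\<in>V. t b *\<^sub>R b)" "\<forall>b\<in>V. t b \<ge> 0"
      by (auto simp: C_def convex_cone_hull_finite[OF V(1)])
    have "x \<in> vs X" unfolding t(1) using B(2) Bvs by (intro subspace_sum subspace_scale sub) auto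
    thus "x \<in> U" using t(2) unfolding U_def t(1) by (force simp: coord_sum[OF V(1) Bf(2) B(2)])
  qed
  have Cconv: "convex_cone C" unfolding C_def by (rule convex_cone_convex_cone_hull)
  have uC: "unimodular_cone X C" unfolding unimodular_cone_def C_def using B by blast
  have cC: "cdim C = card V" unfolding C_def by (rule cdim_convex_cone_hull[OF V(2)])
  \<comment> \<open>This includes \<open>N = 0\<close>, where \<open>inverse 0\<close> and division
    by 0 are both 0.\<close>
  have R: "riemann_sum X C \<phi> N = (\<Sum>\<^sub>\<infinity>\<gamma>\<in>C \<inter> lat X. exp (\<xi> \<gamma> / of_nat N)) / of_nat N ^ card V" for N
  proof -
    have "\<phi> (inverse (real N) *\<^sub>R \<gamma>) = exp (\<xi> \<gamma> / of_nat N)" if "\<gamma> \<in> C \<inter> lat X" for \<gamma>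
    proof -
      have "inverse (real N) *\<^sub>R \<gamma> \<in> C" using that Cconv by (intro convex_cone_scaleR) auto
      moreover have "\<gamma> \<in> vs X" using that lat_memberships(2)[OF X] by blast
      ultimately show ?thesis using U\<phi> CU dualD(2)[OF \<xi>(1)]
        by (auto simp: scaleR_conv_of_real divide_inverse mult.commute subset_iff)
    qed
    hence "(\<Sum>\<^sub>\<infinity>\<gamma>\<in>C \<inter> lat X. \<phi> (inverse (real N) *\<^sub>R \<gamma>)) = (\<Sum>\<^sub>\<infinity>\<gamma>\<in>C \<inter> lat X. exp (\<xi> \<gamma> / of_nat N))"
      by (rule infsum_cong)
    thus ?thesis by (simp only: riemann_sum_def cC)
  qed
  have I: "poly_integral X F (D X (lin F) (qproj X (lin F) ` C) n \<phi>) =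
      symbol X (D X (lin F) (qproj X (lin F) ` C) n) \<xi> * poly_integral X F (\<lambda>x. exp (\<xi> x))"
    if F: "F \<in> faces C" "cdim C \<le> cdim F + n" for F n
  proof (rule poly_integral_scale)
    obtain V' where V': "V' \<subseteq> V" "F = convex_cone hull V'" "lin F = span V'" "cdim F = card V'" "card V' \<le> card V"
      using cone_face[OF B F(1)[unfolded C_def]] by blast
    note Q = unimodular_cone_quot[OF X B V'(1), folded V'(3) C_def]
    note UC = unimodular_cone_face_quot[OF X B V'(1), folded V'(3) C_def]
    have u: "unimodular_cone (quot X (lin F)) (qproj X (lin F) ` C)" by (rule UC(1))
    \<comment> \<open>The projected cone has dimension \<open>cdim C - cdim F\<close>, so the range
      of the sum over faces is exactly the range in which \<open>diff_op\<close> applies.\<close>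
    have "cdim (qproj X (lin F) ` C) \<le> n" using F(2) cC V'(4) UC(2) by simp
    from diff_op[OF X Q(1) u this] obtain m where "hom_diff_op X m (D X (lin F) (qproj X (lin F) ` C) n)" by blast
    fix x assume "x \<in> F"
    moreover have "F \<subseteq> C" using F(1) by (auto simp: faces_def face_of_def)
    ultimately have "x \<in> U" using CU by auto
    show "D X (lin F) (qproj X (lin F) ` C) n \<phi> x = symbol X (D X (lin F) (qproj X (lin F) ` C) n) \<xi> * exp (\<xi> x)"
    proof (rule hom_diff_op_symbol[OF X \<open>hom_diff_op X m _\<close>])
      fix T c
      assume *: "\<And>\<xi> f U x. \<xi> \<in> dual X \<Longrightarrow> smooth_on_space X f \<Longrightarrow> U \<subseteq> vs X \<Longrightarrow>
        (\<And>x v. x \<in> U \<Longrightarrow> v \<in> vs X \<Longrightarrow> \<forall>\<^sub>F t in nhds (0::real). x + t *\<^sub>R v \<in> U) \<Longrightarrow>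
        (\<And>x. x \<in> U \<Longrightarrow> f x = exp (\<xi> x)) \<Longrightarrow> x \<in> U \<Longrightarrow>
        D X (lin F) (qproj X (lin F) ` C) n f x = symbol X (D X (lin F) (qproj X (lin F) ` C) n) \<xi> * exp (\<xi> x)"
      show ?thesis
      proof (rule *[OF \<xi>(1) sch(1)])
        show "U \<subseteq> vs X" by (auto simp: U_def)
      qed (use Uopen U\<phi> \<open>x \<in> U\<close> in auto)
    qed
  qed
  have "asymptotic_series (riemann_sum X C \<phi>) (\<lambda>n. \<Sum>F | F \<in> faces C \<and> cdim C \<le> cdim F + n.
               poly_integral X F (D X (lin F) (qproj X (lin F) ` C) n \<phi>))"
    by (rule riemann[OF X uC sch(2)])
  moreover have "(\<lambda>n. \<Sum>F | F \<in> faces C \<and> cdim C \<le> cdim F + n.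
               poly_integral X F (D X (lin F) (qproj X (lin F) ` C) n \<phi>)) =
      (\<lambda>n. \<Sum>F | F \<in> faces C \<and> cdim C \<le> cdim F + n.
        symbol X (D X (lin F) (qproj X (lin F) ` C) n) \<xi> * poly_integral X F (\<lambda>x. exp (\<xi> x)))"
    using I by (intro ext sum.cong) auto
  moreover have "riemann_sum X C \<phi> = (\<lambda>N. (\<Sum>\<^sub>\<infinity>\<gamma>\<in>C \<inter> lat X. exp (\<xi> \<gamma> / of_nat N)) / of_nat N ^ card V)"
    using R by (rule ext)
  ultimately show ?thesis by simp
qed


lemma unimodular_cone_rational:
  assumes X: "rational_space X" and C: "unimodular_cone X C"
  shows "rational_affine_cone X C"
proof -
  obtain B V where BV: "is_zbasis B (lat X)" "V \<subseteq> B" "C = convex_cone hull V"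
    using C by (auto simp: unimodular_cone_def)
  have Bf: "finite B" "independent B" "lat X = int_span B" using BV(1) by (auto simp: is_zbasis_def)
  have "B \<subseteq> lat X"
    unfolding Bf(3) by (auto simp: int_span_iff[OF Bf(1,2)] coord_basis Bf(2) span_base)
  hence "rational_cone X C"
    unfolding rational_cone_def using BV zbasis_subset(1)[OF BV(1,2)] by blast
  moreover have "rational_point X 0" by (rule rational_point_lat[OF X lat_memberships(1)[OF X]])
  ultimately show ?thesis unfolding rational_affine_cone_def by (intro exI[of _ 0] exI[of _ C]) auto
qed

text \<open>For a face \<open>F\<close> the integral contributes \<open>N^(cdim F)\<close> and the
  normalisation \<open>N^(- card V)\<close>, so the Taylor series of its coefficient is shifted by
  the codimension of \<open>F\<close>. Faces of codimension above \<open>n\<close> thus drop out of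
  the coefficient \<open>n\<close>, which gives the summation range of the Riemann sum
  expansion.\<close>

lemma asymptotic_series_BV:
  assumes X: "rational_space X" and \<mu>: "BV_family X \<mu>" and B: "is_zbasis B (lat X)" "V \<subseteq> B"
    and \<xi>: "\<xi> \<in> dual X" "\<forall>b\<in>V. Re (\<xi> b) < 0"
  defines "C \<equiv> convex_cone hull V"
  shows "asymptotic_series (\<lambda>N. (\<Sum>\<^sub>\<infinity>\<gamma>\<in>C \<inter> lat X. exp (\<xi> \<gamma> / of_nat N)) / of_nat N ^ card V)
     (\<lambda>n. \<Sum>F | F \<in> faces C \<and> cdim C \<le> cdim F + n.
        hom_part (quot X (lin F)) (n - (cdim C - cdim F)) (\<mu> (quot X (lin F)) (qproj X (lin F) ` C)) (dproj X (lin F) \<xi>)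
          * poly_integral X F (\<lambda>x. exp (\<xi> x)))"
proof -
  note V = zbasis_subset[OF B]
  note sub0 = rational_subspace_0[OF X] and q0 = quot_0[OF X]
  have uC: "unimodular_cone X C" unfolding unimodular_cone_def C_def using B by blast
  have cC: "cdim C = card V" unfolding C_def by (rule cdim_convex_cone_hull[OF V(2)])
  have finF: "finite (faces C)" unfolding C_def by (rule finite_faces_cone[OF V(1)])
  define I where "I = (\<lambda>F. poly_integral X F (\<lambda>x. exp (\<xi> x)))"
  define g where "g = (\<lambda>F. \<mu> (quot X (lin F)) (qproj X (lin F) ` C))"
  define h where "h = (\<lambda>F k. hom_part (quot X (lin F)) k (g F) (dproj X (lin F) \<xi>))"
  have face: "asymptotic_series (\<lambda>N. g F (\<lambda>x. dproj X (lin F) \<xi> x / of_nat N)) (h F)"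
    "transverse_cone X C F = qproj X (lin F) ` C" "cdim F \<le> card V"
    "\<And>N. N > 0 \<Longrightarrow> (\<lambda>x. \<xi> x / of_nat N) \<in> I_dom X F"
    "\<And>N. N > 0 \<Longrightarrow> I_mero X F (\<lambda>x. \<xi> x / of_nat N) = of_nat N ^ cdim F * I F"
    if F: "F \<in> faces C" for F
  proof -
    obtain V' where V': "V' \<subseteq> V" "F = convex_cone hull V'" "lin F = span V'" "cdim F = card V'" "card V' \<le> card V"
      using cone_face[OF B F[unfolded C_def]] by blast
    note Q = unimodular_cone_quot[OF X B V'(1), folded V'(2,3) C_def]
    note UC = unimodular_cone_face_quot[OF X B V'(1), folded V'(3) C_def]
    have rc: "rational_affine_cone (quot X (lin F)) (qproj X (lin F) ` C)"
      by (rule unimodular_cone_rational[OF Q(5) UC(1)])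
    have "analytic_at0_rat (quot X (lin F)) (g F)"
      using \<mu>[unfolded BV_family_def, THEN spec, THEN spec, THEN spec, THEN mp, OF conjI[OF Q(1) conjI[OF refl rc]]]
      unfolding g_def by blast
    thus "asymptotic_series (\<lambda>N. g F (\<lambda>x. dproj X (lin F) \<xi> x / of_nat N)) (h F)"
      unfolding h_def by (intro asymptotic_series_hom_part Q(5) dproj_dual[OF X Q(1) \<xi>(1)])
    show "transverse_cone X C F = qproj X (lin F) ` C" by (rule Q(6))
    show "cdim F \<le> card V" using V' by simp
    have V'B: "V' \<subseteq> B" using V'(1) B(2) by auto
    have neg: "\<forall>b\<in>V'. Re (\<xi> b) < 0" using \<xi>(2) V'(1) by auto
    fix N :: nat assume N: "N > 0"
    have negN: "\<forall>b\<in>V'. Re (\<xi> b / of_nat N) < 0" using neg N by (auto simp: divide_neg_pos)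
    note IN = I_mero_cone[OF X B(1) V'B dual_divide[OF \<xi>(1)] negN, folded V'(2)]
    show "(\<lambda>x. \<xi> x / of_nat N) \<in> I_dom X F" by (rule IN(1))
    show "I_mero X F (\<lambda>x. \<xi> x / of_nat N) = of_nat N ^ cdim F * I F"
      unfolding IN(2) V'(4) I_def by (rule I_mero_cone(4)[OF X B(1) V'B \<xi>(1) neg N, folded V'(2)])
  qed
  have "near0 X (\<lambda>\<xi>. \<xi> \<in> S_dom X C \<longrightarrow> (\<forall>F\<in>faces C. \<xi> \<in> I_dom X F) \<longrightarrow>
           S_mero X C \<xi> =
             (\<Sum>F\<in>faces C. \<mu> (quot X (lin F)) (transverse_cone X C F) (dproj X (lin F) \<xi>) * I_mero X F \<xi>))"
    using \<mu>[unfolded BV_family_def, THEN spec, THEN spec, THEN spec, THEN mp,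
        OF conjI[OF sub0 conjI[OF q0[symmetric] unimodular_cone_rational[OF X uC]]]]
    by (elim conjE)
  \<comment> \<open>The germ identity is applied along the sequence \<xi>/N only. The real parts on
    \<open>V\<close> stay negative there, so every function involved is regular.\<close>
  from eventually_near0[OF X \<xi>(1) this] eventually_gt_at_top[of 0]
  have ev: "\<forall>\<^sub>F N in sequentially. (\<Sum>F\<in>faces C. I F * (g F (\<lambda>x. dproj X (lin F) \<xi> x / of_nat N) / of_nat N ^ (card V - cdim F)))
      = (\<Sum>\<^sub>\<infinity>\<gamma>\<in>C \<inter> lat X. exp (\<xi> \<gamma> / of_nat N)) / of_nat N ^ card V"
  proof eventually_elim
    case (elim N)
    have negN: "\<forall>b\<in>V. Re (\<xi> b / of_nat N) < 0" using \<xi>(2) elim(2) by (auto simp: divide_neg_pos)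
    note SN = S_mero_cone[OF X B dual_divide[OF \<xi>(1)] negN, folded C_def]
    have dp: "dproj X L (\<lambda>x. \<xi> x / of_nat N) = (\<lambda>x. dproj X L \<xi> x / of_nat N)" for L
      by (simp add: dproj_def fun_eq_iff)
    have "(\<Sum>\<^sub>\<infinity>\<gamma>\<in>C \<inter> lat X. exp (\<xi> \<gamma> / of_nat N))
        = (\<Sum>F\<in>faces C. \<mu> (quot X (lin F)) (transverse_cone X C F) (dproj X (lin F) (\<lambda>x. \<xi> x / of_nat N))
            * I_mero X F (\<lambda>x. \<xi> x / of_nat N))"
      using elim(1) SN face(4)[OF _ elim(2)] by simp
    also have "\<dots> = (\<Sum>F\<in>faces C. g F (\<lambda>x. dproj X (lin F) \<xi> x / of_nat N) * (of_nat N ^ cdim F * I F))"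
      by (intro sum.cong refl) (simp only: face(2) face(5)[OF _ elim(2)] dp g_def)
    finally have *: "(\<Sum>\<^sub>\<infinity>\<gamma>\<in>C \<inter> lat X. exp (\<xi> \<gamma> / of_nat N)) / of_nat N ^ card V
        = (\<Sum>F\<in>faces C. g F (\<lambda>x. dproj X (lin F) \<xi> x / of_nat N) * (of_nat N ^ cdim F * I F) / of_nat N ^ card V)"
      by (simp add: sum_divide_distrib)
    have "(of_nat N :: complex) ^ card V = of_nat N ^ (card V - cdim F) * of_nat N ^ cdim F" if "F \<in> faces C" for F
      using face(3)[OF that] by (simp flip: power_add)
    thus ?case unfolding * using elim(2) by (intro sum.cong refl) (simp add: field_simps)
  qed
  have "asymptotic_series (\<lambda>N. \<Sum>F\<in>faces C. I F * (g F (\<lambda>x. dproj X (lin F) \<xi> x / of_nat N) / of_nat N ^ (card V - cdim F)))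
      (\<lambda>n. \<Sum>F\<in>faces C. I F * (if card V - cdim F \<le> n then h F (n - (card V - cdim F)) else 0))"
    by (intro asymptotic_series_sum finF asymptotic_series_scale asymptotic_series_shift face(1))
  from asymptotic_series_cong[OF ev this]
  have "asymptotic_series (\<lambda>N. (\<Sum>\<^sub>\<infinity>\<gamma>\<in>C \<inter> lat X. exp (\<xi> \<gamma> / of_nat N)) / of_nat N ^ card V)
      (\<lambda>n. \<Sum>F\<in>faces C. I F * (if card V - cdim F \<le> n then h F (n - (card V - cdim F)) else 0))" .
  also have "(\<lambda>n. \<Sum>F\<in>faces C. I F * (if card V - cdim F \<le> n then h F (n - (card V - cdim F)) else 0))
      = (\<lambda>n. \<Sum>F | F \<in> faces C \<and> cdim C \<le> cdim F + n. h F (n - (cdim C - cdim F)) * I F)"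
  proof
    fix n
    show "(\<Sum>F\<in>faces C. I F * (if card V - cdim F \<le> n then h F (n - (card V - cdim F)) else 0))
      = (\<Sum>F | F \<in> faces C \<and> cdim C \<le> cdim F + n. h F (n - (cdim C - cdim F)) * I F)"
      using finF cC by (intro sum.mono_neutral_cong_right) auto
  qed
  finally show ?thesis unfolding h_def g_def I_def .
qed

text \<open>
  If \<open>\<eta>\<close> is \<open>-1\<close> on \<open>V\<close>, then \<open>\<xi> + z\<eta>\<close> satisfies the hypothesis of \<open>eq\<close> once \<open>Re z\<close> is large, and both sides are
  holomorphic in \<open>z\<close>.
\<close>

lemma symbol_eq_of_eq_on_cone:
  assumes X: "rational_space X" and D: "hom_diff_op X m D" and B: "is_zbasis B (lat X)" "V \<subseteq> B"
    and eq: "\<And>\<xi>. \<xi> \<in> dual X \<Longrightarrow> \<forall>b\<in>V. Re (\<xi> b) < 0 \<Longrightarrow> symbol X D \<xi> = hom_part X k f \<xi>"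
    and \<xi>: "\<xi> \<in> dual X"
  shows "symbol X D \<xi> = hom_part X k f \<xi>"
proof -
  note V = zbasis_subset[OF B]
  have Bf: "independent B" using B(1) by (auto simp: is_zbasis_def)
  \<comment> \<open>Minus the sum of the coordinates along \<open>V\<close>; as a combination of
    coordinate functionals it lies in the dual.\<close>
  define \<eta> :: "'a \<Rightarrow> complex" where "\<eta> = (\<lambda>x. - of_real (\<Sum>b\<in>V. coord B b x))"
  have \<eta>: "\<eta> \<in> dual X"
    unfolding dual_def \<eta>_def
    by (simp add: coord_add coord_scaleR Bf sum.distrib scaleR_conv_of_real flip: sum_distrib_left)
  have \<eta>V: "\<eta> b = -1" if "b \<in> V" for b
  proof -
    have "(\<Sum>c\<in>V. coord B c b) = (\<Sum>c\<in>V. if c = b then 1 else 0)"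
      using that B(2) by (intro sum.cong) (auto simp: coord_basis Bf)
    also have "\<dots> = 1" using V(1) that by simp
    finally show ?thesis by (simp only: \<eta>_def of_real_1)
  qed
  define \<zeta> where "\<zeta> = (\<lambda>z x. \<xi> x + z * \<eta> x)"
  have \<zeta>: "\<zeta> z \<in> dual X" for z
    using \<xi> \<eta> by (auto simp: dual_def \<zeta>_def algebra_simps)
  have lin: "(\<lambda>z. \<zeta> z x) holomorphic_on UNIV" for x
    unfolding \<zeta>_def by (intro holomorphic_intros)
  obtain T c where T: "\<And>\<xi>. \<xi> \<in> dual X \<Longrightarrow> symbol X D \<xi> = (\<Sum>us\<in>T. c us * prod_list (map \<xi> us))"
    using hom_diff_op_symbol[OF X D] by metis
  have "(\<lambda>z. prod_list (map (\<zeta> z) us)) holomorphic_on UNIV" for us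
    by (induction us) (auto intro!: holomorphic_intros lin)
  hence holo: "(\<lambda>z. symbol X D (\<zeta> z)) holomorphic_on UNIV"
    unfolding T[OF \<zeta>] by (intro holomorphic_intros)
  have holo': "(\<lambda>z. hom_part X k f (\<zeta> z)) holomorphic_on UNIV"
    unfolding hom_part_def dmonom_def by (intro holomorphic_intros lin)
  \<comment> \<open>On a generator, \<open>\<zeta> z\<close> has real part
    \<open>Re (\<xi> b) - Re z\<close>, and \<open>t0\<close> dominates every
    \<open>Re (\<xi> b)\<close>.\<close>
  define t0 where "t0 = (\<Sum>b\<in>V. \<bar>Re (\<xi> b)\<bar>)"
  have eq': "symbol X D (\<zeta> z) = hom_part X k f (\<zeta> z)" if "z \<in> {z. Re z > t0}" for z
  proof (rule eq[OF \<zeta>], intro ballI)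
    fix b assume b: "b \<in> V"
    have "\<bar>Re (\<xi> b)\<bar> \<le> t0" unfolding t0_def using b V(1) by (intro member_le_sum) auto
    thus "Re (\<zeta> z b) < 0" using that by (simp add: \<zeta>_def \<eta>V[OF b])
  qed
  have "complex_of_real (t0 + 1) \<in> {z. Re z > t0}" by simp
  hence "{z. Re z > t0} \<noteq> {}" by blast
  from analytic_continuation_open[OF open_halfspace_Re_gt open_UNIV this connected_UNIV subset_UNIV holo holo' eq', of 0]
  show ?thesis by (simp add: \<zeta>_def)
qed

text \<open>The induction ranges over all rational spaces at once, since the term of a face is a
  statement about the quotient by its span; \<open>quotients\<close> and
  \<open>BV_family_quot\<close> carry the two sides there. All terms of one coefficient share the
  index \<open>n\<close>, so \<open>n\<close> stays fixed while the number of generators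
  drops.\<close>

lemma symbol_unimodular_cone:
  fixes D :: "('a::real_vector) ratspace \<Rightarrow> 'a set \<Rightarrow> 'a set \<Rightarrow> nat \<Rightarrow> ('a \<Rightarrow> complex) \<Rightarrow> 'a \<Rightarrow> complex"
  assumes diff_op: "\<And>X L C n. rational_space X \<Longrightarrow> rational_subspace X L \<Longrightarrow>
      unimodular_cone (quot X L) C \<Longrightarrow> cdim C \<le> n \<Longrightarrow> hom_diff_op X (n - cdim C) (D X L C n)"
    and quotients: "\<And>X L C n \<xi>. rational_space X \<Longrightarrow> rational_subspace X L \<Longrightarrow>
      unimodular_cone (quot X L) C \<Longrightarrow> cdim C \<le> n \<Longrightarrow> \<xi> \<in> dual X \<Longrightarrow>
      symbol X (D X L C n) \<xi> = symbol (quot X L) (D (quot X L) {0} C n) (dproj X L \<xi>)"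
    and riemann: "\<And>X C \<phi>. rational_space X \<Longrightarrow> unimodular_cone X C \<Longrightarrow> schwartz X \<phi> \<Longrightarrow>
      asymptotic_series (riemann_sum X C \<phi>)
        (\<lambda>n. \<Sum>F | F \<in> faces C \<and> cdim C \<le> cdim F + n.
               poly_integral X F (D X (lin F) (qproj X (lin F) ` C) n \<phi>))"
    and "rational_space X" "BV_family X \<mu>" "is_zbasis B (lat X)" "V \<subseteq> B" "card V \<le> n" "\<xi> \<in> dual X"
  shows "symbol X (D X {0} (convex_cone hull V) n) \<xi> = hom_part X (n - card V) (\<mu> X (convex_cone hull V)) \<xi>"
  using assms(4-9)
proof (induction "card V" arbitrary: X B V \<xi> rule: less_induct)
  case less
  note X = less.prems(1) and \<mu> = less.prems(2) and B = less.prems(3,4) and n = less.prems(5)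
  define C where "C = convex_cone hull V"
  note V = zbasis_subset[OF B]
  have uC: "unimodular_cone X C" unfolding unimodular_cone_def C_def using B by blast
  have cC: "cdim C = card V" unfolding C_def by (rule cdim_convex_cone_hull[OF V(2)])
  have finF: "finite (faces C)" unfolding C_def by (rule finite_faces_cone[OF V(1)])
  have D: "hom_diff_op X (n - cdim C) (D X {0} C n)"
    using diff_op[OF X rational_subspace_0[OF X], unfolded quot_0[OF X], OF uC] n cC by simp
  have "symbol X (D X {0} C n) \<xi> = hom_part X (n - card V) (\<mu> X C) \<xi>"
  proof (rule symbol_eq_of_eq_on_cone[OF X D B _ less.prems(6)])
    fix \<xi> assume \<xi>: "\<xi> \<in> dual X" "\<forall>b\<in>V. Re (\<xi> b) < 0"
    define I where "I = (\<lambda>F. poly_integral X F (\<lambda>x. exp (\<xi> x)))"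
    define s where "s = (\<lambda>F. symbol X (D X (lin F) (qproj X (lin F) ` C) n) \<xi>)"
    define h where "h = (\<lambda>F. hom_part (quot X (lin F)) (n - (cdim C - cdim F)) (\<mu> (quot X (lin F)) (qproj X (lin F) ` C)) (dproj X (lin F) \<xi>))"
    define A where "A = {F. F \<in> faces C \<and> cdim C \<le> cdim F + n}"
    have finA: "finite A" unfolding A_def using finF by simp
    \<comment> \<open>Both series expand the same function of \<open>N\<close>, so their
      coefficients at \<open>n\<close> coincide.\<close>
    have sum_eq: "(\<Sum>F\<in>A. s F * I F) = (\<Sum>F\<in>A. h F * I F)"
      using asymptotic_series_unique[OF asymptotic_series_riemann[OF diff_op riemann X B \<xi>]
          asymptotic_series_BV[OF X \<mu> B \<xi>], of n]
      unfolding A_def s_def h_def I_def C_def .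
    have lin0: "lin {0::'a} = {0}" by (simp add: lin_def)
    have cdim0: "cdim {0::'a} = 0" using cdim_convex_cone_hull[OF independent_empty] by simp
    have zeroA: "{0} \<in> A" unfolding A_def C_def using zero_face_cone[OF V] n cC[unfolded C_def] by simp
    have "s F = h F" if F: "F \<in> A - {{0}}" for F
    proof -
      obtain V' where V': "V' \<subseteq> V" "F = convex_cone hull V'" "lin F = span V'" "cdim F = card V'" "card V' \<le> card V"
        using cone_face[OF B, of F] F unfolding A_def C_def by blast
      note Q = unimodular_cone_quot[OF X B V'(1), folded V'(2,3) C_def]
      note UC = unimodular_cone_face_quot[OF X B V'(1), folded V'(3) C_def]
      have "V' \<noteq> {}" using F V'(2) by auto
      hence "card V' > 0" using finite_subset[OF V'(1) V(1)] by (simp add: card_gt_0_iff)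
      hence less_card: "card (qproj X (lin F) ` (V - V')) < card V" using Q(4) V'(5) by linarith
      have cn: "cdim (qproj X (lin F) ` C) \<le> n" using F UC(2) cC V'(4) unfolding A_def by simp linarith
      have subs: "qproj X (lin F) ` (V - V') \<subseteq> qproj X (lin F) ` (B - V')" using B(2) by auto
      have "s F = symbol (quot X (lin F)) (D (quot X (lin F)) {0} (qproj X (lin F) ` C) n) (dproj X (lin F) \<xi>)"
        unfolding s_def by (rule quotients[OF X Q(1) UC(1) cn \<xi>(1)])
      also have "\<dots> = hom_part (quot X (lin F)) (n - card (qproj X (lin F) ` (V - V')))
          (\<mu> (quot X (lin F)) (qproj X (lin F) ` C)) (dproj X (lin F) \<xi>)"
        unfolding Q(3)
        by (rule less.hyps[OF less_card Q(5) BV_family_quot[OF X Q(1,5) \<mu>] Q(2) subs _ dproj_dual[OF X Q(1) \<xi>(1)]])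
          (use cn UC(2) Q(4) in simp)
      also have "card (qproj X (lin F) ` (V - V')) = cdim C - cdim F" using Q(4) cC V'(4) by simp
      finally show "s F = h F" unfolding h_def .
    qed
    hence "(\<Sum>F\<in>A - {{0}}. s F * I F) = (\<Sum>F\<in>A - {{0}}. h F * I F)" by (intro sum.cong) auto
    hence "s {0} * I {0} = h {0} * I {0}"
      using sum_eq sum.remove[OF finA zeroA, of "\<lambda>F. s F * I F"] sum.remove[OF finA zeroA, of "\<lambda>F. h F * I F"] by simp
    \<comment> \<open>The face \<open>{0}\<close> is the cone over the empty set of
      generators.\<close>
    moreover have "I {0} \<noteq> 0"
      using I_mero_cone(3)[OF X B(1) _ \<xi>(1), of "{}"] by (simp add: I_def)
    ultimately have sh: "s {0} = h {0}" by simp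
    have Cvs: "C \<subseteq> vs X"
      unfolding C_def vs_eq_span[OF X B(1)]
      using B(2) by (meson hull_minimal convex_cone_span span_superset order_trans)
    \<comment> \<open>\<open>qproj X {0}\<close> is known to be the identity on \<open>vs X\<close>
      only, so the term of \<open>{0}\<close> is matched with the claim through the image of
      \<open>C\<close> and the values of \<xi> on the lattice basis.\<close>
    have qid: "qproj X {0} x = x" if "x \<in> vs X" for x
      using qproj(2)[OF X rational_subspace_0[OF X] that] by simp
    have img: "qproj X {0} ` C = C"
    proof -
      have "qproj X {0} ` C = (\<lambda>x. x) ` C" using qid Cvs by (intro image_cong) auto
      thus ?thesis by simp
    qed
    have "dmonom X \<alpha> (dproj X {0} \<xi>) = dmonom X \<alpha> \<xi>" for \<alpha>
      unfolding dmonom_def dproj_def using qid zbasis_rational_space(5)[OF X] by (intro prod.cong) auto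
    hence "h {0} = hom_part X (n - card V) (\<mu> X C) \<xi>"
      unfolding h_def lin0 cdim0 quot_0[OF X] img cC by (simp add: hom_part_def)
    moreover have "s {0} = symbol X (D X {0} C n) \<xi>" unfolding s_def lin0 img ..
    ultimately show "symbol X (D X {0} C n) \<xi> = hom_part X (n - card V) (\<mu> X C) \<xi>"
      using sh by simp
  qed
  thus ?case unfolding C_def .
qed

theorem theorem1p2:
  fixes D :: "('a::real_vector) ratspace \<Rightarrow> 'a set \<Rightarrow> 'a set \<Rightarrow> nat
                \<Rightarrow> ('a \<Rightarrow> complex) \<Rightarrow> 'a \<Rightarrow> complex"
  assumes diff_op: "\<And>X L C n. rational_space X \<Longrightarrow> rational_subspace X L \<Longrightarrow>
      unimodular_cone (quot X L) C \<Longrightarrow> cdim C \<le> n \<Longrightarrow>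
      hom_diff_op X (n - cdim C) (D X L C n)"
    and quotients: "\<And>X L C n \<xi>. rational_space X \<Longrightarrow> rational_subspace X L \<Longrightarrow>
      unimodular_cone (quot X L) C \<Longrightarrow> cdim C \<le> n \<Longrightarrow> \<xi> \<in> dual X \<Longrightarrow>
      symbol X (D X L C n) \<xi> = symbol (quot X L) (D (quot X L) {0} C n) (dproj X L \<xi>)"
    and subspaces: "\<And>X C n \<xi>. rational_space X \<Longrightarrow>
      unimodular_cone X C \<Longrightarrow> cdim C < dim (vs X) \<Longrightarrow> cdim C \<le> n \<Longrightarrow> \<xi> \<in> dual X \<Longrightarrow>
      symbol X (D X {0} C n) \<xi> = symbol (subsp X (lin C)) (D (subsp X (lin C)) {0} C n) \<xi>"
    and dim0: "\<And>X n f x. rational_space X \<Longrightarrow> dim (vs X) = 0 \<Longrightarrow>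
      smooth_on_space X f \<Longrightarrow> x \<in> vs X \<Longrightarrow>
      D X {0} {0} n f x = (if n = 0 then f x else 0)"
    and dim1: "\<And>X u n f x. rational_space X \<Longrightarrow> dim (vs X) = 1 \<Longrightarrow>
      is_zbasis {u} (lat X) \<Longrightarrow> 1 \<le> n \<Longrightarrow> smooth_on_space X f \<Longrightarrow> x \<in> vs X \<Longrightarrow>
      D X {0} (convex_cone hull {u}) n f x
        = - of_real (bern n / fact n) * nablas (replicate (n - 1) u) f x"
    and riemann: "\<And>X C \<phi>. rational_space X \<Longrightarrow> unimodular_cone X C \<Longrightarrow> schwartz X \<phi> \<Longrightarrow>
      asymptotic_series (riemann_sum X C \<phi>)
        (\<lambda>n. \<Sum>F | F \<in> faces C \<and> cdim C \<le> cdim F + n.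
               poly_integral X F (D X (lin F) (qproj X (lin F) ` C) n \<phi>))"
  shows "\<And>X L C n \<mu> \<xi>. rational_space X \<Longrightarrow> rational_subspace X L \<Longrightarrow>
      unimodular_cone (quot X L) C \<Longrightarrow> cdim C \<le> n \<Longrightarrow> BV_family X \<mu> \<Longrightarrow> \<xi> \<in> dual X \<Longrightarrow>
      symbol X (D X L C n) \<xi> = mu_part \<mu> X L (n - cdim C) C \<xi>"
proof -
  fix X :: "'a ratspace" and L C n \<mu> \<xi>
  assume X: "rational_space X" and L: "rational_subspace X L" and C: "unimodular_cone (quot X L) C"
    and n: "cdim C \<le> n" and \<mu>: "BV_family X \<mu>" and \<xi>: "\<xi> \<in> dual X"
  obtain B V where B: "is_zbasis B (lat (quot X L))" "V \<subseteq> B" and CV: "C = convex_cone hull V"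
    using C by (auto simp: unimodular_cone_def)
  \<comment> \<open>The basis of the projected lattice comes from the unimodularity of
    \<open>C\<close>.\<close>
  have Y: "rational_space (quot X L)" by (rule rational_space_quot[OF X L B(1)])
  have cC: "cdim C = card V" unfolding CV by (rule cdim_convex_cone_hull[OF zbasis_subset(2)[OF B]])
  have Vn: "card V \<le> n" using n unfolding cC .
  \<comment> \<open>Hypothesis (1) moves the cone into \<open>quot X L\<close> as a space of its
    own, where it is the case of the zero subspace.\<close>
  have "symbol X (D X L C n) \<xi> = symbol (quot X L) (D (quot X L) {0} C n) (dproj X L \<xi>)"
    by (rule quotients[OF X L C n \<xi>])
  also have "\<dots> = hom_part (quot X L) (n - card V) (\<mu> (quot X L) C) (dproj X L \<xi>)"
    unfolding CV
    by (rule symbol_unimodular_cone[OF diff_op quotients riemann Y BV_family_quot[OF X L Y \<mu>] B Vn dproj_dual[OF X L \<xi>]])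
  finally show "symbol X (D X L C n) \<xi> = mu_part \<mu> X L (n - cdim C) C \<xi>"
    by (simp only: mu_part_def cC)
qed

end
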